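(* Let $\alpha\ge-\frac12$, $\gamma>0$ and $1<p<q<\infty$. Let $\tilde\rho:\mathbb{R}^+\to\mathbb{R}^+$ satisfy the doubling condition and $\int_0^\infty\frac{\tilde\rho(t)}{t^{\gamma-d_\alpha+1}}\,dt<\infty$. Let $\phi:\mathbb{R}^+\to\mathbb{R}^+$ be measurable, with $\phi$ almost decreasing and $r\mapsto r^{d_\alpha/p}\phi(r)$ almost increasing; assume that $\phi$ satisfies the doubling condition, is surjective, and that there is a constant $C_0>0$ such that for all $r>0$, $$\phi(r)\int_0^r\frac{\tilde\rho(t)}{t^{\gamma-d_\alpha+1}}\,dt+\int_r^\infty\frac{\tilde\rho(t)\phi(t)}{t^{\gamma-d_\alpha+1}}\,dt\le C_0(\phi(r))^{p/q}.$$ Then the generalized Dunkl-type Bessel–Riesz operator $I_{\tilde\rho,\gamma}^\alpha$ is bounded from $L^{p,\phi}(\mathbb{R},d\mu_\alpha)$ to $L^{q,\psi}(\mathbb{R},d\mu_\alpha)$, where $\psi(r)=(\phi(r))^{p/q}$: there is a constant $C>0$ such that for all $f\in L^{p,\phi}(\mathbb{R},d\mu_\alpha)$, $$\|I_{\tilde\rho,\gamma}^\alpha f\|_{L^{q,\psi}(\mathbb{R},d\mu_\alpha)}\le C\,\|f\|_{L^{p,\phi}(\mathbb{R},d\mu_\alpha)}.$$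
   Context: Notation: $\mathbb{R}^+=(0,\infty)$; $\alpha\ge-\frac12$ is a fixed real number; $d_\alpha=2\alpha+2$; $d\mu_\alpha(x)=A_\alpha|x|^{2\alpha+1}dx$ on $\mathbb{R}$ with $A_\alpha=(2^{\alpha+1}\Gamma(\alpha+1))^{-1}$; $B(0,r)=(-r,r)$. Dunkl translation: for $x,y\in\mathbb{R}$ and $\theta\in[0,\pi]$ put $(x,y)_\theta=\sqrt{x^2+y^2-2xy\cos\theta}$. For a function $g$ on $\mathbb{R}$ (continuous, or locally integrable with respect to $\mu_\alpha$, in which case the formula is understood for almost every $y$), $$\tau_x^\alpha g(y)=\frac{c_\alpha}{2}\int_0^\pi\Big\{g((x,y)_\theta)+g(-(x,y)_\theta)+\frac{x+y}{(x,y)_\theta}\big[g((x,y)_\theta)-g(-(x,y)_\theta)\big]\Big\}(1-\cos\theta)\sin^{2\alpha}\theta\,d\theta,$$ with $c_\alpha=\big(\int_0^\pi\sin^{2\alpha}\theta\,d\theta\big)^{-1}$; for $\alpha=-\frac12$ it is the ordinary translation $\tau_x^\alpha g(y)=g(x+y)$. The notation $\tau_x^\alpha|f|^p(y)$ means $(\tau_x^\alpha(|f|^p))(y)$. Generalized Dunkl-type Morrey space: for $1\le p<\infty$ and $\phi:\mathbb{R}^+\to\mathbb{R}^+$, $L^{p,\phi}(\mathbb{R},d\mu_\alpha)$ is the set of locally $p$-integrable $f$ on $\mathbb{R}$ with $$\|f\|_{L^{p,\phi}(\mathbb{R},d\mu_\alpha)}=\sup_{r>0,\,x\in\mathbb{R}}\frac1{\phi(r)}\Big(\frac1{r^{d_\alpha}}\int_{B(0,r)}\tau_x^\alpha|f|^p(y)\,d\mu_\alpha(y)\Big)^{1/p}<\infty.$$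 Generalized Dunkl-type Bessel–Riesz operator: $I_{\tilde\rho,\gamma}^\alpha f(x)=\int_{\mathbb{R}}f(y)\,\tau_x^\alpha K_{\tilde\rho,\gamma}^\alpha(y)\,d\mu_\alpha(y)$, where $K_{\tilde\rho,\gamma}^\alpha(x)=\frac{\tilde\rho(|x|)}{(1+|x|)^\gamma}$. A function $\theta:\mathbb{R}^+\to\mathbb{R}^+$ satisfies the doubling condition if there is $C_1>0$ such that $\frac12\le\frac rs\le2$ implies $\frac1{C_1}\le\frac{\theta(r)}{\theta(s)}\le C_1$; it is almost increasing (resp. almost decreasing) if there is $C>0$ with $\theta(r)\le C\theta(s)$ (resp. $\theta(r)\ge C\theta(s)$) for all $r\le s$. *)

theory Defs
  imports "HOL-Analysis.Analysis"
begin

text \<open>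
  Functions on the open half-line are total functions \<^typ>\<open>real \<Rightarrow> real\<close> of which only the
  values at positive arguments are constrained.
\<close>

definition doubling :: "(real \<Rightarrow> real) \<Rightarrow> bool" where
  "doubling \<theta> \<longleftrightarrow> (\<exists>C>0. \<forall>r>0. \<forall>s>0. 1 / 2 \<le> r / s \<and> r / s \<le> 2 \<longrightarrow>
     1 / C \<le> \<theta> r / \<theta> s \<and> \<theta> r / \<theta> s \<le> C)"

definition almost_increasing :: "(real \<Rightarrow> real) \<Rightarrow> bool" where
  "almost_increasing \<theta> \<longleftrightarrow> (\<exists>C>0. \<forall>r>0. \<forall>s\<ge>r. \<theta> r \<le> C * \<theta> s)"

definition almost_decreasing :: "(real \<Rightarrow> real) \<Rightarrow> bool" where
  "almost_decreasing \<theta> \<longleftrightarrow> (\<exists>C>0. \<forall>r>0. \<forall>s\<ge>r. \<theta> r \<ge> C * \<theta> s)"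

definition dunkl_dim :: "real \<Rightarrow> real" where
  "dunkl_dim \<alpha> = 2 * \<alpha> + 2"

definition dunkl_measure :: "real \<Rightarrow> real measure" where
  "dunkl_measure \<alpha> = density lebesgue
     (\<lambda>x. ennreal (inverse (2 powr (\<alpha> + 1) * Gamma (\<alpha> + 1)) * \<bar>x\<bar> powr (2 * \<alpha> + 1)))"

definition dunkl_dist :: "real \<Rightarrow> real \<Rightarrow> real \<Rightarrow> real" where
  "dunkl_dist x y \<theta> = sqrt (x\<^sup>2 + y\<^sup>2 - 2 * x * y * cos \<theta>)"

definition dunkl_const :: "real \<Rightarrow> real" where
  "dunkl_const \<alpha> = inverse (LINT \<theta>:{0..pi}|lebesgue. sin \<theta> powr (2 * \<alpha>))"

text \<open>
  For locally integrable \<open>g\<close> and fixed \<open>x\<close> the integral below converges absolutely for almost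
  every \<open>y\<close>; on the exceptional null set the value is immaterial. Division by
  \<^term>\<open>dunkl_dist x y \<theta> = 0\<close> only happens on null sets, too.
\<close>

definition dunkl_translation :: "real \<Rightarrow> real \<Rightarrow> (real \<Rightarrow> real) \<Rightarrow> real \<Rightarrow> real" where
  "dunkl_translation \<alpha> x g y =
     (if \<alpha> = - 1 / 2 then g (x + y)
      else dunkl_const \<alpha> / 2 *
        (LINT \<theta>:{0..pi}|lebesgue.
          (g (dunkl_dist x y \<theta>) + g (- dunkl_dist x y \<theta>)
           + (x + y) / dunkl_dist x y \<theta> * (g (dunkl_dist x y \<theta>) - g (- dunkl_dist x y \<theta>)))
          * (1 - cos \<theta>) * sin \<theta> powr (2 * \<alpha>)))"

definition locally_p_integrable :: "real \<Rightarrow> real \<Rightarrow> (real \<Rightarrow> complex) \<Rightarrow> bool" where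
  "locally_p_integrable \<alpha> p f \<longleftrightarrow> f \<in> borel_measurable lebesgue \<and>
     (\<forall>K. compact K \<longrightarrow> set_integrable (dunkl_measure \<alpha>) K (\<lambda>x. cmod (f x) powr p))"

text \<open>
  The Dunkl translation does not preserve positivity, but for locally \<open>p\<close>-integrable \<open>f\<close> the
  translate of \<open>\<bar>f\<bar>\<^sup>p\<close> is integrable over \<^term>\<open>ball 0 r\<close> with nonnegative integral,
  since translates of the (even) indicator of the ball are nonnegative.
  So the base of the power below is a nonnegative real.
\<close>

definition dunkl_morrey_norm ::
    "real \<Rightarrow> real \<Rightarrow> (real \<Rightarrow> real) \<Rightarrow> (real \<Rightarrow> complex) \<Rightarrow> ennreal" where
  "dunkl_morrey_norm \<alpha> p \<phi> f =
     (SUP (r, x) \<in> {0<..} \<times> UNIV.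
        ennreal (1 / \<phi> r *
          (1 / r powr dunkl_dim \<alpha> *
            (LINT y:ball 0 r|dunkl_measure \<alpha>.
               dunkl_translation \<alpha> x (\<lambda>z. cmod (f z) powr p) y)) powr (1 / p)))"

definition dunkl_morrey_space ::
    "real \<Rightarrow> real \<Rightarrow> (real \<Rightarrow> real) \<Rightarrow> (real \<Rightarrow> complex) set" where
  "dunkl_morrey_space \<alpha> p \<phi> =
     {f. locally_p_integrable \<alpha> p f \<and> dunkl_morrey_norm \<alpha> p \<phi> f < \<infinity>}"

definition bessel_riesz_kernel :: "(real \<Rightarrow> real) \<Rightarrow> real \<Rightarrow> real \<Rightarrow> real" where
  "bessel_riesz_kernel \<rho> \<gamma> x = \<rho> \<bar>x\<bar> / (1 + \<bar>x\<bar>) powr \<gamma>"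

definition dunkl_bessel_riesz ::
    "real \<Rightarrow> (real \<Rightarrow> real) \<Rightarrow> real \<Rightarrow> (real \<Rightarrow> complex) \<Rightarrow> real \<Rightarrow> complex" where
  "dunkl_bessel_riesz \<alpha> \<rho> \<gamma> f x =
     (LINT y|dunkl_measure \<alpha>.
        f y * complex_of_real (dunkl_translation \<alpha> x (bessel_riesz_kernel \<rho> \<gamma>) y))"

end

theory Submission
  imports Defs
begin

text \<open>
  Write \<open>d\<close> for \<^term>\<open>dunkl_dim \<alpha>\<close>, \<open>\<mu>\<close> for the Dunkl measure, and let \<open>w x r\<close> be a fixed multiple of
  \<open>r * max \<bar>x\<bar> r powr (2 * \<alpha> + 1)\<close>. This is an upper bound for \<open>\<mu> (ball x r)\<close>, and it is
  doubling. The theorem is true for three reasons.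

  \<^bold>\<open>Dunkl averages are averages over balls.\<close> The translation is self-adjoint up to the
  reflection \<open>x \<mapsto> - x\<close>, so the integral of \<open>\<tau>\<^sub>x g\<close> over \<open>ball 0 r\<close> is the integral of \<open>g\<close> against
  the translate \<open>\<tau>\<^sub>-\<^sub>x\<close> of the indicator of that ball. That translate is nonnegative, lives on
  \<open>ball x r \<union> ball (- x) r\<close>, is at most a multiple of \<open>r powr d / w x r\<close>, and on \<open>ball x (r / 2)\<close> is at
  least such a multiple. Hence the Dunkl--Morrey norm is comparable to the classical Morrey norm
  built from the averages of \<open>\<bar>f\<bar> powr p\<close> over \<open>ball x r\<close> with the normalisation \<open>w x r\<close>
  (\<open>dunkl_ball_mean_bounds\<close>). The self-adjointness comes from the product formula: after
  the substitution \<open>z = dunkl_dist x y t\<close> the translation has an explicit kernel which, against \<open>\<mu>\<close>, is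
  unchanged when \<open>(x, y, z)\<close> is replaced by \<open>(- x, z, y)\<close>.

  \<^bold>\<open>The kernel is a superposition of indicators of balls.\<close> Since \<open>\<rho>\<close> is doubling, \<open>\<rho> t * t powr (- \<gamma>)\<close>
  is at most a multiple of the integral of \<open>\<rho> s * s powr (- \<gamma> - 1)\<close> over \<open>s > t\<close>. Translating under the
  integral sign bounds the Bessel--Riesz operator at \<open>x\<close> by the integral over \<open>s > 0\<close> of
  \<open>\<rho> s / s powr (\<gamma> - d + 1)\<close> times the average over \<open>ball x s\<close> of \<open>F y = \<bar>f y\<bar> + \<bar>f (- y)\<bar>\<close>
  (\<open>dunkl_bessel_riesz_le\<close>).

  \<^bold>\<open>Hedberg's argument.\<close> Let \<open>N\<close> bound the Morrey norm of \<open>F\<close>, so that the average of \<open>F\<close> over \<open>ball x s\<close>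
  is at most \<open>2 * N * \<phi> s\<close>, and suppose that all averages of \<open>F\<close> around \<open>x\<close> are at most \<open>t\<close>. Use the
  first bound for \<open>s > r\<close> and the second for \<open>s < r\<close>, where \<open>\<phi> r = t / N\<close>; such an \<open>r\<close> exists because
  \<open>\<phi>\<close> is onto. The integral condition on \<open>\<rho>\<close> and \<open>\<phi>\<close> then bounds the operator at \<open>x\<close> by a multiple of
  \<open>N powr (1 - p / q) * t powr (p / q)\<close>. So a multiple of its \<open>(q / p)\<close>-th power is dominated by the
  maximal function of \<open>F\<close>, and the claim follows from the boundedness of the maximal operator on Morrey
  spaces (\<open>Hedberg_Morrey\<close>).

  The maximal function itself never occurs. That a function \<open>G\<close> is dominated by it is expressed
  as: whenever \<open>0 < t < G x\<close>, some ball around \<open>x\<close> has average above \<open>t\<close>. This only mentions the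
  measurable function \<open>G\<close>, and it avoids powers of extended reals.
\<close>

section \<open>The maximal theorem for a doubling weight\<close>

lemma nn_integral_powr_from_0:
  fixes a c :: real
  assumes "-1 < a" "0 \<le> c"
  shows "(\<integral>\<^sup>+t\<in>{0<..<c}. ennreal (t powr a) \<partial>lborel) = ennreal (c powr (a + 1) / (a + 1))"
proof -
  have "((\<lambda>t. t powr a) has_integral (c powr (a + 1) / (a + 1))) {0<..<c}"
    using has_integral_powr_from_0[OF assms] by (simp add: has_integral_Icc_iff_Ioo)
  then show ?thesis
    by (intro nn_integral_has_integral_lebesgue') auto
qed

abbreviation ball_integral :: "'a::metric_space measure \<Rightarrow> ('a \<Rightarrow> real) \<Rightarrow> 'a \<Rightarrow> real \<Rightarrow> ennreal" where
  "ball_integral M f x r \<equiv> (\<integral>\<^sup>+y\<in>ball x r. ennreal (f y) \<partial>M)"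

text \<open>
  The layer-cake formula for a single number; integrated over a measure space it expresses
  \<open>L\<^sup>p\<close> norms through the measures of level sets.
\<close>
lemma powr_eq_nn_integral:
  fixes a p :: real
  assumes "0 < p" "0 \<le> a"
  shows "ennreal (a powr p) = (\<integral>\<^sup>+t\<in>{0<..<a}. ennreal (p * t powr (p - 1)) \<partial>lborel)"
proof -
  have "(\<integral>\<^sup>+t\<in>{0<..<a}. ennreal (p * t powr (p - 1)) \<partial>lborel)
      = (\<integral>\<^sup>+t. ennreal p * (ennreal (t powr (p - 1)) * indicator {0<..<a} t) \<partial>lborel)"
    using assms by (intro nn_integral_cong) (auto simp: ennreal_mult mult.assoc)
  also have "\<dots> = ennreal p * ennreal (a powr p / p)"
    using nn_integral_powr_from_0[of "p - 1" a] assms by (subst nn_integral_cmult) auto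
  also have "\<dots> = ennreal (a powr p)"
    using assms by (simp flip: ennreal_mult)
  finally show ?thesis by simp
qed

text \<open>
  A measure whose balls are dominated by a doubling weight \<open>w\<close>. Averages over
  balls are normalised by \<open>w x r\<close> rather than by the measure of the ball. Enlarging balls five times is what the Vitali covering lemma asks for; coercivity bounds the radii of
  balls on which an integrable function has large average.
\<close>
locale doubling_weight =
  fixes M :: "'a::euclidean_space measure" and w :: "'a \<Rightarrow> real \<Rightarrow> real" and D :: real
  assumes sets_M [measurable_cong]: "sets M = sets borel"
    and sigma_finite_M: "sigma_finite_measure M"
    and w_pos: "0 < r \<Longrightarrow> 0 < w x r"
    and ball_le_w: "0 < r \<Longrightarrow> emeasure M (ball x r) \<le> ennreal (w x r)"
    and w_doubling: "0 < r \<Longrightarrow> r \<le> s \<Longrightarrow> s \<le> 5 * r \<Longrightarrow> w x s \<le> D * w x r"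
    and w_coercive: "\<exists>R. \<forall>x r. 0 < r \<longrightarrow> w x r \<le> b \<longrightarrow> r \<le> R"
begin

abbreviation maximal_const :: "real \<Rightarrow> real \<Rightarrow> real" where
  "maximal_const p B \<equiv> (2 powr p * D\<^sup>2 * p / (p - 1) + 2 powr p) * B powr p"

lemma space_M [simp]: "space M = UNIV"
  using sets_eq_imp_space_eq[OF sets_M] by simp

lemma D_pos: "0 < D"
proof -
  have "0 < D * w 0 1" using w_pos[of 1 0] w_doubling[of 1 1 0] by simp
  then show ?thesis using w_pos[of 1 0] by (simp add: zero_less_mult_iff)
qed

text \<open>
  Cover \<open>S\<close> by the given balls. Their radii are bounded, so the Vitali lemma selects countably many
  disjoint ones whose fivefold enlargements still cover \<open>S\<close>; doubling and disjointness give the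
  estimate.
\<close>
lemma weak_type:
  fixes F :: "'a \<Rightarrow> ennreal" and t :: real
  assumes [measurable]: "F \<in> borel_measurable borel" "S \<in> sets borel"
    and t: "0 < t"
    and S: "\<And>x. x \<in> S \<Longrightarrow> \<exists>r>0. ennreal (t * w x r) \<le> (\<integral>\<^sup>+y\<in>ball x r. F y \<partial>M)"
  shows "ennreal t * emeasure M S \<le> ennreal D * (\<integral>\<^sup>+y. F y \<partial>M)"
proof (cases "(\<integral>\<^sup>+y. F y \<partial>M) = top")
  case True
  then show ?thesis using D_pos by (simp add: ennreal_mult_top)
next
  case False
  define I where "I = enn2real (\<integral>\<^sup>+y. F y \<partial>M)"
  have I: "(\<integral>\<^sup>+y. F y \<partial>M) = ennreal I" using False by (simp add: I_def less_top)
  have I0: "0 \<le> I" by (simp add: I_def)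
  obtain r where r: "\<And>x. x \<in> S \<Longrightarrow> 0 < r x"
      "\<And>x. x \<in> S \<Longrightarrow> ennreal (t * w x (r x)) \<le> (\<integral>\<^sup>+y\<in>ball x (r x). F y \<partial>M)"
    using S by metis
  obtain R where R: "\<And>x s. 0 < s \<Longrightarrow> w x s \<le> I / t \<Longrightarrow> s \<le> R"
    using w_coercive by blast
  have rR: "r x \<le> R" if "x \<in> S" for x
  proof (rule R[OF r(1)[OF that]])
    have "(\<integral>\<^sup>+y\<in>ball x (r x). F y \<partial>M) \<le> ennreal I"
      unfolding I[symmetric] by (intro nn_integral_mono) (auto simp: indicator_def)
    with r(2)[OF that] have "ennreal (t * w x (r x)) \<le> ennreal I" by (rule order_trans)
    then show "w x (r x) \<le> I / t" using t I0 by (simp add: field_simps)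
  qed
  obtain C where C: "countable C" "C \<subseteq> S"
     "pairwise (\<lambda>i j. disjnt (ball i (r i)) (ball j (r j))) C"
     "S \<subseteq> (\<Union>i\<in>C. ball i (5 * r i))"
    by (rule Vitali_covering_lemma_balls[where S=S and K=S and a="\<lambda>x. x" and r=r and B=R]) (use r(1) rR in force)+
  have "ennreal t * emeasure M S \<le> ennreal t * emeasure M (\<Union>i\<in>C. ball i (5 * r i))"
    using C by (intro mult_left_mono emeasure_mono) (auto intro!: sets.countable_UN')
  also have "emeasure M (\<Union>i\<in>C. ball i (5 * r i))
      = (\<integral>\<^sup>+y. indicator (\<Union>i\<in>C. ball i (5 * r i)) y \<partial>M)"
    using C by (intro nn_integral_indicator[symmetric]) (auto intro!: sets.countable_UN')
  also have "\<dots> \<le> (\<integral>\<^sup>+y. (\<integral>\<^sup>+i. indicator (ball i (5 * r i)) y \<partial>count_space C) \<partial>M)"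
  proof (intro nn_integral_mono)
    fix y
    show "indicator (\<Union>i\<in>C. ball i (5 * r i)) y
        \<le> (\<integral>\<^sup>+i. indicator (ball i (5 * r i)) y \<partial>count_space C)"
    proof (cases "y \<in> (\<Union>i\<in>C. ball i (5 * r i))")
      case True
      then obtain i where i: "i \<in> C" "y \<in> ball i (5 * r i)" by auto
      then show ?thesis
        using nn_integral_ge_point[of i C "\<lambda>i. indicator (ball i (5 * r i)) y :: ennreal"]
        by (simp add: indicator_def split: if_splits)
      qed (simp add: indicator_def)
  qed
  also have "\<dots> = (\<integral>\<^sup>+i. emeasure M (ball i (5 * r i)) \<partial>count_space C)"
    by (subst nn_integral_count_space_nn_integral[OF \<open>countable C\<close>])
      (auto intro!: borel_measurable_indicator)
  also have "ennreal t * \<dots> = (\<integral>\<^sup>+i. ennreal t * emeasure M (ball i (5 * r i)) \<partial>count_space C)"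
    by (rule nn_integral_cmult[symmetric]) simp
  also have "\<dots> \<le> (\<integral>\<^sup>+i. ennreal D * (\<integral>\<^sup>+y\<in>ball i (r i). F y \<partial>M) \<partial>count_space C)"
  proof (intro nn_integral_mono)
    fix i assume "i \<in> space (count_space C)"
    then have i: "i \<in> S" using C by auto
    have "ennreal t * emeasure M (ball i (5 * r i)) \<le> ennreal t * ennreal (w i (5 * r i))"
      using r(1)[OF i] by (intro mult_left_mono ball_le_w) auto
    also have "\<dots> \<le> ennreal t * ennreal (D * w i (r i))"
      using r(1)[OF i] by (intro mult_left_mono ennreal_leI w_doubling) auto
    also have "\<dots> = ennreal D * ennreal (t * w i (r i))"
      using t D_pos w_pos[OF r(1)[OF i], of i] by (simp add: mult_ac flip: ennreal_mult)
    also have "\<dots> \<le> ennreal D * (\<integral>\<^sup>+y\<in>ball i (r i). F y \<partial>M)"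
      by (intro mult_left_mono r(2)[OF i]) auto
    finally show "ennreal t * emeasure M (ball i (5 * r i))
      \<le> ennreal D * (\<integral>\<^sup>+y\<in>ball i (r i). F y \<partial>M)" .
  qed
  also have "\<dots> = ennreal D * (\<integral>\<^sup>+i. (\<integral>\<^sup>+y\<in>ball i (r i). F y \<partial>M) \<partial>count_space C)"
    by (rule nn_integral_cmult) simp
  also have "(\<integral>\<^sup>+i. (\<integral>\<^sup>+y\<in>ball i (r i). F y \<partial>M) \<partial>count_space C)
      = (\<integral>\<^sup>+i. emeasure (density M F) (ball i (r i)) \<partial>count_space C)"
    by (intro nn_integral_cong) (simp add: emeasure_density)
  also have "\<dots> = emeasure (density M F) (\<Union>i\<in>C. ball i (r i))"
    using C by (intro emeasure_UN_countable[symmetric])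
       (auto simp: disjoint_family_on_def pairwise_def disjnt_def)
  also have "\<dots> \<le> emeasure (density M F) (space (density M F))"
    by (rule emeasure_space)
  also have "\<dots> = (\<integral>\<^sup>+y. F y \<partial>M)"
    by (subst emeasure_density) (auto intro!: nn_integral_cong)
  finally show ?thesis by (simp add: mult_left_mono)
qed

text \<open>
  Marcinkiewicz interpolation between the weak-type bound and the trivial bound for bounded
  functions: at level \<open>t\<close> the part of \<open>F\<close> below \<open>t / 2\<close> contributes at most \<open>t / 2\<close> to every average, so
  \<open>{G > t}\<close> is controlled by the part of \<open>F\<close> above \<open>t / 2\<close>. Integrating over \<open>t\<close> and exchanging the
  integrals produces the \<open>p\<close>-th power of \<open>F\<close>.
\<close>
lemma strong_type:
  fixes F G :: "'a \<Rightarrow> real"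
  assumes [measurable]: "F \<in> borel_measurable borel" "G \<in> borel_measurable borel"
    and F0: "\<And>x. 0 \<le> F x" and G0: "\<And>x. 0 \<le> G x" and p: "1 < p"
    and dom: "\<And>x t. 0 < t \<Longrightarrow> t < G x \<Longrightarrow>
       \<exists>r>0. ennreal (t * w x r) \<le> ball_integral M F x r"
  shows "(\<integral>\<^sup>+x. ennreal (G x powr p) \<partial>M)
    \<le> ennreal (2 powr p * D * p / (p - 1)) * (\<integral>\<^sup>+x. ennreal (F x powr p) \<partial>M)"
proof -
  interpret M: sigma_finite_measure M by (rule sigma_finite_M)
  interpret P: pair_sigma_finite M "lborel :: real measure" ..
  let ?l = "\<lambda>x t. ennreal (p * t powr (p - 1)) * indicator {0<..<G x} t"
  let ?u = "\<lambda>x t. ennreal (F x) * (ennreal (2 * D * p) * (ennreal (t powr (p - 2)) * indicator {0<..<2 * F x} t))"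
  have level: "ennreal (p * t powr (p - 1)) * emeasure M {x. t < G x}
      \<le> ennreal (2 * D * p * t powr (p - 2)) * (\<integral>\<^sup>+x. ennreal (F x) * indicator {x. t / 2 < F x} x \<partial>M)"
    if t: "0 < t" for t
  proof -
    have "ennreal (t / 2) * emeasure M {x. t < G x}
        \<le> ennreal D * (\<integral>\<^sup>+x. ennreal (F x) * indicator {x. t / 2 < F x} x \<partial>M)"
    proof (rule weak_type)
      fix x assume "x \<in> {x. t < G x}"
      with dom[OF t] obtain r where r: "0 < r"
        "ennreal (t * w x r) \<le> ball_integral M F x r" by auto
      have [measurable]: "ball x r \<in> sets borel" by simp
      have "ennreal (t / 2 * w x r) + ennreal (t / 2 * w x r) = ennreal (t * w x r)"
        using t w_pos[OF r(1), of x] by (simp flip: ennreal_plus)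
      also note r(2)
      also have "ball_integral M F x r
          \<le> (\<integral>\<^sup>+y. ennreal (F y) * indicator {y. t / 2 < F y} y * indicator (ball x r) y
               + ennreal (t / 2) * indicator (ball x r) y \<partial>M)"
        using F0 t by (intro nn_integral_mono) (auto simp: indicator_def intro!: ennreal_leI)
      also have "\<dots> = (\<integral>\<^sup>+y\<in>ball x r. ennreal (F y) * indicator {y. t / 2 < F y} y \<partial>M)
            + ennreal (t / 2) * emeasure M (ball x r)"
        by (subst nn_integral_add, measurable, measurable, simp add: nn_integral_cmult_indicator)
      also have "\<dots> \<le> (\<integral>\<^sup>+y\<in>ball x r. ennreal (F y) * indicator {y. t / 2 < F y} y \<partial>M)
            + ennreal (t / 2 * w x r)"
        using t w_pos[OF r(1), of x] mult_left_mono[OF ball_le_w[OF r(1), of x], of "ennreal (t / 2)"]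
        by (intro add_left_mono) (simp add: ennreal_mult''[symmetric] less_imp_le)
      finally have "ennreal (t / 2 * w x r)
          \<le> (\<integral>\<^sup>+y\<in>ball x r. ennreal (F y) * indicator {y. t / 2 < F y} y \<partial>M)"
        by (simp add: ennreal_add_left_cancel_le add.commute)
      with r(1) show "\<exists>r>0. ennreal (t / 2 * w x r)
          \<le> (\<integral>\<^sup>+y\<in>ball x r. ennreal (F y) * indicator {y. t / 2 < F y} y \<partial>M)" by blast
    qed (use t in auto)
    then have "ennreal (2 * p * t powr (p - 2)) * (ennreal (t / 2) * emeasure M {x. t < G x})
        \<le> ennreal (2 * p * t powr (p - 2)) *
          (ennreal D * (\<integral>\<^sup>+x. ennreal (F x) * indicator {x. t / 2 < F x} x \<partial>M))"
      by (rule mult_left_mono) simp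
    moreover have "ennreal (2 * p * t powr (p - 2)) * ennreal (t / 2) = ennreal (p * t powr (p - 1))"
      using t p powr_add[of t "p - 2" 1] by (simp add: mult_ac flip: ennreal_mult)
    moreover have "ennreal (2 * p * t powr (p - 2)) * ennreal D = ennreal (2 * D * p * t powr (p - 2))"
      using p D_pos by (simp add: mult_ac flip: ennreal_mult)
    ultimately show ?thesis by (simp flip: mult.assoc)
  qed
  have "(\<integral>\<^sup>+x. ennreal (G x powr p) \<partial>M)
      = (\<integral>\<^sup>+x. (\<integral>\<^sup>+t. ?l x t \<partial>lborel) \<partial>M)"
    using p G0 by (intro nn_integral_cong powr_eq_nn_integral) auto
  also have "\<dots> = (\<integral>\<^sup>+t. (\<integral>\<^sup>+x. ?l x t \<partial>M) \<partial>lborel)"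
    unfolding greaterThanLessThan_iff indicator_def
    by (rule P.Fubini'[symmetric]) simp
  also have "\<dots> \<le> (\<integral>\<^sup>+t. (\<integral>\<^sup>+x. ?u x t \<partial>M) \<partial>lborel)"
  proof (rule nn_integral_mono)
    fix t :: real
    show "(\<integral>\<^sup>+x. ?l x t \<partial>M) \<le> (\<integral>\<^sup>+x. ?u x t \<partial>M)"
    proof (cases "0 < t")
      case True
      have "(\<integral>\<^sup>+x. ?l x t \<partial>M)
          = (\<integral>\<^sup>+x. ennreal (p * t powr (p - 1)) * indicator {x. t < G x} x \<partial>M)"
        using True by (intro nn_integral_cong) (auto simp: indicator_def)
      also have "\<dots> = ennreal (p * t powr (p - 1)) * emeasure M {x. t < G x}"
        by (intro nn_integral_cmult_indicator) simp
      also note level[OF True]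
      also have "ennreal (2 * D * p * t powr (p - 2)) * (\<integral>\<^sup>+x. ennreal (F x) * indicator {x. t / 2 < F x} x \<partial>M)
          = (\<integral>\<^sup>+x. ennreal (2 * D * p * t powr (p - 2)) * (ennreal (F x) * indicator {x. t / 2 < F x} x) \<partial>M)"
        by (intro nn_integral_cmult[symmetric]) simp
      also have "\<dots> = (\<integral>\<^sup>+x. ?u x t \<partial>M)"
        using True D_pos p by (intro nn_integral_cong) (auto simp: indicator_def ennreal_mult mult_ac)
      finally show ?thesis .
    qed (simp add: indicator_def)
  qed
  also have "\<dots> = (\<integral>\<^sup>+x. (\<integral>\<^sup>+t. ?u x t \<partial>lborel) \<partial>M)"
    unfolding greaterThanLessThan_iff indicator_def
    by (rule P.Fubini') simp
  also have "\<dots> = (\<integral>\<^sup>+x. ennreal (F x) * (ennreal (2 * D * p) * ennreal ((2 * F x) powr (p - 1) / (p - 1))) \<partial>M)"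
    using nn_integral_powr_from_0[of "p - 2"] p F0
    by (intro nn_integral_cong) (simp add: nn_integral_cmult)
  also have "\<dots> = (\<integral>\<^sup>+x. ennreal (2 powr p * D * p / (p - 1)) * ennreal (F x powr p) \<partial>M)"
  proof (intro nn_integral_cong)
    fix x
    have "F x * (2 * D * p * ((2 * F x) powr (p - 1) / (p - 1)))
        = 2 powr p * D * p / (p - 1) * F x powr p"
      using F0[of x] p powr_mult_base[of "F x" "p - 1"] powr_mult_base[of 2 "p - 1"]
      by (simp add: powr_mult field_simps)
    then show "ennreal (F x) * (ennreal (2 * D * p) * ennreal ((2 * F x) powr (p - 1) / (p - 1)))
       = ennreal (2 powr p * D * p / (p - 1)) * ennreal (F x powr p)"
      using F0[of x] p D_pos by (simp flip: ennreal_mult)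
  qed
  also have "\<dots> = ennreal (2 powr p * D * p / (p - 1)) * (\<integral>\<^sup>+x. ennreal (F x powr p) \<partial>M)"
    by (rule nn_integral_cmult) simp
  finally show ?thesis .
qed

text \<open>
  Hoelder's inequality in the weak form needed here, from the pointwise inequality
  \<open>F \<le> b + b powr (1 - p) * F powr p\<close>.
\<close>
lemma ball_nn_integral_le_Morrey:
  fixes F :: "'a \<Rightarrow> real"
  assumes [measurable]: "F \<in> borel_measurable borel"
    and F0: "\<And>x. 0 \<le> F x" and p: "1 < p" and b: "0 < b" and r: "0 < r"
    and F: "ball_integral M (\<lambda>y. F y powr p) x r \<le> ennreal (w x r * b powr p)"
  shows "ball_integral M F x r \<le> ennreal (2 * b * w x r)"
proof -
  have [measurable]: "ball x r \<in> sets borel" by simp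
  have pw: "F y \<le> b + b powr (1 - p) * F y powr p" for y
  proof (cases "F y \<le> b")
    case True
    then show ?thesis by (simp add: add_increasing2)
  next
    case False
    then have "1 \<le> (F y / b) powr (p - 1)"
      using p b by (intro ge_one_powr_ge_zero) (auto simp: field_simps)
    also have "(F y / b) powr (p - 1) = b powr (1 - p) * F y powr (p - 1)"
      using b F0[of y] powr_minus_divide[of b "p - 1"] by (simp add: powr_divide)
    finally have "F y * 1 \<le> F y * (b powr (1 - p) * F y powr (p - 1))"
      by (rule mult_left_mono) (rule F0)
    also have "\<dots> = b powr (1 - p) * F y powr p"
      using powr_mult_base[of "F y" "p - 1"] F0[of y] by (simp add: mult_ac)
    finally show ?thesis using b by simp
  qed
  have "ball_integral M F x r
      \<le> (\<integral>\<^sup>+y. ennreal b * indicator (ball x r) y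
           + ennreal (b powr (1 - p)) * (ennreal (F y powr p) * indicator (ball x r) y) \<partial>M)"
    using pw b by (intro nn_integral_mono)
      (auto simp: indicator_def simp flip: ennreal_mult ennreal_plus intro!: ennreal_leI)
  also have "\<dots> = ennreal b * emeasure M (ball x r)
      + ennreal (b powr (1 - p)) * ball_integral M (\<lambda>y. F y powr p) x r"
    by (subst nn_integral_add, measurable, measurable, subst nn_integral_cmult, measurable,
        simp add: nn_integral_cmult_indicator)
  also have "\<dots> \<le> ennreal b * ennreal (w x r) + ennreal (b powr (1 - p)) * ennreal (w x r * b powr p)"
    by (intro add_mono mult_left_mono ball_le_w r F) auto
  also have "\<dots> = ennreal (b * w x r + b powr (1 - p) * (w x r * b powr p))"
    using b w_pos[OF r, of x] by (simp flip: ennreal_mult ennreal_plus)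
  also have "b powr (1 - p) * (w x r * b powr p) = b * w x r"
    using b powr_add[of b "1 - p" p] by simp
  finally show ?thesis by (simp add: mult_ac)
qed

text \<open>
  Split \<open>F\<close> at \<open>ball x (2 * r)\<close>. For points of \<open>ball x r\<close>, balls of radius at least \<open>r\<close> only see
  averages of size \<open>\<Phi> r\<close>, by the Morrey condition and the almost monotonicity of \<open>\<Phi>\<close>; smaller balls
  stay inside \<open>ball x (2 * r)\<close>, where the \<open>L\<^sup>p\<close> bound applies to the restriction of \<open>F\<close>.
\<close>
lemma maximal_Morrey:
  fixes F G :: "'a \<Rightarrow> real" and \<Phi> :: "real \<Rightarrow> real"
  assumes [measurable]: "F \<in> borel_measurable borel" "G \<in> borel_measurable borel"
    and F0: "\<And>x. 0 \<le> F x" and G0: "\<And>x. 0 \<le> G x" and p: "1 < p"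
    and dom: "\<And>x t. 0 < t \<Longrightarrow> t < G x \<Longrightarrow>
       \<exists>r>0. ennreal (t * w x r) < ball_integral M F x r"
    and \<Phi>0: "\<And>r. 0 < r \<Longrightarrow> 0 < \<Phi> r"
    and B: "\<And>r s. 0 < r \<Longrightarrow> r \<le> s \<Longrightarrow> \<Phi> s \<le> B * \<Phi> r"
    and F: "\<And>x r. 0 < r \<Longrightarrow>
       (ball_integral M (\<lambda>y. F y powr p) x r) \<le> ennreal (w x r * \<Phi> r powr p)"
    and r: "0 < r"
  shows "ball_integral M (\<lambda>y. G y powr p) x r
    \<le> ennreal (maximal_const p B * (w x r * \<Phi> r powr p))"
proof -
  have [measurable]: "ball x s \<in> sets borel" for x :: 'a and s by simp
  have B0: "0 < B"
    using B[of 1 1] \<Phi>0[of 1] by (auto simp: zero_less_mult_iff dest: less_le_trans)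
  define b where "b = B * \<Phi> r"
  have b: "0 < b" using B0 \<Phi>0[OF r] by (simp add: b_def)
  define F1 where "F1 = (\<lambda>y. F y * indicator (ball x (2 * r)) y)"
  define G1 where "G1 = (\<lambda>y. if y \<in> ball x r \<and> 2 * b < G y then G y else 0)"
  have [measurable]: "F1 \<in> borel_measurable borel" "G1 \<in> borel_measurable borel"
    unfolding F1_def G1_def by measurable
  have "(\<integral>\<^sup>+y. ennreal (G1 y powr p) \<partial>M)
      \<le> ennreal (2 powr p * D * p / (p - 1)) * (\<integral>\<^sup>+y. ennreal (F1 y powr p) \<partial>M)"
  proof (rule strong_type)
    fix y t assume t: "0 < t" "t < G1 y"
    then have y: "y \<in> ball x r" "2 * b < G y" "t < G y"
      by (auto simp: G1_def split: if_splits)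
    \<comment> \<open>Balls of radius at least \<open>r\<close> have averages at most \<open>2 * b\<close>, so a ball with average above \<open>t'\<close> is small.\<close>
    define t' where "t' = max t (2 * b)"
    have "0 < t'" "t' < G y" using t y by (auto simp: t'_def)
    from dom[OF this] obtain s where s: "0 < s"
      "ennreal (t' * w y s) < ball_integral M F y s" by auto
    have "s < r"
    proof (rule ccontr)
      assume "\<not> s < r"
      then have "\<Phi> s \<le> b" using B[OF r, of s] by (simp add: b_def)
      then have "2 * \<Phi> s * w y s \<le> t' * w y s"
        using w_pos[OF s(1), of y] by (intro mult_right_mono) (auto simp: t'_def)
      moreover have "ball_integral M F y s \<le> ennreal (2 * \<Phi> s * w y s)"
        by (intro ball_nn_integral_le_Morrey[where p = p] F F0 p \<Phi>0 s) measurable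
      ultimately show False using s(2) by (meson ennreal_leI leD order_trans)
    qed
    then have sub: "ball y s \<subseteq> ball x (2 * r)"
      using y(1) by (simp add: subset_iff) (metis add_mono dist_triangle dist_commute add_less_le_mono less_imp_le mult_2 order_le_less_trans)
    have "ennreal (t * w y s) \<le> ennreal (t' * w y s)"
      using w_pos[OF s(1), of y] by (intro ennreal_leI mult_right_mono) (auto simp: t'_def)
    also note less_imp_le[OF s(2)]
    also have "ball_integral M F y s = ball_integral M F1 y s"
      using sub by (intro nn_integral_cong) (auto simp: F1_def indicator_def)
    finally show "\<exists>r>0. ennreal (t * w y r) \<le> ball_integral M F1 y r"
      using s(1) by blast
  qed (auto simp: F1_def G1_def F0 G0 p)
  also have "(\<integral>\<^sup>+y. ennreal (F1 y powr p) \<partial>M)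
      = ball_integral M (\<lambda>y. F y powr p) x (2 * r)"
    using p by (intro nn_integral_cong) (auto simp: F1_def indicator_def)
  also have "\<dots> \<le> ennreal (w x (2 * r) * \<Phi> (2 * r) powr p)"
    using r by (intro F) auto
  also have "\<dots> \<le> ennreal (D * w x r * b powr p)"
    using r B[OF r, of "2 * r"] \<Phi>0[of "2 * r"] p w_doubling[OF r, of "2 * r" x] w_pos[of "2 * r" x]
    by (intro ennreal_leI mult_mono powr_mono2) (auto simp: b_def intro: less_imp_le order_trans)
  finally have G1: "(\<integral>\<^sup>+y. ennreal (G1 y powr p) \<partial>M)
      \<le> ennreal (2 powr p * D * p / (p - 1)) * ennreal (D * w x r * b powr p)"
    by (simp add: mult_left_mono)
  have "ball_integral M (\<lambda>y. G y powr p) x r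
      \<le> (\<integral>\<^sup>+y. ennreal (G1 y powr p) + ennreal ((2 * b) powr p) * indicator (ball x r) y \<partial>M)"
    using p G0 b by (intro nn_integral_mono)
      (auto simp: G1_def indicator_def intro!: ennreal_leI powr_mono2 add_increasing)
  also have "\<dots> = (\<integral>\<^sup>+y. ennreal (G1 y powr p) \<partial>M) + ennreal ((2 * b) powr p) * emeasure M (ball x r)"
    by (subst nn_integral_add, measurable, measurable, simp add: nn_integral_cmult_indicator)
  also have "\<dots> \<le> ennreal (2 powr p * D * p / (p - 1)) * ennreal (D * w x r * b powr p)
       + ennreal ((2 * b) powr p) * ennreal (w x r)"
    by (intro add_mono G1 mult_left_mono ball_le_w r) auto
  also have "\<dots> = ennreal (2 powr p * D * p / (p - 1) * (D * w x r * b powr p) + (2 * b) powr p * w x r)"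
    using D_pos p w_pos[OF r, of x] by (simp flip: ennreal_mult ennreal_plus)
  also have "2 powr p * D * p / (p - 1) * (D * w x r * b powr p) + (2 * b) powr p * w x r
      = maximal_const p B * (w x r * \<Phi> r powr p)"
    using B0 \<Phi>0[OF r] b by (simp add: b_def powr_mult power2_eq_square algebra_simps)
  finally show ?thesis .
qed

text \<open>
  The heart of the argument, for an abstract operator that is dominated by a superposition of
  averages. The function \<open>G\<close> in the proof is the \<open>(q / p)\<close>-th power of \<open>H\<close>, scaled so that it is
  dominated by the maximal function of \<open>F\<close>.
\<close>
lemma Hedberg_Morrey:
  fixes F H :: "'a \<Rightarrow> real" and \<phi> k :: "real \<Rightarrow> real"
  assumes [measurable]: "F \<in> borel_measurable borel" "H \<in> borel_measurable borel"
      "k \<in> borel_measurable borel"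
    and F0: "\<And>x. 0 \<le> F x" and H0: "\<And>x. 0 \<le> H x"
    and p: "1 < p" and pq: "p < q"
    and k0: "\<And>s. 0 < s \<Longrightarrow> 0 \<le> k s"
    and \<phi>0: "\<And>r. 0 < r \<Longrightarrow> 0 < \<phi> r"
    and \<phi>_meas: "\<phi> \<in> borel_measurable (lebesgue_on {0<..})"
    and \<phi>_surj: "{0<..} \<subseteq> \<phi> ` {0<..}"
    and B: "\<And>r s. 0 < r \<Longrightarrow> r \<le> s \<Longrightarrow> \<phi> s \<le> B * \<phi> r"
    and L: "0 < L"
    and k_le: "\<And>r. 0 < r \<Longrightarrow> ennreal (\<phi> r) * (\<integral>\<^sup>+s\<in>{0<..<r}. ennreal (k s) \<partial>lborel)
        + (\<integral>\<^sup>+s\<in>{r<..}. ennreal (k s * \<phi> s) \<partial>lebesgue) \<le> ennreal (L * \<phi> r powr (p / q))"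
    and H: "\<And>x. ennreal (H x) \<le> (\<integral>\<^sup>+s\<in>{0<..}. ennreal (k s / w x s) *
        ball_integral M F x s \<partial>lborel)"
    and N: "0 < N"
    and F: "\<And>x r. 0 < r \<Longrightarrow>
       (ball_integral M (\<lambda>y. F y powr p) x r) \<le> ennreal (w x r * (N * \<phi> r) powr p)"
    and r: "0 < r"
  shows "ball_integral M (\<lambda>y. H y powr q) x r
    \<le> ennreal ((2 * L) powr q * maximal_const p B
         * (w x r * (N powr q * \<phi> r powr p)))"
proof -
  have [measurable]: "ball x r \<in> sets borel" by simp
  have q: "0 < q" using p pq by simp
  define c where "c = 2 * L * N powr (1 - p / q)"
  have c: "0 < c" using L N by (simp add: c_def)
  define G where "G = (\<lambda>x. (H x / c) powr (q / p))"
  have [measurable]: "G \<in> borel_measurable borel" unfolding G_def by measurable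
  define \<phi>' where "\<phi>' = (\<lambda>s. \<phi> s * indicator {0<..} s)"
  have [measurable]: "\<phi>' \<in> borel_measurable lebesgue"
    unfolding \<phi>'_def
    using \<phi>_meas by (subst (asm) borel_measurable_restrict_space_iff) (auto simp: mult.commute)
  have [measurable]: "k \<in> borel_measurable lebesgue"
    by (rule measurable_completion) simp
  have [measurable]: "(\<lambda>s. ennreal (k s * \<phi> s) * indicator {r<..} s) \<in> borel_measurable lebesgue"
    if "0 < r" for r :: real
  proof -
    have [measurable]: "{r<..} \<in> sets lebesgue" by auto
    have "(\<lambda>s. ennreal (k s * \<phi>' s) * indicator {r<..} s) \<in> borel_measurable lebesgue"
      by measurable
    also have "(\<lambda>s. ennreal (k s * \<phi>' s) * indicator {r<..} s)
        = (\<lambda>s. ennreal (k s * \<phi> s) * indicator {r<..} s)"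
      using that by (auto simp: indicator_def \<phi>'_def)
    finally show ?thesis .
  qed
  have [measurable]: "(\<lambda>s. ennreal (k s) * indicator {0<..<r} s) \<in> borel_measurable lebesgue" for r :: real
  proof -
    have [measurable]: "{0<..<r} \<in> sets lebesgue" by auto
    show ?thesis by measurable
  qed
  have dom: "\<exists>r>0. ennreal (t * w x r) < ball_integral M F x r"
    if t: "0 < t" "t < G x" for x t
  proof (rule ccontr)
    assume "\<not> ?thesis"
    then have le_t: "ball_integral M F x s \<le> ennreal (t * w x s)" if "0 < s" for s
      using that by (metis not_less)
    have le_\<phi>: "ball_integral M F x s \<le> ennreal (2 * (N * \<phi> s) * w x s)"
      if "0 < s" for s
      using that N \<phi>0[OF that] by (intro ball_nn_integral_le_Morrey[where p = p] F F0 p) auto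
    \<comment> \<open>At this radius the local bound \<open>t\<close> and the Morrey bound \<open>N * \<phi> r\<close> of the averages coincide.\<close>
    obtain r where r: "0 < r" "\<phi> r = t / N"
      using \<phi>_surj t N by (metis (no_types, lifting) divide_pos_pos greaterThan_iff imageE subsetD)
    let ?l = "\<lambda>s. ennreal (k s / w x s) * ball_integral M F x s * indicator {0<..} s"
    let ?u = "\<lambda>s. ennreal t * (ennreal (k s) * indicator {0<..<r} s)
        + ennreal (2 * N) * (ennreal (k s * \<phi> s) * indicator {r<..} s)"
    have "ennreal (H x) \<le> (\<integral>\<^sup>+s\<in>{0<..}. ennreal (k s / w x s) *
        ball_integral M F x s \<partial>lebesgue)"
      using H[of x] by (simp add: nn_integral_completion)
    also have "\<dots> \<le> (\<integral>\<^sup>+s. ?u s \<partial>lebesgue)"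
    proof (rule nn_integral_mono_AE)
      have neq: "AE s in lebesgue. s \<noteq> r"
        by (rule AE_completion) (rule AE_lborel_singleton)
      show "AE s in lebesgue. ?l s \<le> ?u s"
        using neq
      proof eventually_elim
        fix s assume "s \<noteq> r"
        then consider "s \<le> 0" | "0 < s" "s < r" | "r < s" by linarith
        then show "?l s \<le> ?u s"
        proof cases
          case 2
          then show ?thesis
            using mult_left_mono[OF le_t[OF 2(1)], of "ennreal (k s / w x s)"] w_pos[OF 2(1), of x] k0[OF 2(1)] t
            by (simp add: mult_ac flip: ennreal_mult)
        next
          case 3
          then have s: "0 < s" using r by simp
          then show ?thesis
            using mult_left_mono[OF le_\<phi>[OF s], of "ennreal (k s / w x s)"] w_pos[OF s, of x] k0[OF s] 3 N \<phi>0[OF s]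
            by (simp add: mult_ac flip: ennreal_mult)
        qed simp
      qed
    qed
    also have "\<dots> = (\<integral>\<^sup>+s. ennreal t * (ennreal (k s) * indicator {0<..<r} s) \<partial>lebesgue)
        + (\<integral>\<^sup>+s. ennreal (2 * N) * (ennreal (k s * \<phi> s) * indicator {r<..} s) \<partial>lebesgue)"
      using r(1) by (intro nn_integral_add) auto
    also have "\<dots> \<le> ennreal t * (\<integral>\<^sup>+s\<in>{0<..<r}. ennreal (k s) \<partial>lebesgue)
        + ennreal (2 * N) * (\<integral>\<^sup>+s\<in>{r<..}. ennreal (k s * \<phi> s) \<partial>lebesgue)"
      using r(1) by (simp add: nn_integral_cmult)
    also have "\<dots> \<le> ennreal (2 * N) * (ennreal (\<phi> r) * (\<integral>\<^sup>+s\<in>{0<..<r}. ennreal (k s) \<partial>lborel)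
        + (\<integral>\<^sup>+s\<in>{r<..}. ennreal (k s * \<phi> s) \<partial>lebesgue))"
    proof -
      have "ennreal t * X \<le> ennreal (2 * N) * (ennreal (\<phi> r) * X)" for X
        using t N r(2) by (simp flip: mult.assoc ennreal_mult) (intro mult_right_mono ennreal_leI; simp)
      then show ?thesis
        by (simp add: distrib_left nn_integral_completion add_right_mono)
    qed
    also have "\<dots> \<le> ennreal (2 * N) * ennreal (L * \<phi> r powr (p / q))"
      by (intro mult_left_mono k_le r) simp
    also have "\<dots> = ennreal (c * t powr (p / q))"
    proof -
      have "N = N powr (p / q) * N powr (1 - p / q)"
        using N by (simp flip: powr_add)
      then have *: "N / N powr (p / q) = N powr (1 - p / q)"
        using N by (simp add: field_simps)
      have "N * \<phi> r powr (p / q) = N / N powr (p / q) * t powr (p / q)"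
        unfolding r(2) using N t by (simp add: powr_divide)
      also note *
      finally have "N * \<phi> r powr (p / q) = N powr (1 - p / q) * t powr (p / q)" .
      then show ?thesis
        using N L by (simp add: c_def mult_ac flip: ennreal_mult)
    qed
    finally have "H x / c \<le> t powr (p / q)"
      using c t H0[of x] by (simp add: field_simps)
    then have "G x \<le> (t powr (p / q)) powr (q / p)"
      unfolding G_def using H0[of x] c p q by (intro powr_mono2) auto
    also have "\<dots> = t" using p q t by (simp add: powr_powr)
    finally show False using t by simp
  qed
  have "ball_integral M (\<lambda>y. G y powr p) x r
    \<le> ennreal (maximal_const p B * (w x r * (N * \<phi> r) powr p))"
    by (rule maximal_Morrey[where F = F])
      (use F0 p dom N \<phi>0 B F r in \<open>auto simp: G_def mult.left_commute[of B N]\<close>)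
  also have "ball_integral M (\<lambda>y. G y powr p) x r
     = (\<integral>\<^sup>+y. ennreal (1 / c powr q) * (ennreal (H y powr q) * indicator (ball x r) y) \<partial>M)"
    using p H0 c by (intro nn_integral_cong)
      (simp add: G_def powr_powr powr_divide indicator_def flip: ennreal_mult)
  also have "\<dots> = ennreal (1 / c powr q) * ball_integral M (\<lambda>y. H y powr q) x r"
    by (rule nn_integral_cmult) measurable
  finally have "ennreal (c powr q) * (ennreal (1 / c powr q) * ball_integral M (\<lambda>y. H y powr q) x r)
    \<le> ennreal (c powr q) * ennreal (maximal_const p B * (w x r * (N * \<phi> r) powr p))"
    by (rule mult_left_mono) simp
  also have "ennreal (c powr q) * (ennreal (1 / c powr q) * ball_integral M (\<lambda>y. H y powr q) x r)
     = ball_integral M (\<lambda>y. H y powr q) x r"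
    using c by (simp flip: mult.assoc ennreal_mult)
  also have "ennreal (c powr q) * ennreal (maximal_const p B * (w x r * (N * \<phi> r) powr p))
    = ennreal (c powr q * (maximal_const p B * (w x r * (N * \<phi> r) powr p)))"
    by (rule ennreal_mult'[symmetric]) simp
  also have "c powr q = (2 * L) powr q * N powr (q - p)"
    using L N q by (simp add: c_def powr_mult powr_powr left_diff_distrib)
  also have "(2 * L) powr q * N powr (q - p) * (maximal_const p B * (w x r * (N * \<phi> r) powr p))
    = (2 * L) powr q * maximal_const p B
         * (w x r * (N powr q * \<phi> r powr p))"
  proof -
    have "N powr (q - p) * (N * \<phi> r) powr p = N powr q * \<phi> r powr p"
      using N \<phi>0[OF r] by (simp add: powr_mult flip: powr_add mult.assoc)
    then show ?thesis by (simp add: mult_ac)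
  qed
  finally show ?thesis .
qed

end

section \<open>Spherical caps\<close>

lemma nn_integral_Icc_reflect:
  fixes f :: "real \<Rightarrow> ennreal"
  assumes [measurable]: "f \<in> borel_measurable borel"
  shows "(\<integral>\<^sup>+t\<in>{0..a}. f (a - t) \<partial>lborel) = (\<integral>\<^sup>+t\<in>{0..a}. f t \<partial>lborel)"
  by (subst (2) nn_integral_real_affine[where c = "-1" and t = a])
     (auto simp: indicator_def intro!: nn_integral_cong)

lemma sin_ge_half: "t / 2 \<le> sin t" if "0 \<le> t" "t \<le> pi / 2" for t :: real
proof (cases "t = 0")
  case False
  then have "0 < t / 2" using that by simp
  then obtain z where z: "0 < z" "z < t / 2" "sin (t / 2) - sin 0 = (t / 2 - 0) * cos z"
    using MVT2[of 0 "t / 2" sin cos] DERIV_sin by blast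
  have "cos (pi / 4) \<le> cos z" "cos (pi / 4) \<le> cos (t / 2)"
    using z that pi_gt_zero by (auto intro!: cos_monotone_0_pi_le)
  then have c: "sqrt 2 / 2 \<le> cos z" "sqrt 2 / 2 \<le> cos (t / 2)" by (simp_all add: cos_45)
  have "0 \<le> sqrt 2 / 2" by simp
  then have "0 \<le> cos z" using c(1) by linarith
  have "t / 2 = 2 * (t / 2 * (sqrt 2 / 2)) * (sqrt 2 / 2)" by simp
  also have "\<dots> \<le> 2 * (t / 2 * cos z) * cos (t / 2)"
    using c that \<open>0 \<le> cos z\<close> by (intro mult_mono mult_nonneg_nonneg) simp_all
  also have "\<dots> = sin t" using z(3) sin_double[of "t / 2"] by simp
  finally show ?thesis .
qed simp

text \<open>
  The factor \<open>2 powr \<bar>b\<bar>\<close> serves both signs of the exponent.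
\<close>
lemma sin_powr_bounds:
  assumes "0 < t" "t \<le> pi / 2"
  shows "sin t powr b \<le> 2 powr \<bar>b\<bar> * t powr b" "t powr b \<le> 2 powr \<bar>b\<bar> * sin t powr b"
proof -
  have s: "t / 2 \<le> sin t" "sin t \<le> t" "0 < sin t"
    using assms sin_ge_half[of t] sin_x_le_x[of t] sin_gt_zero[of t] pi_gt_zero by auto
  show "sin t powr b \<le> 2 powr \<bar>b\<bar> * t powr b"
  proof (cases "0 \<le> b")
    case True
    have "sin t powr b \<le> t powr b" using s assms True by (intro powr_mono2) auto
    also have "\<dots> \<le> 2 powr \<bar>b\<bar> * t powr b"
      using ge_one_powr_ge_zero[of 2 "\<bar>b\<bar>"] by (simp add: mult_le_cancel_right1)
    finally show ?thesis .
  next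
    case False
    have "sin t powr b \<le> (t / 2) powr b" using s assms False by (intro powr_mono2') auto
    then show ?thesis using assms False by (simp add: powr_divide powr_minus_divide)
  qed
  show "t powr b \<le> 2 powr \<bar>b\<bar> * sin t powr b"
  proof (cases "0 \<le> b")
    case True
    have "t powr b \<le> (2 * sin t) powr b" using s assms True by (intro powr_mono2) auto
    then show ?thesis using s True by (simp add: powr_mult)
  next
    case False
    have "t powr b \<le> sin t powr b" using s assms False by (intro powr_mono2') auto
    also have "\<dots> \<le> 2 powr \<bar>b\<bar> * sin t powr b"
      using ge_one_powr_ge_zero[of 2 "\<bar>b\<bar>"] by (simp add: mult_le_cancel_right1)
    finally show ?thesis .
  qed
qed

lemma nn_integral_sin_powr_le:
  assumes "-1 < b" "0 \<le> c" "c \<le> pi / 2"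
  shows "(\<integral>\<^sup>+t\<in>{0..c}. ennreal (sin t powr b) \<partial>lborel) \<le> ennreal (2 powr \<bar>b\<bar> / (b + 1) * c powr (b + 1))"
proof -
  have "(\<integral>\<^sup>+t\<in>{0..c}. ennreal (sin t powr b) \<partial>lborel)
      \<le> (\<integral>\<^sup>+t. ennreal (2 powr \<bar>b\<bar>) * (ennreal (t powr b) * indicator {0<..<c} t) \<partial>lborel)"
  proof (rule nn_integral_mono_AE)
    show "AE t in lborel. ennreal (sin t powr b) * indicator {0..c} t
        \<le> ennreal (2 powr \<bar>b\<bar>) * (ennreal (t powr b) * indicator {0<..<c} t)"
      using AE_lborel_singleton[of 0] AE_lborel_singleton[of c]
    proof eventually_elim
      case (elim t)
      then show ?case
        using sin_powr_bounds(1)[of t b] assms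
        by (auto simp: indicator_def simp flip: ennreal_mult intro!: ennreal_leI)
    qed
  qed
  also have "\<dots> = ennreal (2 powr \<bar>b\<bar>) * ennreal (c powr (b + 1) / (b + 1))"
    by (subst nn_integral_cmult, measurable) (simp add: nn_integral_powr_from_0 assms)
  also have "\<dots> = ennreal (2 powr \<bar>b\<bar> / (b + 1) * c powr (b + 1))"
    using assms by (simp flip: ennreal_mult)
  finally show ?thesis .
qed

lemma nn_integral_sin_powr_ge:
  assumes "-1 < b" "0 \<le> c" "c \<le> pi / 2"
  shows "ennreal (c powr (b + 1) / (b + 1)) \<le> ennreal (2 powr \<bar>b\<bar>) * (\<integral>\<^sup>+t\<in>{0..c}. ennreal (sin t powr b) \<partial>lborel)"
proof -
  have "ennreal (c powr (b + 1) / (b + 1)) = (\<integral>\<^sup>+t\<in>{0<..<c}. ennreal (t powr b) \<partial>lborel)"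
    by (simp add: nn_integral_powr_from_0 assms)
  also have "\<dots> \<le> (\<integral>\<^sup>+t. ennreal (2 powr \<bar>b\<bar>) * (ennreal (sin t powr b) * indicator {0..c} t) \<partial>lborel)"
    using sin_powr_bounds(2)[of _ b] assms
    by (intro nn_integral_mono) (auto simp: indicator_def simp flip: ennreal_mult intro!: ennreal_leI)
  also have "\<dots> = ennreal (2 powr \<bar>b\<bar>) * (\<integral>\<^sup>+t\<in>{0..c}. ennreal (sin t powr b) \<partial>lborel)"
    by (intro nn_integral_cmult) measurable
  finally show ?thesis .
qed

lemma nn_integral_sin_powr_finite:
  assumes "-1 < b"
  shows "(\<integral>\<^sup>+t\<in>{0..pi}. ennreal (sin t powr b) \<partial>lborel) < \<infinity>"
proof -
  have half: "(\<integral>\<^sup>+t\<in>{0..pi/2}. ennreal (sin t powr b) \<partial>lborel) < \<infinity>"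
    using nn_integral_sin_powr_le[OF assms, of "pi / 2"] by (auto intro: le_less_trans)
  have "(\<integral>\<^sup>+t\<in>{0..pi}. ennreal (sin t powr b) \<partial>lborel)
    \<le> (\<integral>\<^sup>+t. ennreal (sin t powr b) * indicator {0..pi/2} t
          + ennreal (sin t powr b) * indicator {0..pi/2} (pi - t) * indicator {0..pi} t \<partial>lborel)"
    by (intro nn_integral_mono) (auto simp: indicator_def)
  also have "\<dots> = (\<integral>\<^sup>+t\<in>{0..pi/2}. ennreal (sin t powr b) \<partial>lborel)
      + (\<integral>\<^sup>+t\<in>{0..pi}. ennreal (sin (pi - t) powr b) * indicator {0..pi/2} (pi - t) \<partial>lborel)"
    by (subst nn_integral_add) auto
  also have "\<dots> = (\<integral>\<^sup>+t\<in>{0..pi/2}. ennreal (sin t powr b) \<partial>lborel)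
      + (\<integral>\<^sup>+t\<in>{0..pi}. ennreal (sin t powr b) * indicator {0..pi/2} t \<partial>lborel)"
    by (subst nn_integral_Icc_reflect[of "\<lambda>t. ennreal (sin t powr b) * indicator {0..pi/2} t"]) auto
  also have "(\<integral>\<^sup>+t\<in>{0..pi}. ennreal (sin t powr b) * indicator {0..pi/2} t \<partial>lborel)
      \<le> (\<integral>\<^sup>+t\<in>{0..pi/2}. ennreal (sin t powr b) \<partial>lborel)"
    by (intro nn_integral_mono) (auto simp: indicator_def)
  finally have "(\<integral>\<^sup>+t\<in>{0..pi}. ennreal (sin t powr b) \<partial>lborel)
    \<le> (\<integral>\<^sup>+t\<in>{0..pi/2}. ennreal (sin t powr b) \<partial>lborel) + (\<integral>\<^sup>+t\<in>{0..pi/2}. ennreal (sin t powr b) \<partial>lborel)"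
    by (simp add: add_left_mono)
  also have "\<dots> < \<infinity>" using half by (simp add: ennreal_add_less_top)
  finally show ?thesis .
qed

lemma dunkl_dist_measurable [measurable]:
  "(\<lambda>z. dunkl_dist (f z) (g z) (h z)) \<in> borel_measurable M"
  if [measurable]: "f \<in> borel_measurable M" "g \<in> borel_measurable M" "h \<in> borel_measurable M"
  unfolding dunkl_dist_def by measurable

lemma dunkl_dist_square:
  "(dunkl_dist x y t)\<^sup>2 = x\<^sup>2 + y\<^sup>2 - 2 * x * y * cos t"
  "(\<bar>x\<bar> - \<bar>y\<bar>)\<^sup>2 \<le> (dunkl_dist x y t)\<^sup>2" "(dunkl_dist x y t)\<^sup>2 \<le> (\<bar>x\<bar> + \<bar>y\<bar>)\<^sup>2"
proof -
  have "\<bar>x * y * cos t\<bar> \<le> \<bar>x\<bar> * \<bar>y\<bar>"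
    using abs_cos_le_one[of t] by (simp add: abs_mult mult_left_le)
  then have *: "(\<bar>x\<bar> - \<bar>y\<bar>)\<^sup>2 \<le> x\<^sup>2 + y\<^sup>2 - 2 * x * y * cos t" "x\<^sup>2 + y\<^sup>2 - 2 * x * y * cos t \<le> (\<bar>x\<bar> + \<bar>y\<bar>)\<^sup>2"
    by (auto simp: power2_diff power2_sum abs_le_iff)
  show eq: "(dunkl_dist x y t)\<^sup>2 = x\<^sup>2 + y\<^sup>2 - 2 * x * y * cos t"
    using order_trans[OF zero_le_power2 *(1)] unfolding dunkl_dist_def by (rule real_sqrt_pow2)
  show "(\<bar>x\<bar> - \<bar>y\<bar>)\<^sup>2 \<le> (dunkl_dist x y t)\<^sup>2" "(dunkl_dist x y t)\<^sup>2 \<le> (\<bar>x\<bar> + \<bar>y\<bar>)\<^sup>2"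
    unfolding eq by fact+
qed

lemma dunkl_dist_nonneg: "0 \<le> dunkl_dist x y t"
  using order_trans[OF zero_le_power2 dunkl_dist_square(2)[of x y t]]
  unfolding dunkl_dist_square(1) unfolding dunkl_dist_def by (rule real_sqrt_ge_zero)

lemma dunkl_dist_bounds:
  "\<bar>\<bar>x\<bar> - \<bar>y\<bar>\<bar> \<le> dunkl_dist x y t" "dunkl_dist x y t \<le> \<bar>x\<bar> + \<bar>y\<bar>"
  using dunkl_dist_square(2,3)[of x y t] dunkl_dist_nonneg[of x y t]
  by (auto simp: abs_le_square_iff[symmetric])

lemma dunkl_dist_reflect: "dunkl_dist x y (pi - t) = dunkl_dist (- x) y t"
  by (simp add: dunkl_dist_def)

lemma dunkl_dist_minus: "dunkl_dist (- x) (- y) t = dunkl_dist x y t"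
  by (simp add: dunkl_dist_def)

text \<open>
  Changing the sign of \<open>x\<close> or \<open>y\<close> amounts to the reflection \<open>t \<mapsto> pi - t\<close>, under which the weight is
  invariant.
\<close>
lemma nn_integral_dunkl_dist_abs:
  fixes F :: "real \<Rightarrow> ennreal"
  assumes [measurable]: "F \<in> borel_measurable borel"
  shows "(\<integral>\<^sup>+t\<in>{0..pi}. F (dunkl_dist x y t) * ennreal (sin t powr b) \<partial>lborel)
       = (\<integral>\<^sup>+t\<in>{0..pi}. F (dunkl_dist \<bar>x\<bar> \<bar>y\<bar> t) * ennreal (sin t powr b) \<partial>lborel)"
proof -
  have *: "(\<integral>\<^sup>+t\<in>{0..pi}. F (dunkl_dist x y t) * ennreal (sin t powr b) \<partial>lborel)
    = (\<integral>\<^sup>+t\<in>{0..pi}. F (dunkl_dist (- x) y t) * ennreal (sin t powr b) \<partial>lborel)" for x y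
    by (subst nn_integral_Icc_reflect[symmetric]) (auto simp: dunkl_dist_reflect)
  show ?thesis
    using *[of x y] *[of x "-y"]
    by (auto simp: abs_if dunkl_dist_minus)
qed

abbreviation cap_integral :: "real \<Rightarrow> real \<Rightarrow> real \<Rightarrow> real \<Rightarrow> ennreal" where
  "cap_integral b x y r \<equiv>
     (\<integral>\<^sup>+t\<in>{0..pi}. indicator {..<r} (dunkl_dist x y t) * ennreal (sin t powr b) \<partial>lborel)"

text \<open>
  Let \<open>x\<close> and \<open>y\<close> have equal signs. If \<open>x\<close> is large compared to \<open>r\<close>, then \<open>dunkl_dist x y t < r\<close> forces
  \<open>y\<close> to be comparable to \<open>x\<close> and the angle to be at most \<open>3 * r / \<bar>x\<bar>\<close>. Otherwise the ratio
  \<open>r / max \<bar>x\<bar> r\<close> is at least \<open>1 / 2\<close> and the integral over all angles is good enough.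
\<close>
lemma cap_upper_bound:
  assumes b: "-1 < b"
  obtains C where "0 < C"
    "\<And>x y r. 0 < r \<Longrightarrow> (cap_integral b x y r)
      \<le> ennreal (C * (r / max \<bar>x\<bar> r) powr (b + 1)) * indicator {y. \<bar>\<bar>x\<bar> - \<bar>y\<bar>\<bar> < r} y"
proof -
  obtain I where I: "(\<integral>\<^sup>+t\<in>{0..pi}. ennreal (sin t powr b) \<partial>lborel) = ennreal I" "0 \<le> I"
    using nn_integral_sin_powr_finite[OF b]
    by (cases "\<integral>\<^sup>+t\<in>{0..pi}. ennreal (sin t powr b) \<partial>lborel") auto
  define C where "C = I * 2 powr (b + 1) + 2 powr \<bar>b\<bar> / (b + 1) * 3 powr (b + 1)"
  have "0 < C" unfolding C_def using I b by (intro add_nonneg_pos) auto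
  moreover have "cap_integral b x y r
      \<le> ennreal (C * (r / max \<bar>x\<bar> r) powr (b + 1)) * indicator {y. \<bar>\<bar>x\<bar> - \<bar>y\<bar>\<bar> < r} y"
      (is "?L \<le> _") if r: "0 < r" for x y r
  proof -
    consider "r \<le> \<bar>\<bar>x\<bar> - \<bar>y\<bar>\<bar>" | "\<bar>\<bar>x\<bar> - \<bar>y\<bar>\<bar> < r" "\<bar>x\<bar> \<le> 2 * r" | "\<bar>\<bar>x\<bar> - \<bar>y\<bar>\<bar> < r" "2 * r < \<bar>x\<bar>"
      by linarith
    then show ?thesis
    proof cases
      case 1
      then have "\<not> dunkl_dist x y t < r" for t
        using dunkl_dist_bounds(1)[of x y t] by linarith
      then have "?L = (\<integral>\<^sup>+t. 0 \<partial>(lborel :: real measure))"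
        by (intro nn_integral_cong) simp
      then show ?thesis by simp
    next
      case 2
      have "?L \<le> ennreal I"
        unfolding I(1)[symmetric] by (intro nn_integral_mono) (auto simp: indicator_def)
      also have "I * 1 \<le> I * (2 powr (b + 1) * (r / max \<bar>x\<bar> r) powr (b + 1))"
      proof (intro mult_left_mono)
        have "1 \<le> (2 * (r / max \<bar>x\<bar> r)) powr (b + 1)"
          using 2 r b by (intro ge_one_powr_ge_zero) (auto simp: max_def)
        then show "1 \<le> 2 powr (b + 1) * (r / max \<bar>x\<bar> r) powr (b + 1)"
          using r by (subst (asm) powr_mult) auto
      qed (rule I)
      then have "ennreal I \<le> ennreal (C * (r / max \<bar>x\<bar> r) powr (b + 1))"
        unfolding C_def distrib_right using I b
        by (intro ennreal_leI add_increasing2 mult_nonneg_nonneg) (auto simp: mult_ac)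
      finally show ?thesis using 2 by (simp add: indicator_def)
    next
      case 3
      \<comment> \<open>From \<open>2 * \<bar>x\<bar> * \<bar>y\<bar> * (1 - cos t) < r\<^sup>2\<close>, \<open>2 * \<bar>y\<bar> \<ge> \<bar>x\<bar>\<close> and \<open>t\<^sup>2 / 8 \<le> 1 - cos t\<close>, with \<open>sqrt 8 < 3\<close>.\<close>
      define c where "c = 3 * r / \<bar>x\<bar>"
      have c: "0 \<le> c" "c \<le> pi / 2"
      proof -
        have "c \<le> 3 / 2" using 3 r by (simp add: c_def pos_divide_le_eq)
        then show "c \<le> pi / 2" using pi_gt3 by linarith
      qed (use r in \<open>simp add: c_def\<close>)
      have small: "t \<le> c" if t: "0 \<le> t" "t \<le> pi" "dunkl_dist \<bar>x\<bar> \<bar>y\<bar> t < r" for t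
      proof -
        have "(dunkl_dist \<bar>x\<bar> \<bar>y\<bar> t)\<^sup>2 < r\<^sup>2"
          using t dunkl_dist_nonneg r by (intro power_strict_mono) auto
        then have "(\<bar>x\<bar> - \<bar>y\<bar>)\<^sup>2 + 2 * \<bar>x\<bar> * \<bar>y\<bar> * (1 - cos t) < r\<^sup>2"
          unfolding dunkl_dist_square(1) by (simp add: power2_diff algebra_simps)
        then have *: "2 * \<bar>x\<bar> * \<bar>y\<bar> * (1 - cos t) < r\<^sup>2"
          using zero_le_power2[of "\<bar>x\<bar> - \<bar>y\<bar>"] by linarith
        have "\<bar>x\<bar> * \<bar>x\<bar> * (1 - cos t) \<le> \<bar>x\<bar> * (2 * \<bar>y\<bar>) * (1 - cos t)"
          using 3 by (intro mult_right_mono mult_left_mono) auto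
        with * have **: "\<bar>x\<bar>\<^sup>2 * (1 - cos t) < r\<^sup>2"
          by (simp add: power2_eq_square mult_ac)
        have "r\<^sup>2 < \<bar>x\<bar>\<^sup>2 * 1" using 3 r power_strict_mono[of r "\<bar>x\<bar>" 2] by simp
        with ** have "\<bar>x\<bar>\<^sup>2 * (1 - cos t) < \<bar>x\<bar>\<^sup>2 * 1" by simp
        moreover have "0 < \<bar>x\<bar>\<^sup>2" using 3 r by simp
        ultimately have "1 - cos t < 1" by (simp only: mult_less_cancel_left_pos)
        then have "0 < cos t" by simp
        then have "t < pi / 2"
          using t cos_monotone_0_pi_le[of "pi/2" t] by (cases "pi / 2 \<le> t") auto
        then have "t / 2 \<le> sin t" using t by (intro sin_ge_half) auto
        then have "(t / 2)\<^sup>2 \<le> (sin t)\<^sup>2" using t by (intro power_mono) auto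
        also have "\<dots> = (1 - cos t) * (1 + cos t)" by (simp add: sin_squared_eq power2_eq_square algebra_simps)
        also have "\<dots> \<le> (1 - cos t) * 2" by (intro mult_left_mono) auto
        finally have "\<bar>x\<bar>\<^sup>2 * t\<^sup>2 \<le> \<bar>x\<bar>\<^sup>2 * (8 * (1 - cos t))"
          by (intro mult_left_mono) (auto simp: power2_eq_square)
        also have "\<dots> = 8 * (\<bar>x\<bar>\<^sup>2 * (1 - cos t))" by simp
        also have "\<dots> \<le> 8 * r\<^sup>2" using ** by simp
        also have "\<dots> \<le> (3 * r)\<^sup>2" by (simp add: power_mult_distrib)
        finally have "(\<bar>x\<bar> * t)\<^sup>2 \<le> (3 * r)\<^sup>2" by (simp add: power_mult_distrib)
        then have "\<bar>x\<bar> * t \<le> 3 * r" by (rule power2_le_imp_le) (use r in simp)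
        then show ?thesis using 3 r by (simp add: c_def field_simps)
      qed
      have "?L = cap_integral b \<bar>x\<bar> \<bar>y\<bar> r"
        by (rule nn_integral_dunkl_dist_abs) simp
      also have "\<dots> \<le> (\<integral>\<^sup>+t\<in>{0..c}. ennreal (sin t powr b) \<partial>lborel)"
        using small by (intro nn_integral_mono) (auto simp: indicator_def)
      also have "\<dots> \<le> ennreal (2 powr \<bar>b\<bar> / (b + 1) * c powr (b + 1))"
        by (intro nn_integral_sin_powr_le b c)
      also have "2 powr \<bar>b\<bar> / (b + 1) * c powr (b + 1)
          = 2 powr \<bar>b\<bar> / (b + 1) * 3 powr (b + 1) * (r / max \<bar>x\<bar> r) powr (b + 1)"
        using 3 r by (simp add: c_def powr_mult powr_divide max_def)
      also have "\<dots> \<le> C * (r / max \<bar>x\<bar> r) powr (b + 1)"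
        using I b by (intro mult_right_mono) (auto simp: C_def)
      finally show ?thesis using 3 by (simp add: indicator_def ennreal_leI)
    qed
  qed
  ultimately show thesis by (rule that)
qed

text \<open>
  In the reflected angle \<open>pi - t\<close>, every angle up to \<open>r / (2 * max \<bar>x\<bar> r)\<close> satisfies
  \<open>dunkl_dist x z t < r\<close>, and there the factor \<open>1 - cos t\<close> has become \<open>1 + cos t \<ge> 1\<close>.
\<close>
lemma cap_lower_bound:
  assumes b: "-1 < b"
  obtains c where "0 < c"
    "\<And>x z r. 0 < r \<Longrightarrow> \<bar>z - x\<bar> < r / 2 \<Longrightarrow> ennreal (c * (r / max \<bar>x\<bar> r) powr (b + 1))
      \<le> (\<integral>\<^sup>+t\<in>{0..pi}. indicator {..<r} (dunkl_dist (- x) z t) * ennreal ((1 - cos t) * sin t powr b) \<partial>lborel)"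
proof -
  define c where "c = 1 / (2 powr \<bar>b\<bar> * (b + 1) * 2 powr (b + 1))"
  have "0 < c" using b by (simp add: c_def)
  moreover have "ennreal (c * (r / max \<bar>x\<bar> r) powr (b + 1))
      \<le> (\<integral>\<^sup>+t\<in>{0..pi}. indicator {..<r} (dunkl_dist (- x) z t) * ennreal ((1 - cos t) * sin t powr b) \<partial>lborel)"
      (is "_ \<le> ?R")
    if r: "0 < r" and z: "\<bar>z - x\<bar> < r / 2" for x z r
  proof -
    define m where "m = max \<bar>x\<bar> r"
    define \<tau> where "\<tau> = r / (2 * m)"
    have m: "r \<le> m" "\<bar>x\<bar> \<le> m" "0 < m" using r by (auto simp: m_def)
    have \<tau>: "0 < \<tau>" "\<tau> \<le> 1 / 2" "\<tau> \<le> pi / 2" "\<tau> \<le> pi"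
    proof -
      show "0 < \<tau>" "\<tau> \<le> 1 / 2" using m r by (auto simp: \<tau>_def pos_divide_le_eq)
      then show "\<tau> \<le> pi / 2" "\<tau> \<le> pi" using pi_gt3 by linarith+
    qed
    have near: "dunkl_dist x z t < r" if t: "0 \<le> t" "t \<le> \<tau>" for t
    proof (cases "\<bar>x\<bar> + \<bar>z\<bar> < r")
      case True
      then show ?thesis using dunkl_dist_bounds(2)[of x z t] by simp
    next
      case False
      then have xz: "x * z = \<bar>x\<bar> * \<bar>z\<bar>" using z by (auto simp: abs_if split: if_splits)
      have zm: "\<bar>z\<bar> \<le> 3 / 2 * m" using z m by linarith
      have "(sin (t / 2))\<^sup>2 \<le> (t / 2)\<^sup>2"
        by (intro abs_le_square_iff[THEN iffD1] abs_sin_x_le_abs_x)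
      then have "1 - cos t \<le> t\<^sup>2 / 2"
        using cos_double_sin[of "t / 2"] by (simp add: power2_eq_square)
      also have "\<dots> \<le> \<tau>\<^sup>2 / 2" using t by (simp add: power_mono)
      finally have "2 * (\<bar>x\<bar> * \<bar>z\<bar>) * (1 - cos t) \<le> 2 * (m * (3 / 2 * m)) * (\<tau>\<^sup>2 / 2)"
        using m zm by (intro mult_mono mult_left_mono) auto
      also have "\<dots> = 3 / 8 * r\<^sup>2" using m by (simp add: \<tau>_def power2_eq_square)
      finally have 1: "2 * (\<bar>x\<bar> * \<bar>z\<bar>) * (1 - cos t) \<le> 3 / 8 * r\<^sup>2" .
      have "(z - x)\<^sup>2 \<le> (r / 2)\<^sup>2" using z r by (intro abs_le_square_iff[THEN iffD1]) simp
      then have 2: "(x - z)\<^sup>2 \<le> r\<^sup>2 / 4" by (simp add: power2_commute power_divide)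
      have "(dunkl_dist x z t)\<^sup>2 = (x - z)\<^sup>2 + 2 * (x * z) * (1 - cos t)"
        unfolding dunkl_dist_square(1) by (simp add: power2_diff algebra_simps)
      also have "\<dots> \<le> 5 / 8 * r\<^sup>2" using 1 2 unfolding xz by linarith
      also have "\<dots> < r\<^sup>2" using r by simp
      finally show ?thesis using r dunkl_dist_nonneg[of x z t] by (auto dest: power2_less_imp_less)
    qed
    have "c * (r / m) powr (b + 1) = 1 / 2 powr \<bar>b\<bar> * (\<tau> powr (b + 1) / (b + 1))"
      using r m b by (simp add: c_def \<tau>_def powr_divide powr_mult field_simps)
    then have "ennreal (c * (r / m) powr (b + 1)) = ennreal (1 / 2 powr \<bar>b\<bar>) * ennreal (\<tau> powr (b + 1) / (b + 1))"
      using b by (simp flip: ennreal_mult)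
    also have "\<dots> \<le> ennreal (1 / 2 powr \<bar>b\<bar>) * (ennreal (2 powr \<bar>b\<bar>) * (\<integral>\<^sup>+t\<in>{0..\<tau>}. ennreal (sin t powr b) \<partial>lborel))"
      using \<tau> by (intro mult_left_mono nn_integral_sin_powr_ge b) auto
    also have "\<dots> = (\<integral>\<^sup>+t\<in>{0..\<tau>}. ennreal (sin t powr b) \<partial>lborel)"
      by (simp flip: mult.assoc ennreal_mult)
    also have "\<dots> \<le> (\<integral>\<^sup>+t\<in>{0..pi}. indicator {..<r} (dunkl_dist x z t) * ennreal ((1 + cos t) * sin t powr b) \<partial>lborel)"
    proof (rule nn_integral_mono)
      fix t :: real
      show "ennreal (sin t powr b) * indicator {0..\<tau>} t
        \<le> indicator {..<r} (dunkl_dist x z t) * ennreal ((1 + cos t) * sin t powr b) * indicator {0..pi} t"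
      proof (cases "t \<in> {0..\<tau>}")
        case True
        then have "0 \<le> cos t" using \<tau> by (intro cos_ge_zero) auto
        then have "sin t powr b \<le> (1 + cos t) * sin t powr b"
          by (simp add: distrib_right)
        then show ?thesis using True near[of t] \<tau> by (simp add: ennreal_leI)
      qed simp
    qed
    also have "\<dots> = ?R"
      by (subst nn_integral_Icc_reflect[symmetric]) (auto simp: dunkl_dist_reflect)
    finally show ?thesis by (simp add: m_def)
  qed
  ultimately show thesis by (rule that)
qed

section \<open>The product formula\<close>

text \<open>
  The density, with respect to Lebesgue measure in \<open>z\<close>, of the image of \<open>sin t powr (2 * \<alpha>)\<close> under
  \<open>t \<mapsto> dunkl_dist x y t\<close>, extended evenly to negative \<open>z\<close>. The product under the root is sixteen times
  the squared area of the triangle with sides \<open>\<bar>x\<bar>\<close>, \<open>\<bar>y\<bar>\<close>, \<open>\<bar>z\<bar>\<close> (Heron's formula), which is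
  \<open>(2 * x * y * sin t)\<^sup>2\<close> for the angle \<open>t\<close> between the sides \<open>\<bar>x\<bar>\<close> and \<open>\<bar>y\<bar>\<close>.
\<close>
definition dunkl_kernel :: "real \<Rightarrow> real \<Rightarrow> real \<Rightarrow> real \<Rightarrow> real" where
  "dunkl_kernel \<alpha> x y z = (if \<bar>\<bar>x\<bar> - \<bar>y\<bar>\<bar> < \<bar>z\<bar> \<and> \<bar>z\<bar> < \<bar>x\<bar> + \<bar>y\<bar> then
     2 powr (1 - 2 * \<alpha>) * sqrt ((z\<^sup>2 - (\<bar>x\<bar> - \<bar>y\<bar>)\<^sup>2) * ((\<bar>x\<bar> + \<bar>y\<bar>)\<^sup>2 - z\<^sup>2)) powr (2 * \<alpha> - 1)
       * \<bar>z\<bar> / \<bar>x * y\<bar> powr (2 * \<alpha>) else 0)"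

lemma dunkl_kernel_measurable [measurable]:
  "(\<lambda>w. dunkl_kernel \<alpha> (f w) (g w) (h w)) \<in> borel_measurable M"
  if [measurable]: "f \<in> borel_measurable M" "g \<in> borel_measurable M" "h \<in> borel_measurable M"
  unfolding dunkl_kernel_def by measurable

lemma dunkl_kernel_nonneg: "0 \<le> dunkl_kernel \<alpha> x y z"
  by (simp add: dunkl_kernel_def)

lemma dunkl_kernel_minus [simp]:
  "dunkl_kernel \<alpha> (- x) y z = dunkl_kernel \<alpha> x y z"
  "dunkl_kernel \<alpha> x (- y) z = dunkl_kernel \<alpha> x y z"
  "dunkl_kernel \<alpha> x y (- z) = dunkl_kernel \<alpha> x y z"
  by (simp_all add: dunkl_kernel_def)

lemma dunkl_kernel_abs:
  "dunkl_kernel \<alpha> \<bar>x\<bar> \<bar>y\<bar> z = dunkl_kernel \<alpha> x y z"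
  by (simp add: dunkl_kernel_def abs_mult)

text \<open>
  Heron's expression and the triangle condition are symmetric in the three sides. This is one
  half of the self-adjointness of the translation; the other half is \<open>dunkl_factor_swap\<close>.
\<close>
lemma dunkl_kernel_symmetric:
  assumes "y \<noteq> 0" "z \<noteq> 0"
  shows "\<bar>y\<bar> powr (2 * \<alpha> + 1) * dunkl_kernel \<alpha> x y z = \<bar>z\<bar> powr (2 * \<alpha> + 1) * dunkl_kernel \<alpha> x z y"
proof -
  have heron: "(z\<^sup>2 - (\<bar>x\<bar> - \<bar>y\<bar>)\<^sup>2) * ((\<bar>x\<bar> + \<bar>y\<bar>)\<^sup>2 - z\<^sup>2)
      = (y\<^sup>2 - (\<bar>x\<bar> - \<bar>z\<bar>)\<^sup>2) * ((\<bar>x\<bar> + \<bar>z\<bar>)\<^sup>2 - y\<^sup>2)"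
  proof -
    have *: "(w\<^sup>2 - (u - v)\<^sup>2) * ((u + v)\<^sup>2 - w\<^sup>2) = (v\<^sup>2 - (u - w)\<^sup>2) * ((u + w)\<^sup>2 - v\<^sup>2)" for u v w :: real
      by (simp add: power2_eq_square algebra_simps)
    show ?thesis using *[of "\<bar>z\<bar>" "\<bar>x\<bar>" "\<bar>y\<bar>"] by simp
  qed
  have tri: "(\<bar>\<bar>x\<bar> - \<bar>y\<bar>\<bar> < \<bar>z\<bar> \<and> \<bar>z\<bar> < \<bar>x\<bar> + \<bar>y\<bar>) \<longleftrightarrow> (\<bar>\<bar>x\<bar> - \<bar>z\<bar>\<bar> < \<bar>y\<bar> \<and> \<bar>y\<bar> < \<bar>x\<bar> + \<bar>z\<bar>)"
    by linarith
  have pw: "\<bar>v\<bar> powr (2 * \<alpha> + 1) = \<bar>v\<bar> powr (2 * \<alpha>) * \<bar>v\<bar>" for v :: real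
    by (cases "v = 0") (simp_all add: powr_add)
  show ?thesis
    unfolding dunkl_kernel_def heron tri pw using assms
    by (simp add: abs_mult powr_mult)
qed

text \<open>
  The substitution \<open>z = dunkl_dist x y t\<close>. The hypothesis \<open>\<bar>x\<bar> \<noteq> \<bar>y\<bar>\<close> keeps the distance away from \<open>0\<close>, where the
  square root is not differentiable; it excludes only finitely many \<open>y\<close> for each \<open>x\<close>.
\<close>
lemma nn_integral_dunkl_kernel:
  fixes F :: "real \<Rightarrow> ennreal"
  assumes [measurable]: "F \<in> borel_measurable borel"
    and xy: "x \<noteq> 0" "y \<noteq> 0" "\<bar>x\<bar> \<noteq> \<bar>y\<bar>"
  shows "(\<integral>\<^sup>+t\<in>{0..pi}. F (dunkl_dist x y t) * ennreal (sin t powr (2 * \<alpha>)) \<partial>lborel)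
       = (\<integral>\<^sup>+z\<in>{0<..}. F z * ennreal (dunkl_kernel \<alpha> x y z) \<partial>lborel)"
proof -
  define a c where "a = \<bar>x\<bar>" and "c = \<bar>y\<bar>"
  have ac: "0 < a" "0 < c" "a \<noteq> c" using xy by (auto simp: a_def c_def)
  define g' where "g' = (\<lambda>t. a * c * sin t / dunkl_dist a c t)"
  have pos: "0 < dunkl_dist a c t" for t
    using dunkl_dist_bounds(1)[of a c t] ac by auto
  have pos2: "0 < a\<^sup>2 + c\<^sup>2 - 2 * a * c * cos t" for t
    using pos[of t] by (simp add: dunkl_dist_def)
  have "(\<integral>\<^sup>+t\<in>{0..pi}. F (dunkl_dist x y t) * ennreal (sin t powr (2 * \<alpha>)) \<partial>lborel)
      = (\<integral>\<^sup>+t\<in>{0..pi}. F (dunkl_dist a c t) * ennreal (sin t powr (2 * \<alpha>)) \<partial>lborel)"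
    unfolding a_def c_def by (rule nn_integral_dunkl_dist_abs) measurable
  also have "\<dots> = (\<integral>\<^sup>+t. F (dunkl_dist a c t) * ennreal (dunkl_kernel \<alpha> a c (dunkl_dist a c t)) * ennreal (g' t)
        * indicator {0..pi} t \<partial>lborel)"
  proof (rule nn_integral_cong_AE)
    show "AE t in lborel. F (dunkl_dist a c t) * ennreal (sin t powr (2 * \<alpha>)) * indicator {0..pi} t
      = F (dunkl_dist a c t) * ennreal (dunkl_kernel \<alpha> a c (dunkl_dist a c t)) * ennreal (g' t) * indicator {0..pi} t"
      using AE_lborel_singleton[of 0] AE_lborel_singleton[of pi]
    proof eventually_elim
      case (elim t)
      show ?case
      proof (cases "t \<in> {0..pi}")
        case True
        with elim have t: "0 < t" "t < pi" by auto
        define d where "d = dunkl_dist a c t"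
        have d: "0 < d" "d\<^sup>2 = a\<^sup>2 + c\<^sup>2 - 2 * a * c * cos t"
          using pos dunkl_dist_square(1)[of a c t] by (auto simp: d_def)
        have s: "0 < sin t" using t by (intro sin_gt_zero) auto
        have cs: "cos t < 1" "-1 < cos t"
          using cos_monotone_0_pi[of 0 t] cos_monotone_0_pi[of t pi] t by auto
        have e1: "d\<^sup>2 - (a - c)\<^sup>2 = 2 * a * c * (1 - cos t)" and e2: "(a + c)\<^sup>2 - d\<^sup>2 = 2 * a * c * (1 + cos t)"
          unfolding d(2) by (simp_all add: power2_eq_square algebra_simps)
        have "0 < d\<^sup>2 - (a - c)\<^sup>2" "0 < (a + c)\<^sup>2 - d\<^sup>2"
          unfolding e1 e2 using ac cs by auto
        then have "\<bar>a - c\<bar>\<^sup>2 < d\<^sup>2" "d\<^sup>2 < (a + c)\<^sup>2" by auto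
        then have tri: "\<bar>a - c\<bar> < d" "d < a + c" using d(1) ac
          by (auto intro: power2_less_imp_less)
        have "(d\<^sup>2 - (a - c)\<^sup>2) * ((a + c)\<^sup>2 - d\<^sup>2) = (2 * (a * c) * sin t)\<^sup>2"
          unfolding e1 e2 power_mult_distrib sin_squared_eq by (simp add: power2_eq_square algebra_simps)
        then have "sqrt ((d\<^sup>2 - (a - c)\<^sup>2) * ((a + c)\<^sup>2 - d\<^sup>2)) = 2 * (a * c) * sin t"
          using s ac by simp
        then have "dunkl_kernel \<alpha> a c d
            = 2 powr (1 - 2 * \<alpha>) * (2 * (a * c) * sin t) powr (2 * \<alpha> - 1) * d / (a * c) powr (2 * \<alpha>)"
          using tri ac d(1) by (simp add: dunkl_kernel_def)
        moreover have "(2 * (a * c) * sin t) powr (2 * \<alpha> - 1)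
            = 2 powr (2 * \<alpha> - 1) * ((a * c) powr (2 * \<alpha>) / (a * c)) * (sin t powr (2 * \<alpha>) / sin t)"
          using ac s by (simp add: powr_mult powr_diff)
        ultimately have "dunkl_kernel \<alpha> a c d * g' t = 2 powr (1 - 2 * \<alpha>) * 2 powr (2 * \<alpha> - 1) * sin t powr (2 * \<alpha>)"
          using ac s d(1) by (simp add: g'_def d_def[symmetric])
        also have "\<dots> = sin t powr (2 * \<alpha>)" by (simp flip: powr_add)
        finally have "sin t powr (2 * \<alpha>) = dunkl_kernel \<alpha> a c d * g' t" by simp
        then show ?thesis
          using dunkl_kernel_nonneg[of \<alpha> a c d] by (simp add: d_def ennreal_mult' mult.assoc)
      qed simp
    qed
  qed
  also have "\<dots> = (\<integral>\<^sup>+z. F z * ennreal (dunkl_kernel \<alpha> a c z) * indicator {dunkl_dist a c 0..dunkl_dist a c pi} z \<partial>lborel)"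
  proof (rule nn_integral_substitution_aux[symmetric])
    fix t assume t: "t \<in> {0..pi}"
    show "(dunkl_dist a c has_real_derivative g' t) (at t)"
      unfolding dunkl_dist_def g'_def using pos2[of t]
      by (auto intro!: derivative_eq_intros simp: divide_simps)
    show "0 \<le> g' t" using t ac pos[of t] sin_ge_zero[of t] by (simp add: g'_def)
  next
    show "continuous_on {0..pi} g'"
      unfolding g'_def dunkl_dist_def using pos2 by (intro continuous_intros) (auto simp: less_imp_neq[symmetric])
  qed (auto simp: pi_gt_zero)
  also have "\<dots> = (\<integral>\<^sup>+z\<in>{0<..}. F z * ennreal (dunkl_kernel \<alpha> a c z) \<partial>lborel)"
  proof (intro nn_integral_cong)
    fix z
    have "dunkl_dist a c 0 = \<bar>a - c\<bar>" "dunkl_dist a c pi = a + c"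
    proof -
      have "a\<^sup>2 + c\<^sup>2 - 2 * a * c = (a - c)\<^sup>2" "a\<^sup>2 + c\<^sup>2 + 2 * a * c = (a + c)\<^sup>2"
        by (simp_all add: power2_diff power2_sum)
      then show "dunkl_dist a c 0 = \<bar>a - c\<bar>" "dunkl_dist a c pi = a + c"
        using ac by (simp_all add: dunkl_dist_def)
    qed
    then show "F z * ennreal (dunkl_kernel \<alpha> a c z) * indicator {dunkl_dist a c 0..dunkl_dist a c pi} z
       = F z * ennreal (dunkl_kernel \<alpha> a c z) * indicator {0<..} z"
      using ac by (auto simp: dunkl_kernel_def indicator_def)
  qed
  finally show ?thesis by (simp add: a_def c_def dunkl_kernel_abs)
qed

definition dunkl_density :: "real \<Rightarrow> real \<Rightarrow> real" where
  "dunkl_density \<alpha> x = inverse (2 powr (\<alpha> + 1) * Gamma (\<alpha> + 1)) * \<bar>x\<bar> powr (2 * \<alpha> + 1)"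

text \<open>
  The restriction of the Dunkl measure to the Borel sets. Fubini's theorem needs jointly
  measurable integrands, and composing a Lebesgue measurable function with the distance need not give one;
  so Lebesgue measurable functions are replaced by Borel ones that agree with them almost everywhere.
\<close>
definition dunkl_borel :: "real \<Rightarrow> real measure" where
  "dunkl_borel \<alpha> = density lborel (\<lambda>x. ennreal (dunkl_density \<alpha> x))"

abbreviation dunkl_ball :: "real \<Rightarrow> (real \<Rightarrow> real) \<Rightarrow> real \<Rightarrow> real \<Rightarrow> ennreal" where
  "dunkl_ball \<alpha> \<equiv> ball_integral (dunkl_borel \<alpha>)"

lemma dunkl_measure_eq_density: "dunkl_measure \<alpha> = density lebesgue (\<lambda>x. ennreal (dunkl_density \<alpha> x))"
  by (simp add: dunkl_measure_def dunkl_density_def)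

lemma dunkl_density_measurable [measurable]:
  "(\<lambda>w. dunkl_density \<alpha> (f w)) \<in> borel_measurable M" if [measurable]: "f \<in> borel_measurable M"
  unfolding dunkl_density_def by measurable

lemma sets_dunkl_borel [simp, measurable_cong]: "sets (dunkl_borel \<alpha>) = sets borel"
  by (simp add: dunkl_borel_def)

lemma space_dunkl_borel [simp]: "space (dunkl_borel \<alpha>) = UNIV"
  by (simp add: dunkl_borel_def)

lemma dunkl_density_minus [simp]: "dunkl_density \<alpha> (- x) = dunkl_density \<alpha> x"
  by (simp add: dunkl_density_def)

lemma dunkl_density_pos: "0 < dunkl_density \<alpha> x" if "- 1 / 2 \<le> \<alpha>" "x \<noteq> 0"
  using that Gamma_real_pos[of "\<alpha> + 1"] by (simp add: dunkl_density_def)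

lemma dunkl_density_nonneg: "0 \<le> dunkl_density \<alpha> x" if "- 1 / 2 \<le> \<alpha>"
  using that Gamma_real_pos[of "\<alpha> + 1"] by (simp add: dunkl_density_def)

lemma nn_integral_dunkl_borel:
  assumes [measurable]: "h \<in> borel_measurable borel"
  shows "(\<integral>\<^sup>+x. h x \<partial>dunkl_borel \<alpha>) = (\<integral>\<^sup>+x. ennreal (dunkl_density \<alpha> x) * h x \<partial>lborel)"
  unfolding dunkl_borel_def by (rule nn_integral_density) measurable

lemma integral_dunkl_borel:
  fixes h :: "real \<Rightarrow> 'b::{banach, second_countable_topology}"
  assumes [measurable]: "h \<in> borel_measurable borel" and "- 1 / 2 \<le> \<alpha>"
  shows "(LINT x|dunkl_borel \<alpha>. h x) = (LINT x|lborel. dunkl_density \<alpha> x *\<^sub>R h x)"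
  unfolding dunkl_borel_def using dunkl_density_nonneg[OF assms(2)]
  by (intro integral_density) auto

text \<open>
  The substitution formula, applied to the indicator of a null set, shows that the distance maps
  no set of angles of positive measure into a null set. So the translate of a function at \<open>y\<close> only
  depends on its class modulo null sets, for all but finitely many \<open>y\<close>.
\<close>
lemma AE_dist_kernel:
  assumes xy: "x \<noteq> 0" "y \<noteq> 0" "\<bar>x\<bar> \<noteq> \<bar>y\<bar>" and P: "AE z in lborel. P z"
  shows "AE t in lborel. t \<in> {0..pi} \<longrightarrow> P (dunkl_dist x y t) \<and> P (- dunkl_dist x y t)"
proof -
  obtain N where N: "N \<in> null_sets lborel" "\<And>z. z \<notin> N \<Longrightarrow> P z"
    using P by (auto simp: eventually_ae_filter)
  define N' where "N' = N \<union> uminus -` N"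
  have [measurable]: "N \<in> sets borel" using N by auto
  have [measurable]: "N' \<in> sets borel" unfolding N'_def
    by (intro sets.Un measurable_sets_borel[of _ borel]) simp_all
  have "AE z in lborel. z \<notin> N'"
  proof -
    have "AE z in lborel. - z \<notin> N"
      using AE_distrD[of uminus lborel borel "\<lambda>z. z \<notin> N"] N(1)
      by (simp add: lborel_distr_uminus AE_not_in)
    with AE_not_in[OF N(1)] show ?thesis by eventually_elim (simp add: N'_def)
  qed
  then have "(\<integral>\<^sup>+z\<in>{0<..}. indicator N' z * ennreal (dunkl_kernel 0 x y z) \<partial>lborel) = 0"
    by (subst nn_integral_0_iff_AE) (auto elim: eventually_mono)
  then have "(\<integral>\<^sup>+t\<in>{0..pi}. indicator N' (dunkl_dist x y t) * ennreal (sin t powr (2 * 0)) \<partial>lborel) = 0"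
    by (subst nn_integral_dunkl_kernel) (use xy in auto)
  then have "AE t in lborel. indicator N' (dunkl_dist x y t) * ennreal (sin t powr (2 * 0)) * indicator {0..pi} t = 0"
    by (subst (asm) nn_integral_0_iff_AE) auto
  with AE_lborel_singleton[of 0] AE_lborel_singleton[of pi] show ?thesis
  proof eventually_elim
    case (elim t)
    show ?case
    proof
      assume t: "t \<in> {0..pi}"
      with elim have "0 < sin t" by (intro sin_gt_zero) auto
      with elim(3) t have "dunkl_dist x y t \<notin> N'" by (auto simp: indicator_def split: if_splits)
      then show "P (dunkl_dist x y t) \<and> P (- dunkl_dist x y t)" by (auto simp: N'_def N(2))
    qed
  qed
qed

lemma integral_lebesgue_eq_borel:
  fixes f g :: "real \<Rightarrow> 'b::euclidean_space"
  assumes g [measurable]: "g \<in> borel_measurable borel" and ae: "AE x in lborel. f x = g x"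
  shows "(LINT x|lebesgue. f x) = (LINT x|lborel. g x)"
proof -
  have m: "g \<in> borel_measurable lebesgue" by (rule measurable_completion) simp
  have ae': "AE x in lebesgue. g x = f x"
    by (rule AE_completion) (use ae in eventually_elim, simp)
  with m have m': "f \<in> borel_measurable lebesgue" by (rule borel_measurable_AE)
  have "(LINT x|lebesgue. g x) = (LINT x|lebesgue. f x)"
    using m m' ae' by (rule integral_cong_AE)
  moreover have "(LINT x|lebesgue. g x) = (LINT x|lborel. g x)"
    by (rule integral_completion) simp
  ultimately show ?thesis by simp
qed

definition dunkl_integrand :: "real \<Rightarrow> real \<Rightarrow> (real \<Rightarrow> real) \<Rightarrow> real \<Rightarrow> real \<Rightarrow> real" where
  "dunkl_integrand \<alpha> x g y t = indicator {0..pi} t *\<^sub>R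
     ((g (dunkl_dist x y t) + g (- dunkl_dist x y t)
        + (x + y) / dunkl_dist x y t * (g (dunkl_dist x y t) - g (- dunkl_dist x y t)))
       * (1 - cos t) * sin t powr (2 * \<alpha>))"

lemma dunkl_translation_eq_integrand:
  "dunkl_translation \<alpha> x g y = (if \<alpha> = - 1 / 2 then g (x + y)
     else dunkl_const \<alpha> / 2 * (LINT t|lebesgue. dunkl_integrand \<alpha> x g y t))"
  unfolding dunkl_translation_def set_lebesgue_integral_def dunkl_integrand_def ..

lemma dunkl_integrand_measurable [measurable]:
  "(\<lambda>w. dunkl_integrand \<alpha> (f w) g (h w) (k w)) \<in> borel_measurable M"
  if [measurable]: "g \<in> borel_measurable borel" "f \<in> borel_measurable M" "h \<in> borel_measurable M" "k \<in> borel_measurable M"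
  unfolding dunkl_integrand_def by measurable

lemma dunkl_translation_lborel:
  assumes [measurable]: "g \<in> borel_measurable borel"
  shows "dunkl_translation \<alpha> x g y = (if \<alpha> = - 1 / 2 then g (x + y)
     else dunkl_const \<alpha> / 2 * (LINT t|lborel. dunkl_integrand \<alpha> x g y t))"
proof -
  have "(LINT t|lebesgue. dunkl_integrand \<alpha> x g y t) = (LINT t|lborel. dunkl_integrand \<alpha> x g y t)"
    by (rule integral_lebesgue_eq_borel) simp_all
  then show ?thesis by (simp only: dunkl_translation_eq_integrand)
qed

lemma dunkl_translation_AE_cong:
  assumes "x \<noteq> 0" "y \<noteq> 0" "\<bar>x\<bar> \<noteq> \<bar>y\<bar>" "\<alpha> \<noteq> - 1 / 2"
    and g: "AE z in lborel. g z = g' z" and [measurable]: "g' \<in> borel_measurable borel"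
  shows "dunkl_translation \<alpha> x g y = dunkl_translation \<alpha> x g' y"
proof -
  have "AE t in lborel. dunkl_integrand \<alpha> x g y t = dunkl_integrand \<alpha> x g' y t"
    using AE_dist_kernel[OF assms(1-3) g]
  proof eventually_elim
    case (elim t)
    then show ?case by (cases "t \<in> {0..pi}") (simp_all add: dunkl_integrand_def)
  qed
  then have "(LINT t|lebesgue. dunkl_integrand \<alpha> x g y t) = (LINT t|lborel. dunkl_integrand \<alpha> x g' y t)"
    by (rule integral_lebesgue_eq_borel[rotated]) simp
  with assms(4) show ?thesis
    by (simp only: dunkl_translation_lborel[OF \<open>g' \<in> borel_measurable borel\<close>]) (simp add: dunkl_translation_eq_integrand)
qed

lemma dunkl_translation_measurable [measurable]:
  assumes [measurable]: "g \<in> borel_measurable borel" "f \<in> borel_measurable M" "h \<in> borel_measurable M"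
  shows "(\<lambda>w. dunkl_translation \<alpha> (f w) g (h w)) \<in> borel_measurable M"
  by (simp add: dunkl_translation_lborel)

text \<open>
  With \<open>\<sigma> u v w = (u\<^sup>2 + v\<^sup>2 - w\<^sup>2) / (2 * u * v)\<close> this is Roesler's sign factor
  \<open>1 - \<sigma> x y z + \<sigma> z x y + \<sigma> z y x\<close>, in a form that displays its symmetries.
\<close>
definition dunkl_factor :: "real \<Rightarrow> real \<Rightarrow> real \<Rightarrow> real" where
  "dunkl_factor x y z = (x + y + z) * (z\<^sup>2 - (x - y)\<^sup>2) / (2 * x * y * z)"

lemma dunkl_factor_measurable [measurable]:
  "(\<lambda>w. dunkl_factor (f w) (g w) (h w)) \<in> borel_measurable M"
  if [measurable]: "f \<in> borel_measurable M" "g \<in> borel_measurable M" "h \<in> borel_measurable M"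
  unfolding dunkl_factor_def by measurable

text \<open>
  Exchanging \<open>y\<close> and \<open>z\<close> together with the reflection of \<open>x\<close> permutes the three linear factors
  \<open>x + y + z\<close>, \<open>z - x + y\<close> and \<open>z + x - y\<close> up to the sign that the denominator also acquires.
\<close>
lemma dunkl_factor_swap: "dunkl_factor (- x) z y = dunkl_factor x y z"
proof -
  have "(- x + z + y) * (y\<^sup>2 - (- x - z)\<^sup>2) = - ((x + y + z) * (z\<^sup>2 - (x - y)\<^sup>2))"
    by (simp add: power2_eq_square algebra_simps)
  then show ?thesis by (simp add: dunkl_factor_def mult_ac)
qed

text \<open>
  On the support of the kernel, \<open>\<bar>x\<bar>\<close>, \<open>\<bar>y\<bar>\<close>, \<open>\<bar>z\<bar>\<close> are the sides of a triangle, so each of the three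
  quotients \<open>\<sigma>\<close> is, up to sign, the cosine of one of its angles.
\<close>
lemma abs_dunkl_factor_le:
  assumes "dunkl_kernel \<alpha> x y z \<noteq> 0"
  shows "\<bar>dunkl_factor x y z\<bar> \<le> 4"
proof -
  have tri: "\<bar>\<bar>x\<bar> - \<bar>y\<bar>\<bar> < \<bar>z\<bar>" "\<bar>z\<bar> < \<bar>x\<bar> + \<bar>y\<bar>" and "x * y \<noteq> 0"
    using assms by (auto simp: dunkl_kernel_def split: if_splits)
  then have nz: "x \<noteq> 0" "y \<noteq> 0" "z \<noteq> 0" by auto
  have \<sigma>: "\<bar>(u\<^sup>2 + v\<^sup>2 - w\<^sup>2) / (2 * u * v)\<bar> \<le> 1"
    if "\<bar>\<bar>u\<bar> - \<bar>v\<bar>\<bar> \<le> \<bar>w\<bar>" "\<bar>w\<bar> \<le> \<bar>u\<bar> + \<bar>v\<bar>" for u v w :: real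
  proof -
    have "(\<bar>u\<bar> - \<bar>v\<bar>)\<^sup>2 \<le> w\<^sup>2" "w\<^sup>2 \<le> (\<bar>u\<bar> + \<bar>v\<bar>)\<^sup>2"
      using that by (auto intro!: abs_le_square_iff[THEN iffD1])
    then have "\<bar>u\<^sup>2 + v\<^sup>2 - w\<^sup>2\<bar> \<le> 2 * \<bar>u\<bar> * \<bar>v\<bar>"
      by (simp add: power2_diff power2_sum abs_le_iff)
    moreover have "0 < 2 * \<bar>u\<bar> * \<bar>v\<bar>" if "u \<noteq> 0" "v \<noteq> 0" using that by simp
    ultimately show ?thesis
      by (cases "u = 0 \<or> v = 0") (auto simp: abs_mult divide_le_eq_1_pos)
  qed
  have "dunkl_factor x y z = 1 - (x\<^sup>2 + y\<^sup>2 - z\<^sup>2) / (2 * x * y)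
      + (z\<^sup>2 + x\<^sup>2 - y\<^sup>2) / (2 * z * x) + (z\<^sup>2 + y\<^sup>2 - x\<^sup>2) / (2 * z * y)"
    using nz by (simp add: dunkl_factor_def field_simps power2_eq_square)
  moreover have "\<bar>(x\<^sup>2 + y\<^sup>2 - z\<^sup>2) / (2 * x * y)\<bar> \<le> 1" "\<bar>(z\<^sup>2 + x\<^sup>2 - y\<^sup>2) / (2 * z * x)\<bar> \<le> 1"
     "\<bar>(z\<^sup>2 + y\<^sup>2 - x\<^sup>2) / (2 * z * y)\<bar> \<le> 1"
    using tri by (intro \<sigma>; linarith)+
  ultimately show ?thesis by linarith
qed

text \<open>
  The bracket in the definition of the translation, times \<open>1 - cos t\<close>, is \<open>H d = g d * T d + g (- d) * T (- d)\<close>, where \<open>d\<close> is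
  the distance and \<open>T\<close> the sign factor; the substitution turns the integral of \<open>H\<close> over the angles
  into an integral over \<open>z > 0\<close>, and the two terms of \<open>H\<close> become the two half-lines.
\<close>
lemma dunkl_translation_product_formula:
  assumes \<alpha>: "- 1 / 2 < \<alpha>" and xy: "x \<noteq> 0" "y \<noteq> 0" "\<bar>x\<bar> \<noteq> \<bar>y\<bar>"
    and [measurable]: "g \<in> borel_measurable borel"
    and int: "integrable lborel (\<lambda>z. g z * dunkl_factor x y z * dunkl_kernel \<alpha> x y z)"
  shows "dunkl_translation \<alpha> x g y
    = dunkl_const \<alpha> / 2 * (LINT z|lborel. g z * dunkl_factor x y z * dunkl_kernel \<alpha> x y z)"
proof -
  define u where "u = (\<lambda>z. g z * dunkl_factor x y z * dunkl_kernel \<alpha> x y z)"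
  define H where "H = (\<lambda>z. g z * dunkl_factor x y z + g (- z) * dunkl_factor x y (- z))"
  have [measurable]: "H \<in> borel_measurable borel" "u \<in> borel_measurable borel"
    unfolding H_def u_def by measurable
  let ?d = "dunkl_dist x y"
  have d: "0 < ?d t" for t using dunkl_dist_bounds(1)[of x y t] xy by linarith
  have H: "(g (?d t) + g (- ?d t) + (x + y) / ?d t * (g (?d t) - g (- ?d t))) * (1 - cos t) = H (?d t)" for t
  proof -
    have "(?d t)\<^sup>2 - (x - y)\<^sup>2 = 2 * x * y * (1 - cos t)"
      unfolding dunkl_dist_square(1) by (simp add: power2_eq_square algebra_simps)
    then have T: "dunkl_factor x y (?d t) = (1 + (x + y) / ?d t) * (1 - cos t)"
       "dunkl_factor x y (- ?d t) = (1 - (x + y) / ?d t) * (1 - cos t)"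
      using xy d[of t] by (simp_all add: dunkl_factor_def divide_simps) (simp_all add: algebra_simps)
    show ?thesis unfolding H_def T by (simp only: algebra_simps)
  qed
  have distr: "distr (density lborel (\<lambda>t. ennreal (sin t powr (2 * \<alpha>) * indicator {0..pi} t))) borel ?d
     = density lborel (\<lambda>z. ennreal (dunkl_kernel \<alpha> x y z * indicator {0<..} z))" (is "?L = ?R")
  proof (rule measure_eqI)
    fix A assume "A \<in> sets ?L"
    then have [measurable]: "A \<in> sets borel" by simp
    have "emeasure ?L A = (\<integral>\<^sup>+t\<in>{0..pi}. indicator A (?d t) * ennreal (sin t powr (2 * \<alpha>)) \<partial>lborel)"
      by (subst nn_integral_indicator[symmetric], simp, subst nn_integral_distr, simp, simp,
          subst nn_integral_density, simp, simp)
         (auto intro!: nn_integral_cong simp: indicator_def)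
    also have "\<dots> = (\<integral>\<^sup>+z\<in>{0<..}. indicator A z * ennreal (dunkl_kernel \<alpha> x y z) \<partial>lborel)"
      by (rule nn_integral_dunkl_kernel) (use xy in auto)
    also have "\<dots> = emeasure ?R A"
      by (simp add: emeasure_density) (auto intro!: nn_integral_cong simp: indicator_def)
    finally show "emeasure ?L A = emeasure ?R A" .
  qed simp
  have "dunkl_integrand \<alpha> x g y t = (sin t powr (2 * \<alpha>) * indicator {0..pi} t) *\<^sub>R H (?d t)" for t
    unfolding dunkl_integrand_def H by simp
  then have "(LINT t|lborel. dunkl_integrand \<alpha> x g y t)
      = (LINT t|lborel. (sin t powr (2 * \<alpha>) * indicator {0..pi} t) *\<^sub>R H (?d t))"
    by simp
  also have "\<dots> = (LINT t|density lborel (\<lambda>t. ennreal (sin t powr (2 * \<alpha>) * indicator {0..pi} t)). H (?d t))"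
    by (rule integral_density[symmetric]) (auto simp: indicator_def)
  also have "\<dots> = (LINT z|?L. H z)"
    by (rule integral_distr[symmetric]) auto
  also have "\<dots> = (LINT z|lborel. (dunkl_kernel \<alpha> x y z * indicator {0<..} z) *\<^sub>R H z)"
    unfolding distr by (rule integral_density) (auto simp: indicator_def dunkl_kernel_nonneg)
  also have "\<dots> = (LINT z|lborel. indicator {0<..} z * u z + indicator {0<..} z * u (- z))"
    by (intro Bochner_Integration.integral_cong) (auto simp: H_def u_def indicator_def algebra_simps)
  also have "\<dots> = (LINT z|lborel. indicator {0<..} z * u z) + (LINT z|lborel. indicator {0<..} z * u (- z))"
  proof (rule Bochner_Integration.integral_add)
    have "integrable lborel u" using int by (simp add: u_def)
    moreover from lborel_integrable_real_affine[OF this, of "-1" 0] have "integrable lborel (\<lambda>z. u (- z))" by simp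
    ultimately show "integrable lborel (\<lambda>z. indicator {0<..} z * u z)" "integrable lborel (\<lambda>z. indicator {0<..} z * u (- z))"
      by (auto intro!: integrable_real_mult_indicator simp: mult.commute[of "indicator _ _"])
  qed
  also have "(LINT z|lborel. indicator {0<..} z * u (- z)) = (LINT z|lborel. indicator {..<0} z * u z)"
    by (subst lborel_integral_real_affine[where c = "-1" and t = 0]) (auto intro!: Bochner_Integration.integral_cong simp: indicator_def)
  also have "(LINT z|lborel. indicator {0<..} z * u z) + \<dots> = (LINT z|lborel. indicator {0<..} z * u z + indicator {..<0} z * u z)"
    using int unfolding u_def[symmetric]
    by (intro Bochner_Integration.integral_add[symmetric])
       (auto intro!: integrable_real_mult_indicator simp: mult.commute[of "indicator _ _"])
  also have "\<dots> = (LINT z|lborel. u z)"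
    by (intro integral_cong_AE, measurable) (use AE_lborel_singleton[of 0] in eventually_elim, auto simp: indicator_def)
  finally show ?thesis using \<alpha> by (simp add: dunkl_translation_lborel u_def)
qed

section \<open>Translates of balls\<close>

lemma dunkl_const_pos:
  assumes "- 1 / 2 < \<alpha>"
  shows "0 < dunkl_const \<alpha>"
proof -
  have b: "- 1 < 2 * \<alpha>" using assms by simp
  let ?I = "\<integral>\<^sup>+t. ennreal (indicator {0..pi} t *\<^sub>R sin t powr (2 * \<alpha>)) \<partial>lborel"
  have I: "?I = (\<integral>\<^sup>+t\<in>{0..pi}. ennreal (sin t powr (2 * \<alpha>)) \<partial>lborel)"
    by (intro nn_integral_cong) (simp add: indicator_def)
  have "0 < ennreal ((pi / 2) powr (2 * \<alpha> + 1) / (2 * \<alpha> + 1))"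
    using b by simp
  also have "\<dots> \<le> ennreal (2 powr \<bar>2 * \<alpha>\<bar>) * (\<integral>\<^sup>+t\<in>{0..pi/2}. ennreal (sin t powr (2 * \<alpha>)) \<partial>lborel)"
    by (rule nn_integral_sin_powr_ge) (use b in auto)
  also have "\<dots> \<le> ennreal (2 powr \<bar>2 * \<alpha>\<bar>) * ?I"
    unfolding I by (intro mult_left_mono nn_integral_mono) (auto simp: indicator_def)
  finally have "0 < ?I" by (simp add: zero_less_iff_neq_zero)
  moreover have "?I < \<infinity>" unfolding I by (rule nn_integral_sin_powr_finite[OF b])
  ultimately have "0 < enn2real ?I" by (simp add: enn2real_positive_iff)
  also have "enn2real ?I = (LINT t|lborel. indicator {0..pi} t *\<^sub>R sin t powr (2 * \<alpha>))"
    by (intro integral_eq_nn_integral[symmetric]) auto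
  also have "\<dots> = (LINT t:{0..pi}|lebesgue. sin t powr (2 * \<alpha>))"
    unfolding set_lebesgue_integral_def by (rule integral_lebesgue_eq_borel[symmetric]) auto
  finally show ?thesis by (simp add: dunkl_const_def)
qed

abbreviation translated_ball :: "real \<Rightarrow> real \<Rightarrow> real \<Rightarrow> real \<Rightarrow> real" where
  "translated_ball \<alpha> x r \<equiv> dunkl_translation \<alpha> x (indicator (ball 0 r))"

lemma one_minus_cos_le:
  assumes "0 \<le> s"
  shows "ennreal ((1 - cos t) * s) \<le> 2 * ennreal s"
proof -
  have "ennreal ((1 - cos t) * s) \<le> ennreal (2 * s)"
    using cos_ge_minus_one[of t] assms by (intro ennreal_leI mult_right_mono) linarith+
  then show ?thesis using assms by (simp add: ennreal_mult)
qed

text \<open>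
  For even functions the sign-changing part of the translation vanishes; the indicator of a
  centred ball therefore has a nonnegative translate, given by a cap integral.
\<close>
lemma dunkl_translation_ball:
  assumes "- 1 / 2 < \<alpha>"
  shows "ennreal (translated_ball \<alpha> x r y)
      = ennreal (dunkl_const \<alpha>) * (\<integral>\<^sup>+t\<in>{0..pi}. indicator {..<r} (dunkl_dist x y t)
          * ennreal ((1 - cos t) * sin t powr (2 * \<alpha>)) \<partial>lborel)" (is "_ = _ * ?I")
    and "0 \<le> translated_ball \<alpha> x r y"
proof -
  define h where "h = (\<lambda>t. indicator {0..pi} t * indicator {..<r} (dunkl_dist x y t) * ((1 - cos t) * sin t powr (2 * \<alpha>)))"
  have h0: "0 \<le> h t" for t by (simp add: h_def)
  have [measurable]: "h \<in> borel_measurable borel" unfolding h_def by measurable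
  have "dunkl_integrand \<alpha> x (indicator (ball 0 r)) y t = 2 * h t" for t
    using dunkl_dist_nonneg[of x y t] by (simp add: dunkl_integrand_def h_def indicator_def)
  then have "dunkl_integrand \<alpha> x (indicator (ball 0 r)) y = (\<lambda>t. 2 * h t)" by (rule ext)
  then have eq: "translated_ball \<alpha> x r y = dunkl_const \<alpha> * (LINT t|lborel. h t)"
    using assms dunkl_translation_lborel[OF borel_measurable_indicator[of "ball 0 r" borel], of \<alpha> x y]
    by (simp add: open_ball)
  show "0 \<le> translated_ball \<alpha> x r y"
    unfolding eq using dunkl_const_pos[OF assms] h0 by (auto intro!: mult_nonneg_nonneg)
  have I: "?I = (\<integral>\<^sup>+t. ennreal (h t) \<partial>lborel)"
    by (intro nn_integral_cong) (simp add: h_def indicator_def)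
  have "?I \<le> (\<integral>\<^sup>+t. ennreal 2 * (ennreal (sin t powr (2 * \<alpha>)) * indicator {0..pi} t) \<partial>lborel)"
    by (intro nn_integral_mono) (simp add: indicator_def one_minus_cos_le)
  also have "\<dots> = ennreal 2 * (\<integral>\<^sup>+t\<in>{0..pi}. ennreal (sin t powr (2 * \<alpha>)) \<partial>lborel)"
    by (rule nn_integral_cmult) measurable
  also have "\<dots> < \<infinity>"
    using nn_integral_sin_powr_finite[of "2 * \<alpha>"] assms by (simp add: ennreal_mult_less_top)
  finally have "integrable lborel h"
    unfolding I using h0 by (intro integrableI_nonneg) auto
  then have "ennreal (LINT t|lborel. h t) = ?I"
    unfolding I using h0 by (intro nn_integral_eq_integral[symmetric]) auto
  then show "ennreal (translated_ball \<alpha> x r y) = ennreal (dunkl_const \<alpha>) * ?I"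
    unfolding eq using dunkl_const_pos[OF assms] h0 by (simp add: ennreal_mult)
qed

lemma dunkl_translation_ball_bounds:
  assumes \<alpha>: "- 1 / 2 \<le> \<alpha>"
  obtains C c where "0 < C" "0 < c"
    "\<And>x z r. 0 < r \<Longrightarrow> 0 \<le> translated_ball \<alpha> x r z"
    "\<And>x z r. 0 < r \<Longrightarrow> translated_ball \<alpha> x r z
        \<le> C * (r / max \<bar>x\<bar> r) powr (2 * \<alpha> + 1) * indicator (ball x r \<union> ball (- x) r) z"
    "\<And>x z r. 0 < r \<Longrightarrow> \<bar>z - x\<bar> < r / 2 \<Longrightarrow>
        c * (r / max \<bar>x\<bar> r) powr (2 * \<alpha> + 1) \<le> translated_ball \<alpha> (- x) r z"
proof (cases "\<alpha> = - 1 / 2")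
  case True
  show thesis
  proof (rule that[of 1 1])
    show "0 \<le> translated_ball \<alpha> x r z" for x z r :: real
      by (simp add: dunkl_translation_def True)
    show "translated_ball \<alpha> x r z
        \<le> 1 * (r / max \<bar>x\<bar> r) powr (2 * \<alpha> + 1) * indicator (ball x r \<union> ball (- x) r) z"
      if "0 < r" for x z r :: real
      using that by (auto simp: dunkl_translation_def True indicator_def dist_real_def)
    show "1 * (r / max \<bar>x\<bar> r) powr (2 * \<alpha> + 1) \<le> translated_ball \<alpha> (- x) r z"
      if "0 < r" "\<bar>z - x\<bar> < r / 2" for x z r :: real
    proof -
      have "\<bar>x - z\<bar> < r" using that by linarith
      then show ?thesis using that by (simp add: dunkl_translation_def True indicator_def dist_real_def)
    qed
  qed simp_all
next
  case False
  then have \<alpha>: "- 1 / 2 < \<alpha>" and b: "- 1 < 2 * \<alpha>" using \<alpha> by auto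
  obtain C where C: "0 < C"
    "\<And>x y r. 0 < r \<Longrightarrow> (cap_integral (2 * \<alpha>) x y r)
      \<le> ennreal (C * (r / max \<bar>x\<bar> r) powr (2 * \<alpha> + 1)) * indicator {y. \<bar>\<bar>x\<bar> - \<bar>y\<bar>\<bar> < r} y"
    using cap_upper_bound[OF b] by blast
  obtain c where c: "0 < c"
    "\<And>x z r. 0 < r \<Longrightarrow> \<bar>z - x\<bar> < r / 2 \<Longrightarrow> ennreal (c * (r / max \<bar>x\<bar> r) powr (2 * \<alpha> + 1))
      \<le> (\<integral>\<^sup>+t\<in>{0..pi}. indicator {..<r} (dunkl_dist (- x) z t) * ennreal ((1 - cos t) * sin t powr (2 * \<alpha>)) \<partial>lborel)"
    using cap_lower_bound[OF b] by blast
  note k = dunkl_const_pos[OF \<alpha>]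
  show thesis
  proof (rule that[of "dunkl_const \<alpha> * (2 * C)" "dunkl_const \<alpha> * c"])
    show "0 \<le> translated_ball \<alpha> x r z" for x z r :: real
      by (rule dunkl_translation_ball(2)[OF \<alpha>])
  next
    fix x z r :: real assume r: "0 < r"
    have "ennreal (translated_ball \<alpha> x r z)
        \<le> ennreal (dunkl_const \<alpha>) * (\<integral>\<^sup>+t. ennreal 2 * (indicator {..<r} (dunkl_dist x z t) * ennreal (sin t powr (2 * \<alpha>)) * indicator {0..pi} t) \<partial>lborel)"
      unfolding dunkl_translation_ball(1)[OF \<alpha>]
      by (intro mult_left_mono nn_integral_mono) (simp_all add: indicator_def one_minus_cos_le)
    also have "\<dots> = ennreal (dunkl_const \<alpha>) * (ennreal 2 * cap_integral (2 * \<alpha>) x z r)"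
      by (intro arg_cong[where f = "\<lambda>u. ennreal (dunkl_const \<alpha>) * u"] nn_integral_cmult) measurable
    also have "\<dots> \<le> ennreal (dunkl_const \<alpha>) * (ennreal 2 * (ennreal (C * (r / max \<bar>x\<bar> r) powr (2 * \<alpha> + 1)) * indicator {y. \<bar>\<bar>x\<bar> - \<bar>y\<bar>\<bar> < r} z))"
      by (intro mult_left_mono C r) auto
    also have "\<dots> = ennreal (dunkl_const \<alpha> * (2 * C) * (r / max \<bar>x\<bar> r) powr (2 * \<alpha> + 1) * indicator {y. \<bar>\<bar>x\<bar> - \<bar>y\<bar>\<bar> < r} z)"
      using k C(1) by (simp add: indicator_def ennreal_mult mult_ac)
    finally have "translated_ball \<alpha> x r z
        \<le> dunkl_const \<alpha> * (2 * C) * (r / max \<bar>x\<bar> r) powr (2 * \<alpha> + 1) * indicator {y. \<bar>\<bar>x\<bar> - \<bar>y\<bar>\<bar> < r} z"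
      using k C(1) by (subst (asm) ennreal_le_iff) (auto intro!: mult_nonneg_nonneg)
    also have "\<dots> \<le> dunkl_const \<alpha> * (2 * C) * (r / max \<bar>x\<bar> r) powr (2 * \<alpha> + 1) * indicator (ball x r \<union> ball (- x) r) z"
      using k C(1) by (intro mult_left_mono) (auto simp: indicator_def dist_real_def)
    finally show "translated_ball \<alpha> x r z
        \<le> dunkl_const \<alpha> * (2 * C) * (r / max \<bar>x\<bar> r) powr (2 * \<alpha> + 1) * indicator (ball x r \<union> ball (- x) r) z" .
  next
    fix x z r :: real assume r: "0 < r" "\<bar>z - x\<bar> < r / 2"
    have "ennreal (dunkl_const \<alpha> * c * (r / max \<bar>x\<bar> r) powr (2 * \<alpha> + 1))
        = ennreal (dunkl_const \<alpha>) * ennreal (c * (r / max \<bar>x\<bar> r) powr (2 * \<alpha> + 1))"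
      using k c(1) by (simp add: mult_ac flip: ennreal_mult)
    also have "\<dots> \<le> ennreal (translated_ball \<alpha> (- x) r z)"
      unfolding dunkl_translation_ball(1)[OF \<alpha>] by (intro mult_left_mono c r) auto
    finally show "dunkl_const \<alpha> * c * (r / max \<bar>x\<bar> r) powr (2 * \<alpha> + 1) \<le> translated_ball \<alpha> (- x) r z"
      using dunkl_translation_ball(2)[OF \<alpha>, of "- x" r z] by (subst (asm) ennreal_le_iff) auto
  qed (use k C c in auto)
qed

lemma nn_integral_dunkl_kernel_UNIV:
  fixes F :: "real \<Rightarrow> ennreal"
  assumes [measurable]: "F \<in> borel_measurable borel"
    and xy: "x \<noteq> 0" "y \<noteq> 0" "\<bar>x\<bar> \<noteq> \<bar>y\<bar>"
  shows "(\<integral>\<^sup>+z. F z * ennreal (dunkl_kernel \<alpha> x y z) \<partial>lborel)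
       = (\<integral>\<^sup>+t\<in>{0..pi}. (F (dunkl_dist x y t) + F (- dunkl_dist x y t)) * ennreal (sin t powr (2 * \<alpha>)) \<partial>lborel)"
proof -
  let ?u = "\<lambda>z. F z * ennreal (dunkl_kernel \<alpha> x y z)"
  have "(\<integral>\<^sup>+z. ?u z \<partial>lborel) = (\<integral>\<^sup>+z. ?u z * indicator {0<..} z + ?u z * indicator {..<0} z \<partial>lborel)"
    by (intro nn_integral_cong_AE) (use AE_lborel_singleton[of 0] in eventually_elim, auto simp: indicator_def)
  also have "\<dots> = (\<integral>\<^sup>+z\<in>{0<..}. ?u z \<partial>lborel) + (\<integral>\<^sup>+z\<in>{..<0}. ?u z \<partial>lborel)"
    by (rule nn_integral_add) measurable
  also have "(\<integral>\<^sup>+z\<in>{..<0}. ?u z \<partial>lborel) = (\<integral>\<^sup>+z\<in>{0<..}. F (- z) * ennreal (dunkl_kernel \<alpha> x y z) \<partial>lborel)"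
    by (subst nn_integral_real_affine[where c = "-1" and t = 0])
       (auto intro!: nn_integral_cong simp: indicator_def)
  also have "(\<integral>\<^sup>+z\<in>{0<..}. ?u z \<partial>lborel) + \<dots> = (\<integral>\<^sup>+z\<in>{0<..}. (F z + F (- z)) * ennreal (dunkl_kernel \<alpha> x y z) \<partial>lborel)"
    by (subst nn_integral_add[symmetric]) (auto intro!: nn_integral_cong simp: distrib_right)
  also have "\<dots> = (\<integral>\<^sup>+t\<in>{0..pi}. (F (dunkl_dist x y t) + F (- dunkl_dist x y t)) * ennreal (sin t powr (2 * \<alpha>)) \<partial>lborel)"
    by (rule nn_integral_dunkl_kernel[symmetric]) (use xy in auto)
  finally show ?thesis .
qed

text \<open>
  The translation by \<open>0\<close> is a multiple of the identity off the origin. Leaving the multiple as an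
  integral is enough for the adjointness relation, where it occurs on both sides.
\<close>
lemma dunkl_translation_0:
  assumes \<alpha>: "- 1 / 2 < \<alpha>" and [measurable]: "g \<in> borel_measurable borel" and y: "y \<noteq> 0"
  shows "dunkl_translation \<alpha> 0 g y
    = g y * (dunkl_const \<alpha> * (LINT t|lborel. indicator {0..pi} t * ((1 - cos t) * sin t powr (2 * \<alpha>))))"
proof -
  have d: "dunkl_dist 0 y t = \<bar>y\<bar>" for t by (simp add: dunkl_dist_def)
  have g: "g \<bar>y\<bar> + g (- \<bar>y\<bar>) + (0 + y) / \<bar>y\<bar> * (g \<bar>y\<bar> - g (- \<bar>y\<bar>)) = 2 * g y"
    using y by (cases "0 < y") auto
  have "dunkl_integrand \<alpha> 0 g y t = 2 * g y * (indicator {0..pi} t * ((1 - cos t) * sin t powr (2 * \<alpha>)))" for t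
    unfolding dunkl_integrand_def d g by simp
  then have "dunkl_integrand \<alpha> 0 g y
      = (\<lambda>t. 2 * g y * (indicator {0..pi} t * ((1 - cos t) * sin t powr (2 * \<alpha>))))" by (rule ext)
  then show ?thesis using \<alpha> by (simp add: dunkl_translation_lborel)
qed

text \<open>
  In the main case both sides are the iterated integrals of
  \<open>Q y z = w y * \<chi> y * g z * T x y z * K x y z\<close>, with \<open>w\<close> the density of the measure, \<open>\<chi>\<close> the indicator of the ball,
  \<open>T\<close> the sign factor and \<open>K\<close> the kernel: the inner integrals are translations by the product
  formula, in \<open>z\<close> for the left side and, after the symmetries of \<open>T\<close> and \<open>K\<close>, in \<open>y\<close> for the right side.
  Fubini's theorem applies because \<open>T\<close> is bounded and the cap estimate confines \<open>z\<close> to a bounded set.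
\<close>
lemma dunkl_translation_ball_adjoint:
  assumes \<alpha>: "- 1 / 2 \<le> \<alpha>" and r: "0 < r"
    and [measurable]: "g \<in> borel_measurable borel" and g0: "\<And>z. 0 \<le> g z"
    and fin: "\<And>R. dunkl_ball \<alpha> g 0 R < \<infinity>"
  shows "(LINT y:ball 0 r|dunkl_borel \<alpha>. dunkl_translation \<alpha> x g y)
    = (LINT z|dunkl_borel \<alpha>. g z * translated_ball \<alpha> (- x) r z)"
proof -
  let ?\<chi> = "indicator (ball 0 r) :: real \<Rightarrow> real"
  let ?w = "dunkl_density \<alpha>"
  have [measurable]: "ball 0 R \<in> sets borel" for R :: real by simp
  have \<chi> [measurable]: "?\<chi> \<in> borel_measurable borel" by simp
  have w0: "0 \<le> ?w z" for z by (rule dunkl_density_nonneg[OF \<alpha>])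
  have lhs: "(LINT y:ball 0 r|dunkl_borel \<alpha>. dunkl_translation \<alpha> x g y)
      = (LINT y|lborel. ?w y * (?\<chi> y * dunkl_translation \<alpha> x g y))"
    unfolding set_lebesgue_integral_def by (subst integral_dunkl_borel) (use \<alpha> in auto)
  have rhs: "(LINT z|dunkl_borel \<alpha>. g z * dunkl_translation \<alpha> (- x) ?\<chi> z)
      = (LINT z|lborel. ?w z * (g z * dunkl_translation \<alpha> (- x) ?\<chi> z))"
    by (subst integral_dunkl_borel) (use \<alpha> in auto)
  consider "\<alpha> = - 1 / 2" | "- 1 / 2 < \<alpha>" "x = 0" | "- 1 / 2 < \<alpha>" "x \<noteq> 0" using \<alpha> by linarith
  then show ?thesis
  proof cases
    case 1
    have "(LINT y|lborel. ?w y * (?\<chi> y * dunkl_translation \<alpha> x g y)) = (LINT y|lborel. ?w y * (?\<chi> y * g (x + y)))"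
      by (simp add: dunkl_translation_def 1)
    also have "\<dots> = (LINT z|lborel. ?w (- x + z) * (?\<chi> (- x + z) * g z))"
      by (subst lborel_integral_real_affine[where c = 1 and t = "- x"]) auto
    also have "\<dots> = (LINT z|lborel. ?w z * (g z * dunkl_translation \<alpha> (- x) ?\<chi> z))"
    proof (rule integral_cong_AE)
      show "AE z in lborel. ?w (- x + z) * (?\<chi> (- x + z) * g z) = ?w z * (g z * dunkl_translation \<alpha> (- x) ?\<chi> z)"
        using AE_lborel_singleton[of 0] AE_lborel_singleton[of x]
        by eventually_elim (auto simp: dunkl_density_def dunkl_translation_def 1)
    qed measurable
    finally show ?thesis unfolding lhs rhs .
  next
    case 2
    show ?thesis unfolding lhs rhs
    proof (rule integral_cong_AE)
      show "AE z in lborel. ?w z * (?\<chi> z * dunkl_translation \<alpha> x g z) = ?w z * (g z * dunkl_translation \<alpha> (- x) ?\<chi> z)"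
        using AE_lborel_singleton[of 0] by eventually_elim (simp add: 2 dunkl_translation_0[OF 2(1)] \<chi>)
    qed measurable
  next
    case 3
    note x = 3(2)
    have b: "- 1 < 2 * \<alpha>" using 3(1) by simp
    let ?T = "dunkl_factor" and ?K = "dunkl_kernel \<alpha>"
    have TK: "\<bar>?T x y z * ?K x y z\<bar> \<le> 4 * ?K x y z" for x y z
    proof (cases "?K x y z = 0")
      case False
      then show ?thesis
        using abs_dunkl_factor_le[OF False] dunkl_kernel_nonneg[of \<alpha> x y z]
        by (simp add: abs_mult mult_right_mono)
    qed simp
    obtain C where C: "0 < C"
      "\<And>x y r. 0 < r \<Longrightarrow> (cap_integral (2 * \<alpha>) x y r)
        \<le> ennreal (C * (r / max \<bar>x\<bar> r) powr (2 * \<alpha> + 1)) * indicator {y. \<bar>\<bar>x\<bar> - \<bar>y\<bar>\<bar> < r} y"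
      using cap_upper_bound[OF b] by blast
    define E where "E = 2 * (C * (r / max \<bar>x\<bar> r) powr (2 * \<alpha> + 1))"
    have E: "0 \<le> E" using C(1) by (simp add: E_def)
    have cap: "ball_integral lborel (\<lambda>y. ?K x z y) 0 r \<le> ennreal E * indicator (ball 0 (\<bar>x\<bar> + r)) z"
      if z: "z \<noteq> 0" "\<bar>x\<bar> \<noteq> \<bar>z\<bar>" for z
    proof -
      have "ball_integral lborel (\<lambda>y. ?K x z y) 0 r = (\<integral>\<^sup>+y. indicator (ball 0 r) y * ennreal (?K x z y) \<partial>lborel)"
        by (simp add: mult.commute)
      also have "\<dots> = (\<integral>\<^sup>+t. 2 * (indicator {..<r} (dunkl_dist x z t) * ennreal (sin t powr (2 * \<alpha>)) * indicator {0..pi} t) \<partial>lborel)"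
        using dunkl_dist_nonneg[of x z]
        by (subst nn_integral_dunkl_kernel_UNIV) (auto simp: x z indicator_def intro!: nn_integral_cong)
      also have "\<dots> = 2 * cap_integral (2 * \<alpha>) x z r"
        by (rule nn_integral_cmult) measurable
      also have "\<dots> \<le> 2 * (ennreal (C * (r / max \<bar>x\<bar> r) powr (2 * \<alpha> + 1)) * indicator {y. \<bar>\<bar>x\<bar> - \<bar>y\<bar>\<bar> < r} z)"
        by (intro mult_left_mono C r) auto
      also have "\<dots> = ennreal E * indicator {y. \<bar>\<bar>x\<bar> - \<bar>y\<bar>\<bar> < r} z"
        using C(1) by (simp add: E_def ennreal_mult mult.assoc)
      also have "\<dots> \<le> ennreal E * indicator (ball 0 (\<bar>x\<bar> + r)) z"
        by (intro mult_left_mono) (auto simp: indicator_def)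
      finally show ?thesis .
    qed
    define Q where "Q = (\<lambda>y z. ?w y * ?\<chi> y * (g z * ?T x y z * ?K x y z))"
    have [measurable]: "(\<lambda>(y, z). Q y z) \<in> borel_measurable (lborel \<Otimes>\<^sub>M lborel)"
      unfolding Q_def by measurable
    have Q_swap: "Q y z = ?w z * g z * (?\<chi> y * ?T (- x) z y * ?K (- x) z y)" if "y \<noteq> 0" "z \<noteq> 0" for y z
    proof -
      have "?w y * ?K x y z = ?w z * ?K x z y"
        using dunkl_kernel_symmetric[OF that, of \<alpha> x] by (simp add: dunkl_density_def)
      moreover have "Q y z = (?w y * ?K x y z) * (?\<chi> y * (g z * ?T x y z))"
        by (simp add: Q_def mult_ac)
      ultimately have "Q y z = (?w z * ?K x z y) * (?\<chi> y * (g z * ?T x y z))" by simp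
      then show ?thesis by (simp add: dunkl_factor_swap mult_ac)
    qed
    have generic: "AE z in lborel. z \<noteq> 0 \<and> \<bar>x\<bar> \<noteq> \<bar>z\<bar>"
      using AE_lborel_singleton[of 0] AE_lborel_singleton[of x] AE_lborel_singleton[of "- x"]
      by eventually_elim auto
    have intQ: "integrable (lborel \<Otimes>\<^sub>M lborel) (\<lambda>(y, z). Q y z)"
    proof (rule integrableI_bounded)
      have "(\<integral>\<^sup>+p. ennreal (norm (case p of (y, z) \<Rightarrow> Q y z)) \<partial>(lborel \<Otimes>\<^sub>M lborel))
          = (\<integral>\<^sup>+z. (\<integral>\<^sup>+y. ennreal \<bar>Q y z\<bar> \<partial>lborel) \<partial>lborel)"
        by (subst lborel_pair.nn_integral_snd[symmetric]) (auto simp: split_beta')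
      also have "\<dots> \<le> (\<integral>\<^sup>+z. ennreal (4 * E) * (ennreal (?w z) * (ennreal (g z) * indicator (ball 0 (\<bar>x\<bar> + r)) z)) \<partial>lborel)"
      proof (rule nn_integral_mono_AE)
        show "AE z in lborel. (\<integral>\<^sup>+y. ennreal \<bar>Q y z\<bar> \<partial>lborel)
          \<le> ennreal (4 * E) * (ennreal (?w z) * (ennreal (g z) * indicator (ball 0 (\<bar>x\<bar> + r)) z))"
          using generic
        proof eventually_elim
          case (elim z)
          have "(\<integral>\<^sup>+y. ennreal \<bar>Q y z\<bar> \<partial>lborel)
              \<le> (\<integral>\<^sup>+y. ennreal (4 * (?w z * g z)) * (ennreal (?K x z y) * indicator (ball 0 r) y) \<partial>lborel)"
          proof (rule nn_integral_mono_AE)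
            show "AE y in lborel. ennreal \<bar>Q y z\<bar> \<le> ennreal (4 * (?w z * g z)) * (ennreal (?K x z y) * indicator (ball 0 r) y)"
              using AE_lborel_singleton[of 0]
            proof eventually_elim
              case (elim y)
              have "\<bar>Q y z\<bar> = ?w z * g z * (?\<chi> y * \<bar>?T (- x) z y * ?K (- x) z y\<bar>)"
                using Q_swap[OF elim] \<open>z \<noteq> 0 \<and> \<bar>x\<bar> \<noteq> \<bar>z\<bar>\<close> w0[of z] g0[of z] by (simp add: abs_mult)
              also have "\<dots> \<le> ?w z * g z * (?\<chi> y * (4 * ?K (- x) z y))"
                using w0[of z] g0[of z] by (intro mult_left_mono TK) auto
              finally have "\<bar>Q y z\<bar> \<le> 4 * (?w z * g z) * (?K x z y * ?\<chi> y)" by (simp add: mult_ac)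
              then have "ennreal \<bar>Q y z\<bar> \<le> ennreal (4 * (?w z * g z) * (?K x z y * ?\<chi> y))" by (rule ennreal_leI)
              also have "\<dots> = ennreal (4 * (?w z * g z)) * (ennreal (?K x z y) * indicator (ball 0 r) y)"
                using w0[of z] g0[of z] dunkl_kernel_nonneg[of \<alpha> x z y]
                by (simp add: ennreal_mult indicator_def)
              finally show ?case .
            qed
          qed
          also have "\<dots> = ennreal (4 * (?w z * g z)) * ball_integral lborel (\<lambda>y. ?K x z y) 0 r"
            by (rule nn_integral_cmult) measurable
          also have "\<dots> \<le> ennreal (4 * (?w z * g z)) * (ennreal E * indicator (ball 0 (\<bar>x\<bar> + r)) z)"
            by (intro mult_left_mono cap) (use elim in auto)
          also have "\<dots> = ennreal (4 * E) * (ennreal (?w z) * (ennreal (g z) * indicator (ball 0 (\<bar>x\<bar> + r)) z))"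
            using w0[of z] g0[of z] E by (simp add: ennreal_mult mult_ac)
          finally show ?case .
        qed
      qed
      also have "\<dots> = ennreal (4 * E) * (\<integral>\<^sup>+z. ennreal (?w z) * (ennreal (g z) * indicator (ball 0 (\<bar>x\<bar> + r)) z) \<partial>lborel)"
        by (rule nn_integral_cmult) measurable
      also have "(\<integral>\<^sup>+z. ennreal (?w z) * (ennreal (g z) * indicator (ball 0 (\<bar>x\<bar> + r)) z) \<partial>lborel)
          = dunkl_ball \<alpha> g 0 (\<bar>x\<bar> + r)"
        by (rule nn_integral_dunkl_borel[symmetric]) measurable
      also have "ennreal (4 * E) * \<dots> < \<infinity>" using fin by (simp add: ennreal_mult_less_top)
      finally show "(\<integral>\<^sup>+p. ennreal (norm (case p of (y, z) \<Rightarrow> Q y z)) \<partial>(lborel \<Otimes>\<^sub>M lborel)) < \<infinity>" .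
    qed measurable
    let ?c = "dunkl_const \<alpha> / 2"
    have "(LINT y|lborel. ?w y * (?\<chi> y * dunkl_translation \<alpha> x g y)) = (LINT y|lborel. ?c * (LINT z|lborel. Q y z))"
    proof (rule integral_cong_AE)
      show "AE y in lborel. ?w y * (?\<chi> y * dunkl_translation \<alpha> x g y) = ?c * (LINT z|lborel. Q y z)"
        using generic lborel_pair.AE_integrable_fst[OF intQ]
      proof eventually_elim
        case (elim y)
        define u where "u = (\<lambda>z. g z * ?T x y z * ?K x y z)"
        have Qu: "Q y z = (?w y * ?\<chi> y) * u z" for z by (simp add: Q_def u_def)
        show ?case
        proof (cases "y \<in> ball 0 r")
          case True
          then have "?w y * ?\<chi> y \<noteq> 0" using dunkl_density_pos[OF \<alpha>, of y] elim(1) by simp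
          with elim(2) have "integrable lborel u"
            unfolding Qu by (simp del: mult_eq_0_iff)
          then have "dunkl_translation \<alpha> x g y = ?c * (LINT z|lborel. u z)"
            unfolding u_def using elim(1) x 3(1) by (intro dunkl_translation_product_formula) auto
          then show ?thesis unfolding Qu by simp
        next
          case False
          then show ?thesis unfolding Qu by simp
        qed
      qed
    qed measurable
    also have "\<dots> = ?c * (LINT y|lborel. (LINT z|lborel. Q y z))"
      by (rule integral_mult_right_zero)
    also have "(LINT y|lborel. (LINT z|lborel. Q y z)) = (LINT z|lborel. (LINT y|lborel. Q y z))"
      by (rule lborel_pair.Fubini_integral[symmetric]) (rule intQ)
    also have "?c * \<dots> = (LINT z|lborel. ?c * (LINT y|lborel. Q y z))"
      by (rule integral_mult_right_zero[symmetric])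
    also have "\<dots> = (LINT z|lborel. ?w z * (g z * dunkl_translation \<alpha> (- x) ?\<chi> z))"
    proof (rule integral_cong_AE)
      show "AE z in lborel. ?c * (LINT y|lborel. Q y z) = ?w z * (g z * dunkl_translation \<alpha> (- x) ?\<chi> z)"
        using generic
      proof eventually_elim
        case (elim z)
        define u where "u = (\<lambda>y. ?\<chi> y * ?T (- x) z y * ?K (- x) z y)"
        have [measurable]: "u \<in> borel_measurable borel" unfolding u_def by measurable
        have "integrable lborel u"
        proof (rule integrableI_bounded)
          have "(\<integral>\<^sup>+y. ennreal (norm (u y)) \<partial>lborel) \<le> (\<integral>\<^sup>+y. 4 * (ennreal (?K x z y) * indicator (ball 0 r) y) \<partial>lborel)"
            using TK[of "- x" z] dunkl_kernel_nonneg[of \<alpha> x z]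
            by (intro nn_integral_mono) (auto simp: u_def indicator_def ennreal_mult[symmetric] simp flip: ennreal_numeral intro!: ennreal_leI)
          also have "\<dots> = 4 * ball_integral lborel (\<lambda>y. ?K x z y) 0 r"
            by (rule nn_integral_cmult) measurable
          also have "\<dots> \<le> 4 * (ennreal E * indicator (ball 0 (\<bar>x\<bar> + r)) z)"
            by (intro mult_left_mono cap) (use elim in auto)
          also have "\<dots> < \<infinity>" by (simp add: indicator_def ennreal_mult_less_top)
          finally show "(\<integral>\<^sup>+y. ennreal (norm (u y)) \<partial>lborel) < \<infinity>" .
        qed simp
        then have "dunkl_translation \<alpha> (- x) ?\<chi> z = ?c * (LINT y|lborel. u y)"
          unfolding u_def using elim x 3(1) by (intro dunkl_translation_product_formula) auto
        moreover have "(LINT y|lborel. Q y z) = (LINT y|lborel. (?w z * g z) * u y)"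
        proof (rule integral_cong_AE)
          show "AE y in lborel. Q y z = ?w z * g z * u y"
            using AE_lborel_singleton[of 0]
            by eventually_elim (use Q_swap elim in \<open>simp add: u_def\<close>)
          show "(\<lambda>y. Q y z) \<in> borel_measurable lborel" unfolding Q_def by measurable
        qed measurable
        ultimately show ?case by simp
      qed
    qed measurable
    finally show ?thesis unfolding lhs rhs .
  qed
qed

section \<open>Dunkl averages and averages over balls\<close>

text \<open>
  The constant makes this an upper bound for the measure of \<open>ball x r\<close>: on this interval of length \<open>2 * r\<close>,
  the density is at most its value at \<open>2 * max \<bar>x\<bar> r\<close>.
\<close>
definition dunkl_weight :: "real \<Rightarrow> real \<Rightarrow> real \<Rightarrow> real" where
  "dunkl_weight \<alpha> x r = dunkl_density \<alpha> 1 * 2 powr (2 * \<alpha> + 2) * r * max \<bar>x\<bar> r powr (2 * \<alpha> + 1)"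

lemma dunkl_weight_minus [simp]: "dunkl_weight \<alpha> (- x) r = dunkl_weight \<alpha> x r"
  by (simp add: dunkl_weight_def)

lemma dunkl_weight_pos: "0 < dunkl_weight \<alpha> x r" if "- 1 / 2 \<le> \<alpha>" "0 < r"
  using that dunkl_density_pos[of \<alpha> 1] by (simp add: dunkl_weight_def)

lemma dunkl_weight_measurable [measurable]:
  "(\<lambda>w. dunkl_weight \<alpha> (f w) (g w)) \<in> borel_measurable M"
  if [measurable]: "f \<in> borel_measurable M" "g \<in> borel_measurable M"
  unfolding dunkl_weight_def by measurable

lemma ratio_powr_eq_dunkl_weight:
  assumes "- 1 / 2 \<le> \<alpha>" "0 < r"
  shows "(r / max \<bar>x\<bar> r) powr (2 * \<alpha> + 1)
    = dunkl_density \<alpha> 1 * 2 powr (2 * \<alpha> + 2) * r powr dunkl_dim \<alpha> / dunkl_weight \<alpha> x r"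
proof -
  have "r powr dunkl_dim \<alpha> = r * r powr (2 * \<alpha> + 1)"
    using powr_mult_base[of r "2 * \<alpha> + 1"] assms by (simp add: dunkl_dim_def add_ac)
  moreover have "0 < dunkl_density \<alpha> 1" using assms by (intro dunkl_density_pos) auto
  ultimately show ?thesis using assms(2) by (simp add: dunkl_weight_def powr_divide)
qed

lemma emeasure_ball_le_dunkl_weight:
  assumes \<alpha>: "- 1 / 2 \<le> \<alpha>" and r: "0 < r"
  shows "emeasure (dunkl_borel \<alpha>) (ball x r) \<le> ennreal (dunkl_weight \<alpha> x r)"
proof -
  define m where "m = max \<bar>x\<bar> r"
  let ?c = "dunkl_density \<alpha> 1 * (2 * m) powr (2 * \<alpha> + 1)"
  have m: "0 < m" using r by (simp add: m_def)
  have a: "0 < dunkl_density \<alpha> 1" using \<alpha> by (intro dunkl_density_pos) auto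
  have "emeasure (dunkl_borel \<alpha>) (ball x r)
      = (\<integral>\<^sup>+y. ennreal (dunkl_density \<alpha> y) * indicator (ball x r) y \<partial>lborel)"
    by (simp add: dunkl_borel_def emeasure_density)
  also have "\<dots> \<le> (\<integral>\<^sup>+y. ennreal ?c * indicator (ball x r) y \<partial>lborel)"
  proof (rule nn_integral_mono)
    fix y
    show "ennreal (dunkl_density \<alpha> y) * indicator (ball x r) y \<le> ennreal ?c * indicator (ball x r) y"
    proof (cases "y \<in> ball x r")
      case True
      then have "\<bar>y\<bar> \<le> 2 * m" by (auto simp: m_def dist_real_def)
      then have "\<bar>y\<bar> powr (2 * \<alpha> + 1) \<le> (2 * m) powr (2 * \<alpha> + 1)"
        using \<alpha> by (intro powr_mono2) auto
      moreover have "dunkl_density \<alpha> y = dunkl_density \<alpha> 1 * \<bar>y\<bar> powr (2 * \<alpha> + 1)"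
        by (simp add: dunkl_density_def)
      ultimately show ?thesis using a True by (simp add: ennreal_leI)
    qed simp
  qed
  also have "\<dots> = ennreal ?c * ennreal (2 * r)"
    using r by (subst nn_integral_cmult_indicator) (auto simp: ball_eq_greaterThanLessThan)
  also have "\<dots> = ennreal (dunkl_weight \<alpha> x r)"
  proof -
    have "?c * (2 * r) = dunkl_weight \<alpha> x r"
      using m powr_mult_base[of 2 "2 * \<alpha> + 1"]
      by (simp add: dunkl_weight_def m_def[symmetric] powr_mult add_ac)
    then show ?thesis using a r by (simp flip: ennreal_mult)
  qed
  finally show ?thesis .
qed

lemma doubling_weight_dunkl:
  assumes \<alpha>: "- 1 / 2 \<le> \<alpha>"
  shows "doubling_weight (dunkl_borel \<alpha>) (dunkl_weight \<alpha>) (5 powr (2 * \<alpha> + 2))"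
proof (rule doubling_weight.intro)
  have a: "0 < dunkl_density \<alpha> 1" using \<alpha> by (intro dunkl_density_pos) auto
  show "sigma_finite_measure (dunkl_borel \<alpha>)"
    unfolding dunkl_borel_def by (subst sigma_finite_measure.sigma_finite_iff_density_finite) (auto simp: sigma_finite_lborel)
  show "0 < dunkl_weight \<alpha> x r" if "0 < r" for x r
    using \<alpha> that by (rule dunkl_weight_pos)
  show "emeasure (dunkl_borel \<alpha>) (ball x r) \<le> ennreal (dunkl_weight \<alpha> x r)" if "0 < r" for x r
    using \<alpha> that by (rule emeasure_ball_le_dunkl_weight)
  show "dunkl_weight \<alpha> x s \<le> 5 powr (2 * \<alpha> + 2) * dunkl_weight \<alpha> x r" if "0 < r" "r \<le> s" "s \<le> 5 * r" for r s x
  proof -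
    have "max \<bar>x\<bar> s powr (2 * \<alpha> + 1) \<le> (5 * max \<bar>x\<bar> r) powr (2 * \<alpha> + 1)"
      using that \<alpha> by (intro powr_mono2) auto
    then have "s * max \<bar>x\<bar> s powr (2 * \<alpha> + 1) \<le> (5 * r) * (5 powr (2 * \<alpha> + 1) * max \<bar>x\<bar> r powr (2 * \<alpha> + 1))"
      using that by (intro mult_mono) (auto simp: powr_mult)
    also have "\<dots> = 5 powr (2 * \<alpha> + 2) * (r * max \<bar>x\<bar> r powr (2 * \<alpha> + 1))"
      using powr_mult_base[of 5 "2 * \<alpha> + 1"] by (simp add: add_ac mult_ac)
    finally have "dunkl_density \<alpha> 1 * 2 powr (2 * \<alpha> + 2) * (s * max \<bar>x\<bar> s powr (2 * \<alpha> + 1))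
       \<le> dunkl_density \<alpha> 1 * 2 powr (2 * \<alpha> + 2) * (5 powr (2 * \<alpha> + 2) * (r * max \<bar>x\<bar> r powr (2 * \<alpha> + 1)))"
      using a by (intro mult_left_mono) auto
    then show ?thesis by (simp add: dunkl_weight_def mult_ac)
  qed
  show "\<exists>R. \<forall>x r. 0 < r \<longrightarrow> dunkl_weight \<alpha> x r \<le> b \<longrightarrow> r \<le> R" for b
  proof (intro exI allI impI)
    fix x r :: real assume r: "0 < r" and b: "dunkl_weight \<alpha> x r \<le> b"
    let ?k = "dunkl_density \<alpha> 1 * 2 powr (2 * \<alpha> + 2)"
    have k: "0 < ?k" using a by simp
    show "r \<le> max 1 (b / ?k)"
    proof (cases "r \<le> 1")
      case False
      then have "1 \<le> max \<bar>x\<bar> r powr (2 * \<alpha> + 1)"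
        using \<alpha> by (intro ge_one_powr_ge_zero) auto
      then have "?k * r * 1 \<le> ?k * r * max \<bar>x\<bar> r powr (2 * \<alpha> + 1)"
        using k r by (intro mult_left_mono) auto
      also have "\<dots> \<le> b" using b by (simp add: dunkl_weight_def)
      finally have "r \<le> b / ?k" using k by (simp add: pos_le_divide_eq mult_ac)
      then show ?thesis by simp
    qed simp
  qed
qed simp_all

lemma AE_dunkl_measure: "AE x in dunkl_measure \<alpha>. P x" if "AE x in lborel. P x"
proof -
  have "AE x in lebesgue. P x" by (rule AE_completion) (rule that)
  moreover have "(\<lambda>x. ennreal (dunkl_density \<alpha> x)) \<in> borel_measurable lebesgue"
    by (rule measurable_completion) simp
  ultimately show ?thesis
    unfolding dunkl_measure_eq_density by (subst AE_density) (auto elim: eventually_mono)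
qed

lemma nn_integral_dunkl_measure:
  fixes f f' :: "real \<Rightarrow> ennreal"
  assumes [measurable]: "f' \<in> borel_measurable borel" and ae: "AE x in lborel. f x = f' x"
  shows "(\<integral>\<^sup>+x. f x \<partial>dunkl_measure \<alpha>) = (\<integral>\<^sup>+x. f' x \<partial>dunkl_borel \<alpha>)"
proof -
  have "(\<integral>\<^sup>+x. f x \<partial>dunkl_measure \<alpha>) = (\<integral>\<^sup>+x. f' x \<partial>dunkl_measure \<alpha>)"
    by (intro nn_integral_cong_AE AE_dunkl_measure ae)
  also have "\<dots> = (\<integral>\<^sup>+x. ennreal (dunkl_density \<alpha> x) * f' x \<partial>lebesgue)"
    unfolding dunkl_measure_eq_density by (rule nn_integral_density; rule measurable_completion) simp_all
  also have "\<dots> = (\<integral>\<^sup>+x. f' x \<partial>dunkl_borel \<alpha>)"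
    by (simp add: nn_integral_completion nn_integral_dunkl_borel)
  finally show ?thesis .
qed

lemma nn_integral_dunkl_measure_le:
  fixes f f' :: "real \<Rightarrow> ennreal"
  assumes [measurable]: "f' \<in> borel_measurable borel" and ae: "AE x in lborel. f x \<le> f' x"
  shows "(\<integral>\<^sup>+x. f x \<partial>dunkl_measure \<alpha>) \<le> (\<integral>\<^sup>+x. f' x \<partial>dunkl_borel \<alpha>)"
proof -
  have "(\<integral>\<^sup>+x. f x \<partial>dunkl_measure \<alpha>) \<le> (\<integral>\<^sup>+x. f' x \<partial>dunkl_measure \<alpha>)"
    by (intro nn_integral_mono_AE AE_dunkl_measure ae)
  also have "\<dots> = (\<integral>\<^sup>+x. f' x \<partial>dunkl_borel \<alpha>)"
    by (rule nn_integral_dunkl_measure) simp_all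
  finally show ?thesis .
qed

lemma integral_dunkl_measure:
  fixes f f' :: "real \<Rightarrow> 'b::euclidean_space"
  assumes \<alpha>: "- 1 / 2 \<le> \<alpha>" and f' [measurable]: "f' \<in> borel_measurable borel"
    and ae: "AE x in lborel. f x = f' x"
  shows "(LINT x|dunkl_measure \<alpha>. f x) = (LINT x|dunkl_borel \<alpha>. f' x)"
proof -
  have "f' \<in> borel_measurable lebesgue" by (rule measurable_completion) simp
  moreover have "AE x in lebesgue. f' x = f x"
    by (rule AE_completion) (use ae in eventually_elim, simp)
  ultimately have "f \<in> borel_measurable lebesgue" by (rule borel_measurable_AE)
  moreover have "dunkl_density \<alpha> \<in> borel_measurable lebesgue"
    by (rule measurable_completion) simp
  ultimately have "(LINT x|dunkl_measure \<alpha>. f x) = (LINT x|lebesgue. dunkl_density \<alpha> x *\<^sub>R f x)"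
    unfolding dunkl_measure_eq_density using dunkl_density_nonneg[OF \<alpha>]
    by (intro integral_density) auto
  also have "\<dots> = (LINT x|lborel. dunkl_density \<alpha> x *\<^sub>R f' x)"
    by (rule integral_lebesgue_eq_borel, measurable) (use ae in eventually_elim, simp)
  also have "\<dots> = (LINT x|dunkl_borel \<alpha>. f' x)"
    by (rule integral_dunkl_borel[symmetric]) (use \<alpha> in auto)
  finally show ?thesis .
qed

lemma AE_lborel_affine:
  fixes c :: real
  assumes "AE z in lborel. P z" "c \<noteq> 0"
  shows "AE z in lborel. P (t + c * z)"
proof -
  obtain N where N: "N \<in> null_sets lborel" "\<And>z. z \<notin> N \<Longrightarrow> P z"
    using assms(1) by (auto simp: eventually_ae_filter)
  have [measurable]: "N \<in> sets borel" using N by auto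
  have "(\<integral>\<^sup>+z. indicator N z \<partial>lborel) = 0" using N by (simp add: null_setsD1)
  then have "(\<integral>\<^sup>+z. indicator N (t + c * z) \<partial>lborel) = 0"
    using assms(2) by (subst (asm) nn_integral_real_affine[where c = c and t = t]) auto
  then have "AE z in lborel. (indicator N (t + c * z) :: ennreal) = 0"
    by (subst (asm) nn_integral_0_iff_AE) auto
  then show ?thesis by eventually_elim (auto simp: indicator_def N(2) split: if_splits)
qed

text \<open>
  Only the case \<open>x \<noteq> 0\<close> of the proper translation needs the substitution; in the other two cases the
  argument of \<open>g\<close> is an affine function of \<open>y\<close> up to sign.
\<close>
lemma AE_dunkl_translation_cong:
  assumes g: "AE z in lborel. g z = g' z" and [measurable]: "g' \<in> borel_measurable borel"
  shows "AE y in lborel. dunkl_translation \<alpha> x g y = dunkl_translation \<alpha> x g' y"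
proof -
  consider "\<alpha> = - 1 / 2" | "\<alpha> \<noteq> - 1 / 2" "x = 0" | "\<alpha> \<noteq> - 1 / 2" "x \<noteq> 0" by blast
  then show ?thesis
  proof cases
    case 1
    then show ?thesis using AE_lborel_affine[OF g, of 1 x] by (simp add: dunkl_translation_def)
  next
    case 2
    have "AE y in lborel. g (- y) = g' (- y)" using AE_lborel_affine[OF g, of "-1" 0] by simp
    with g show ?thesis
    proof eventually_elim
      case (elim y)
      then have "g (dunkl_dist x y t) = g' (dunkl_dist x y t)" "g (- dunkl_dist x y t) = g' (- dunkl_dist x y t)" for t
        using 2 by (auto simp: dunkl_dist_def abs_if)
      then have "dunkl_integrand \<alpha> x g y = dunkl_integrand \<alpha> x g' y"
        by (intro ext) (simp add: dunkl_integrand_def)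
      then show ?case using 2 by (simp add: dunkl_translation_eq_integrand)
    qed
  next
    case 3
    show ?thesis
      using AE_lborel_singleton[of 0] AE_lborel_singleton[of x] AE_lborel_singleton[of "- x"]
      by eventually_elim (rule dunkl_translation_AE_cong; use 3 g in auto)
  qed
qed

abbreviation translated_integral :: "real \<Rightarrow> real \<Rightarrow> (real \<Rightarrow> real) \<Rightarrow> real \<Rightarrow> real" where
  "translated_integral \<alpha> x g r \<equiv> (LINT y:ball 0 r|dunkl_measure \<alpha>. dunkl_translation \<alpha> x g y)"

text \<open>
  This makes the Dunkl--Morrey norm equivalent to a classical one. By adjointness, the Dunkl average of \<open>g\<close> is
  an integral of \<open>g\<close> against a translated ball, so the bounds on such translates apply. The lower
  bound loses a factor \<open>2\<close> in the radius, which doubling absorbs.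
\<close>
lemma dunkl_ball_mean_bounds:
  assumes \<alpha>: "- 1 / 2 \<le> \<alpha>"
  obtains C where "0 < C"
    "\<And>g g' x r. \<lbrakk>0 < r; g' \<in> borel_measurable borel; \<And>z. 0 \<le> g' z; AE z in lborel. g z = g' z;
       \<And>R. dunkl_ball \<alpha> g' 0 R < \<infinity>\<rbrakk> \<Longrightarrow>
     0 \<le> translated_integral \<alpha> x g r \<and>
     ennreal (translated_integral \<alpha> x g r)
       \<le> ennreal (C * (r powr dunkl_dim \<alpha> / dunkl_weight \<alpha> x r)) *
         (dunkl_ball \<alpha> g' x r + dunkl_ball \<alpha> g' (- x) r) \<and>
     dunkl_ball \<alpha> g' x (r / 2)
       \<le> ennreal (C * (dunkl_weight \<alpha> x (r / 2) / r powr dunkl_dim \<alpha>)) *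
         ennreal (translated_integral \<alpha> x g r)"
proof -
  interpret doubling_weight "dunkl_borel \<alpha>" "dunkl_weight \<alpha>" "5 powr (2 * \<alpha> + 2)"
    by (rule doubling_weight_dunkl[OF \<alpha>])
  obtain C c where C: "0 < C" "0 < c"
    "\<And>x z r. 0 < r \<Longrightarrow> 0 \<le> translated_ball \<alpha> x r z"
    "\<And>x z r. 0 < r \<Longrightarrow> translated_ball \<alpha> x r z
        \<le> C * (r / max \<bar>x\<bar> r) powr (2 * \<alpha> + 1) * indicator (ball x r \<union> ball (- x) r) z"
    "\<And>x z r. 0 < r \<Longrightarrow> \<bar>z - x\<bar> < r / 2 \<Longrightarrow>
        c * (r / max \<bar>x\<bar> r) powr (2 * \<alpha> + 1) \<le> translated_ball \<alpha> (- x) r z"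
    using dunkl_translation_ball_bounds[OF \<alpha>] by metis
  define k where "k = dunkl_density \<alpha> 1 * 2 powr (2 * \<alpha> + 2)"
  have k: "0 < k" using dunkl_density_pos[OF \<alpha>, of 1] by (simp add: k_def)
  have ratio: "(r / max \<bar>x\<bar> r) powr (2 * \<alpha> + 1) = k * r powr dunkl_dim \<alpha> / dunkl_weight \<alpha> x r" if "0 < r" for x r
    using ratio_powr_eq_dunkl_weight[OF \<alpha> that] by (simp add: k_def)
  \<comment> \<open>The first entry serves the upper bound, the second the lower bound.\<close>
  define C' where "C' = max (C * k) (5 powr (2 * \<alpha> + 2) / (c * k))"
  have C': "0 < C'" "C * k \<le> C'" "5 powr (2 * \<alpha> + 2) / (c * k) \<le> C'" using C k by (auto simp: C'_def less_max_iff_disj)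
  show thesis
  proof (rule that[OF C'(1)])
    fix g g' :: "real \<Rightarrow> real" and x r :: real
    assume r: "0 < r" and [measurable]: "g' \<in> borel_measurable borel" and g0: "\<And>z. 0 \<le> g' z"
      and ae: "AE z in lborel. g z = g' z"
      and fin: "\<And>R. dunkl_ball \<alpha> g' 0 R < \<infinity>"
    have [measurable]: "ball y R \<in> sets borel" for y R :: real by simp
    have \<chi> [measurable]: "(indicator (ball 0 r) :: real \<Rightarrow> real) \<in> borel_measurable borel" by simp
    let ?L = "translated_integral \<alpha> x g r"
    let ?rd = "r powr dunkl_dim \<alpha>" and ?w = "dunkl_weight \<alpha> x r"
    let ?I = "\<lambda>y R. dunkl_ball \<alpha> g' y R"
    let ?a = "ennreal (C * k * (?rd / ?w))" and ?b = "\<lambda>z. ennreal (g' z) * indicator (ball x r) z + ennreal (g' z) * indicator (ball (- x) r) z"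
    define W where "W = translated_ball \<alpha> (- x) r"
    have W0: "0 \<le> W z" for z using C(3)[OF r] by (simp add: W_def)
    have [measurable]: "W \<in> borel_measurable borel" unfolding W_def by measurable
    have w: "0 < ?w" by (rule w_pos[OF r])
    have "?L = (LINT y:ball 0 r|dunkl_borel \<alpha>. dunkl_translation \<alpha> x g' y)"
      unfolding set_lebesgue_integral_def
      by (rule integral_dunkl_measure[OF \<alpha>], measurable)
         (use AE_dunkl_translation_cong[OF ae, of \<alpha> x] in \<open>auto elim!: eventually_mono\<close>)
    also have "\<dots> = (LINT z|dunkl_borel \<alpha>. g' z * W z)"
      unfolding W_def by (rule dunkl_translation_ball_adjoint[OF \<alpha> r _ g0 fin]) simp
    finally have L: "?L = (LINT z|dunkl_borel \<alpha>. g' z * W z)" .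
    have nonneg: "0 \<le> ?L" unfolding L using g0 W0 by (intro integral_nonneg_AE) auto
    have "(\<integral>\<^sup>+z. ennreal (g' z * W z) \<partial>dunkl_borel \<alpha>)
        \<le> (\<integral>\<^sup>+z. ?a * ?b z \<partial>dunkl_borel \<alpha>)"
    proof (rule nn_integral_mono)
      fix z
      have "W z \<le> C * k * (?rd / ?w) * indicator (ball x r \<union> ball (- x) r) z"
        using C(4)[OF r, of "- x" z] unfolding abs_minus_cancel ratio[OF r] by (simp add: W_def Un_commute mult.assoc)
      then have "ennreal (g' z * W z) \<le> ennreal (g' z * (C * k * (?rd / ?w) * indicator (ball x r \<union> ball (- x) r) z))"
        using g0 by (intro ennreal_leI mult_left_mono) auto
      also have "\<dots> = ?a * (ennreal (g' z) * indicator (ball x r \<union> ball (- x) r) z)"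
        using g0[of z] C(1) k w by (simp add: indicator_def mult_ac flip: ennreal_mult)
      also have "\<dots> \<le> ?a * ?b z"
        by (intro mult_left_mono) (auto simp: indicator_def)
      finally show "ennreal (g' z * W z) \<le> \<dots>" .
    qed
    also have "\<dots> = ?a * (?I x r + ?I (- x) r)"
      by (subst nn_integral_cmult, measurable) (subst nn_integral_add, auto)
    finally have up: "(\<integral>\<^sup>+z. ennreal (g' z * W z) \<partial>dunkl_borel \<alpha>) \<le> ?a * (?I x r + ?I (- x) r)" .
    have If: "?I y r < \<infinity>" if "\<bar>y\<bar> = \<bar>x\<bar>" for y
    proof -
      have "?I y r \<le> ?I 0 (\<bar>x\<bar> + r)"
        using that by (intro nn_integral_mono) (auto simp: indicator_def dist_real_def)
      then show ?thesis using fin[of "\<bar>x\<bar> + r"] by (rule le_less_trans)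
    qed
    have "?a * (?I x r + ?I (- x) r) < \<infinity>"
      using If[of x] If[of "- x"] by (simp add: ennreal_mult_less_top)
    with up have "(\<integral>\<^sup>+z. ennreal (g' z * W z) \<partial>dunkl_borel \<alpha>) < \<infinity>" by (rule le_less_trans)
    then have "integrable (dunkl_borel \<alpha>) (\<lambda>z. g' z * W z)"
      using g0 W0 by (intro integrableI_nonneg) auto
    then have L': "ennreal ?L = (\<integral>\<^sup>+z. ennreal (g' z * W z) \<partial>dunkl_borel \<alpha>)"
      unfolding L using g0 W0 by (intro nn_integral_eq_integral[symmetric]) auto
    have "ennreal ?L \<le> ?a * (?I x r + ?I (- x) r)"
      unfolding L' by (rule up)
    also have "\<dots> \<le> ennreal (C' * (?rd / ?w)) * (?I x r + ?I (- x) r)"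
      using C'(2) w by (intro mult_right_mono ennreal_leI) auto
    finally have 1: "ennreal ?L \<le> ennreal (C' * (?rd / ?w)) * (?I x r + ?I (- x) r)" .
    define e where "e = c * k * (?rd / ?w)"
    have e: "0 < e" using C k w r by (simp add: e_def)
    have "ennreal e * ?I x (r / 2) = (\<integral>\<^sup>+z. ennreal e * (ennreal (g' z) * indicator (ball x (r / 2)) z) \<partial>dunkl_borel \<alpha>)"
      by (rule nn_integral_cmult[symmetric]) measurable
    also have "\<dots> \<le> ennreal ?L"
      unfolding L'
    proof (rule nn_integral_mono)
      fix z
      show "ennreal e * (ennreal (g' z) * indicator (ball x (r / 2)) z) \<le> ennreal (g' z * W z)"
      proof (cases "z \<in> ball x (r / 2)")
        case True
        then have "e \<le> W z"
          using C(5)[OF r, of z x] ratio[OF r, of x] by (simp add: W_def e_def dist_real_def abs_minus_commute mult.assoc)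
        then have "g' z * e \<le> g' z * W z" using g0 by (intro mult_left_mono) auto
        then show ?thesis using True e g0[of z] by (simp add: mult.commute ennreal_leI flip: ennreal_mult)
      qed simp
    qed
    finally have le: "ennreal e * ?I x (r / 2) \<le> ennreal ?L" .
    have "?I x (r / 2) = ennreal (1 / e) * (ennreal e * ?I x (r / 2))"
      using e by (simp flip: mult.assoc ennreal_mult)
    also have "\<dots> \<le> ennreal (1 / e) * ennreal ?L"
      by (intro mult_left_mono le) auto
    also have "\<dots> \<le> ennreal (C' * (dunkl_weight \<alpha> x (r / 2) / ?rd)) * ennreal ?L"
    proof (intro mult_right_mono ennreal_leI)
      have "1 / e = 1 / (c * k) * (?w / ?rd)" using C k w r by (simp add: e_def)
      also have "\<dots> \<le> 1 / (c * k) * (5 powr (2 * \<alpha> + 2) * dunkl_weight \<alpha> x (r / 2) / ?rd)"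
        using C k r w_doubling[of "r / 2" r x] by (intro mult_left_mono divide_right_mono) auto
      also have "\<dots> = 5 powr (2 * \<alpha> + 2) / (c * k) * (dunkl_weight \<alpha> x (r / 2) / ?rd)" by simp
      also have "\<dots> \<le> C' * (dunkl_weight \<alpha> x (r / 2) / ?rd)"
        using C'(3) w_pos[of "r / 2" x] r by (intro mult_right_mono) auto
      finally show "1 / e \<le> C' * (dunkl_weight \<alpha> x (r / 2) / ?rd)" .
    qed simp
    finally have 2: "?I x (r / 2) \<le> ennreal (C' * (dunkl_weight \<alpha> x (r / 2) / ?rd)) * ennreal ?L" .
    from nonneg 1 2 show "0 \<le> ?L \<and> ennreal ?L \<le> ennreal (C' * (?rd / ?w)) * (?I x r + ?I (- x) r) \<and>
        ?I x (r / 2) \<le> ennreal (C' * (dunkl_weight \<alpha> x (r / 2) / ?rd)) * ennreal ?L" by blast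
  qed
qed

section \<open>The Bessel--Riesz operator\<close>

lemma nn_integral_dunkl_borel_reflect:
  assumes [measurable]: "h \<in> borel_measurable borel"
  shows "(\<integral>\<^sup>+y. h (- y) \<partial>dunkl_borel \<alpha>) = (\<integral>\<^sup>+y. h y \<partial>dunkl_borel \<alpha>)"
  by (simp add: nn_integral_dunkl_borel)
     (subst (2) nn_integral_real_affine[where c = "-1" and t = 0], auto)

text \<open>
  On \<open>{t<..<2 * t}\<close> the integrand on the right is at least a multiple of its value at \<open>t\<close>, by doubling, and
  that interval has length \<open>t\<close>. The right side uses a Borel version \<open>\<rho>'\<close> of \<open>\<rho>\<close>, while the doubling of \<open>\<rho>\<close>
  itself gives the bound at every \<open>t\<close>.
\<close>
lemma bessel_riesz_kernel_le:
  assumes \<gamma>: "0 < \<gamma>" and \<rho>: "doubling \<rho>" "\<And>t. 0 < t \<Longrightarrow> 0 < \<rho> t"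
    and [measurable]: "\<rho>' \<in> borel_measurable borel"
    and ae: "AE s in lborel. 0 < s \<longrightarrow> \<rho> s = \<rho>' s"
  obtains C where "0 < C"
    "\<And>t. 0 < t \<Longrightarrow> ennreal (bessel_riesz_kernel \<rho> \<gamma> t)
       \<le> (\<integral>\<^sup>+s\<in>{t<..}. ennreal (C * (\<rho>' s * s powr (- \<gamma> - 1))) \<partial>lborel)"
proof -
  obtain D where D: "0 < D"
    "\<And>r s. \<lbrakk>0 < r; 0 < s; 1 / 2 \<le> r / s; r / s \<le> 2\<rbrakk> \<Longrightarrow> \<rho> r / \<rho> s \<le> D"
    using \<rho>(1) unfolding doubling_def by blast
  show thesis
  proof (rule that[of "D * 2 powr (\<gamma> + 1)"])
    show "0 < D * 2 powr (\<gamma> + 1)" using D by simp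
    fix t :: real assume t: "0 < t"
    have "bessel_riesz_kernel \<rho> \<gamma> t \<le> \<rho> t / t powr \<gamma>"
      unfolding bessel_riesz_kernel_def using t \<gamma> \<rho>(2)[OF t]
      by (auto intro!: divide_left_mono powr_mono2)
    also have "\<dots> = \<rho> t * t powr (- \<gamma> - 1) * t"
      using t by (simp add: powr_diff powr_minus_divide)
    finally have "ennreal (bessel_riesz_kernel \<rho> \<gamma> t) \<le> ennreal (\<rho> t * t powr (- \<gamma> - 1)) * ennreal t"
      using t \<rho>(2)[OF t] by (simp add: ennreal_leI flip: ennreal_mult)
    also have "\<dots> = (\<integral>\<^sup>+s. ennreal (\<rho> t * t powr (- \<gamma> - 1)) * indicator {t<..<2 * t} s \<partial>lborel)"
      using t by (subst nn_integral_cmult_indicator) auto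
    also have "\<dots> \<le> (\<integral>\<^sup>+s\<in>{t<..}. ennreal (D * 2 powr (\<gamma> + 1) * (\<rho>' s * s powr (- \<gamma> - 1))) \<partial>lborel)"
    proof (rule nn_integral_mono_AE)
      show "AE s in lborel. ennreal (\<rho> t * t powr (- \<gamma> - 1)) * indicator {t<..<2 * t} s
        \<le> ennreal (D * 2 powr (\<gamma> + 1) * (\<rho>' s * s powr (- \<gamma> - 1))) * indicator {t<..} s"
        using ae
      proof eventually_elim
        case (elim s)
        show ?case
        proof (cases "s \<in> {t<..<2 * t}")
          case True
          then have s: "0 < s" "t < s" "s < 2 * t" using t by auto
          have "\<rho> t / \<rho> s \<le> D" using s t by (intro D) (auto simp: field_simps)
          then have "\<rho> t \<le> D * \<rho>' s" using \<rho>(2)[OF s(1)] elim s by (simp add: field_simps)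
          moreover have "t powr (- \<gamma> - 1) = 2 powr (\<gamma> + 1) * (2 * t) powr (- \<gamma> - 1)"
            using t powr_minus[of 2 "\<gamma> + 1"] by (simp add: powr_mult)
          moreover have "(2 * t) powr (- \<gamma> - 1) \<le> s powr (- \<gamma> - 1)"
            using s \<gamma> by (intro powr_mono2') auto
          ultimately have "\<rho> t * t powr (- \<gamma> - 1) \<le> (D * \<rho>' s) * (2 powr (\<gamma> + 1) * s powr (- \<gamma> - 1))"
            using \<rho>(2)[OF t] by (intro mult_mono) auto
          then show ?thesis using True by (auto simp: mult_ac intro!: ennreal_leI)
        qed simp
      qed
    qed
    finally show "ennreal (bessel_riesz_kernel \<rho> \<gamma> t)
       \<le> (\<integral>\<^sup>+s\<in>{t<..}. ennreal (D * 2 powr (\<gamma> + 1) * (\<rho>' s * s powr (- \<gamma> - 1))) \<partial>lborel)" .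
  qed
qed

text \<open>
  The Bochner integral of a non-integrable function is \<open>0\<close>, so an operator may be estimated before
  its integral is known to converge.
\<close>
lemma norm_integral_le_nn_integral:
  fixes f :: "'a \<Rightarrow> 'b::{banach, second_countable_topology}"
  shows "ennreal (norm (integral\<^sup>L M f)) \<le> (\<integral>\<^sup>+x. ennreal (norm (f x)) \<partial>M)"
  by (cases "integrable M f") (simp_all add: integral_norm_bound_ennreal not_integrable_integral_eq)

text \<open>
  Translating the superposition \<open>K t \<le> \<integral>\<^sub>s A s * indicator {..<s} t\<close> under the integral sign; on even
  functions the translation is positive, so inequalities are preserved.
\<close>
lemma dunkl_translation_even_le:
  fixes A :: "real \<Rightarrow> ennreal"
  assumes \<alpha>: "- 1 / 2 \<le> \<alpha>" and [measurable]: "A \<in> borel_measurable borel"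
    and even: "\<And>t. K (- t) = K t"
    and K: "\<And>t. 0 < t \<Longrightarrow> ennreal \<bar>K t\<bar> \<le> (\<integral>\<^sup>+s\<in>{t<..}. A s \<partial>lborel)"
    and xy: "\<bar>x\<bar> \<noteq> \<bar>y\<bar>"
  shows "ennreal \<bar>dunkl_translation \<alpha> x K y\<bar>
    \<le> (\<integral>\<^sup>+s\<in>{0<..}. A s * ennreal (translated_ball \<alpha> x s y) \<partial>lborel)"
proof (cases "\<alpha> = - 1 / 2")
  case True
  have "ennreal \<bar>K (x + y)\<bar> = ennreal \<bar>K \<bar>x + y\<bar>\<bar>" using even[of "x + y"] by (auto simp: abs_if)
  also have "\<dots> \<le> (\<integral>\<^sup>+s\<in>{\<bar>x + y\<bar><..}. A s \<partial>lborel)" using xy by (intro K) auto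
  also have "\<dots> = (\<integral>\<^sup>+s\<in>{0<..}. A s * ennreal (translated_ball \<alpha> x s y) \<partial>lborel)"
    by (intro nn_integral_cong) (auto simp: dunkl_translation_def True indicator_def)
  finally show ?thesis by (simp add: dunkl_translation_def True)
next
  case False
  then have \<alpha>: "- 1 / 2 < \<alpha>" using \<alpha> by simp
  note c = dunkl_const_pos[OF \<alpha>]
  let ?d = "dunkl_dist x y"
  let ?e = "\<lambda>t. ennreal ((1 - cos t) * sin t powr (2 * \<alpha>))"
  let ?h = "\<lambda>t s. A s * (indicator {..<s} (?d t) * ?e t * indicator {0..pi} t)"
  have d: "0 < ?d t" for t using dunkl_dist_bounds(1)[of x y t] xy by linarith
  have "ennreal \<bar>dunkl_translation \<alpha> x K y\<bar>
      = ennreal (dunkl_const \<alpha> / 2) * ennreal (norm (LINT t|lebesgue. dunkl_integrand \<alpha> x K y t))"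
    using c False by (simp add: dunkl_translation_eq_integrand abs_mult flip: ennreal_mult)
  also have "\<dots> \<le> ennreal (dunkl_const \<alpha> / 2) * (\<integral>\<^sup>+t. ennreal (norm (dunkl_integrand \<alpha> x K y t)) \<partial>lebesgue)"
    by (intro mult_left_mono norm_integral_le_nn_integral) simp
  also have "\<dots> \<le> ennreal (dunkl_const \<alpha> / 2) *
      (\<integral>\<^sup>+t. 2 * (\<integral>\<^sup>+s. ?h t s \<partial>lborel) \<partial>lebesgue)"
  proof (intro mult_left_mono nn_integral_mono)
    fix t :: real
    have "norm (dunkl_integrand \<alpha> x K y t) = 2 * (\<bar>K (?d t)\<bar> * ((1 - cos t) * sin t powr (2 * \<alpha>) * indicator {0..pi} t))"
      by (simp add: dunkl_integrand_def even abs_mult indicator_def)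
    then have "ennreal (norm (dunkl_integrand \<alpha> x K y t)) = 2 * (ennreal \<bar>K (?d t)\<bar> * (?e t * indicator {0..pi} t))"
      by (simp add: ennreal_mult indicator_def)
    also have "\<dots> \<le> 2 * ((\<integral>\<^sup>+s\<in>{?d t<..}. A s \<partial>lborel) * (?e t * indicator {0..pi} t))"
      by (intro mult_left_mono mult_right_mono K d) auto
    also have "(\<integral>\<^sup>+s\<in>{?d t<..}. A s \<partial>lborel) * (?e t * indicator {0..pi} t)
        = (\<integral>\<^sup>+s. ?h t s \<partial>lborel)"
      by (subst nn_integral_multc[symmetric], measurable) (auto simp: indicator_def intro!: nn_integral_cong)
    finally show "ennreal (norm (dunkl_integrand \<alpha> x K y t))
        \<le> 2 * (\<integral>\<^sup>+s. ?h t s \<partial>lborel)" .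
  qed simp
  also have "\<dots> = ennreal (dunkl_const \<alpha>) *
      (\<integral>\<^sup>+t. (\<integral>\<^sup>+s. ?h t s \<partial>lborel) \<partial>lborel)"
  proof -
    have "ennreal (dunkl_const \<alpha> / 2) * (2 * X) = ennreal (dunkl_const \<alpha>) * X" for X
      using c by (simp flip: mult.assoc ennreal_numeral ennreal_mult)
    then show ?thesis
      unfolding nn_integral_completion lessThan_iff indicator_def
      by (subst nn_integral_cmult) (simp_all)
  qed
  also have "(\<integral>\<^sup>+t. (\<integral>\<^sup>+s. ?h t s \<partial>lborel) \<partial>lborel)
      = (\<integral>\<^sup>+s. (\<integral>\<^sup>+t. ?h t s \<partial>lborel) \<partial>lborel)"
    unfolding lessThan_iff indicator_def by (rule lborel_pair.Fubini') simp
  also have "\<dots> = (\<integral>\<^sup>+s. A s * (\<integral>\<^sup>+t\<in>{0..pi}. indicator {..<s} (?d t) * ?e t \<partial>lborel) \<partial>lborel)"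
    by (intro nn_integral_cong nn_integral_cmult) measurable
  also have "ennreal (dunkl_const \<alpha>) * \<dots>
      = (\<integral>\<^sup>+s. ennreal (dunkl_const \<alpha>) * (A s * (\<integral>\<^sup>+t\<in>{0..pi}. indicator {..<s} (?d t) * ?e t \<partial>lborel)) \<partial>lborel)"
    unfolding lessThan_iff indicator_def by (rule nn_integral_cmult[symmetric]) simp
  also have "\<dots> = (\<integral>\<^sup>+s\<in>{0<..}. A s * ennreal (translated_ball \<alpha> x s y) \<partial>lborel)"
  proof (rule nn_integral_cong)
    fix s
    show "ennreal (dunkl_const \<alpha>) * (A s * (\<integral>\<^sup>+t\<in>{0..pi}. indicator {..<s} (?d t) * ?e t \<partial>lborel))
      = A s * ennreal (translated_ball \<alpha> x s y) * indicator {0<..} s"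
    proof (cases "0 < s")
      case False
      then have "\<not> ?d t < s" for t using d[of t] by linarith
      then show ?thesis using False by simp
    qed (simp add: dunkl_translation_ball(1)[OF \<alpha>] mult_ac)
  qed
  finally show ?thesis .
qed

text \<open>
  The translated kernel is a superposition of translated balls, each of which is bounded by
  the indicators of \<open>ball x s\<close> and \<open>ball (- x) s\<close>; the reflection invariance of the measure moves the
  second ball onto the first, at the price of replacing \<open>f y\<close> by \<open>f (- y)\<close>.
\<close>
lemma dunkl_bessel_riesz_le:
  assumes \<alpha>: "- 1 / 2 \<le> \<alpha>" and \<gamma>: "0 < \<gamma>" and \<rho>: "doubling \<rho>" "\<And>t. 0 < t \<Longrightarrow> 0 < \<rho> t"
    and [measurable]: "\<rho>' \<in> borel_measurable borel"
    and ae: "AE s in lborel. 0 < s \<longrightarrow> \<rho> s = \<rho>' s" and \<rho>'0: "\<And>s. 0 \<le> \<rho>' s"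
  obtains C where "0 < C"
    "\<And>f f' x. \<lbrakk>f' \<in> borel_measurable borel; AE y in lborel. f y = f' y\<rbrakk> \<Longrightarrow>
       ennreal (cmod (dunkl_bessel_riesz \<alpha> \<rho> \<gamma> f x))
         \<le> (\<integral>\<^sup>+s\<in>{0<..}. ennreal (C * (\<rho>' s / s powr (\<gamma> - dunkl_dim \<alpha> + 1)) / dunkl_weight \<alpha> x s) *
             dunkl_ball \<alpha> (\<lambda>y. cmod (f' y) + cmod (f' (- y))) x s \<partial>lborel)"
proof -
  interpret doubling_weight "dunkl_borel \<alpha>" "dunkl_weight \<alpha>" "5 powr (2 * \<alpha> + 2)"
    by (rule doubling_weight_dunkl[OF \<alpha>])
  interpret M: sigma_finite_measure "dunkl_borel \<alpha>" by (rule sigma_finite_M)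
  interpret P: pair_sigma_finite "dunkl_borel \<alpha>" "lborel :: real measure" ..
  obtain C\<^sub>1 where C1: "0 < C\<^sub>1"
    "\<And>t. 0 < t \<Longrightarrow> ennreal (bessel_riesz_kernel \<rho> \<gamma> t)
       \<le> (\<integral>\<^sup>+s\<in>{t<..}. ennreal (C\<^sub>1 * (\<rho>' s * s powr (- \<gamma> - 1))) \<partial>lborel)"
    using bessel_riesz_kernel_le[OF \<gamma> \<rho> _ ae] by auto
  obtain C\<^sub>2 c where C2: "0 < C\<^sub>2"
    "\<And>x z r. 0 < r \<Longrightarrow> translated_ball \<alpha> x r z
        \<le> C\<^sub>2 * (r / max \<bar>x\<bar> r) powr (2 * \<alpha> + 1) * indicator (ball x r \<union> ball (- x) r) z"
    using dunkl_translation_ball_bounds[OF \<alpha>] by metis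
  define k where "k = dunkl_density \<alpha> 1 * 2 powr (2 * \<alpha> + 2)"
  have k: "0 < k" using dunkl_density_pos[OF \<alpha>, of 1] by (simp add: k_def)
  define C where "C = C\<^sub>1 * (C\<^sub>2 * k)"
  have C: "0 < C" using C1 C2 k by (simp add: C_def)
  define a where "a = (\<lambda>x s. C * (\<rho>' s / s powr (\<gamma> - dunkl_dim \<alpha> + 1)) / dunkl_weight \<alpha> x s)"
  have [measurable]: "(\<lambda>s. a x s) \<in> borel_measurable borel" for x unfolding a_def by measurable
  have transl: "ennreal \<bar>dunkl_translation \<alpha> x (bessel_riesz_kernel \<rho> \<gamma>) y\<bar>
      \<le> (\<integral>\<^sup>+s\<in>{0<..}. ennreal (a x s) * (indicator (ball x s) y + indicator (ball (- x) s) y) \<partial>lborel)"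
    if xy: "\<bar>x\<bar> \<noteq> \<bar>y\<bar>" for x y
  proof -
    have "ennreal \<bar>dunkl_translation \<alpha> x (bessel_riesz_kernel \<rho> \<gamma>) y\<bar>
        \<le> (\<integral>\<^sup>+s\<in>{0<..}. ennreal (C\<^sub>1 * (\<rho>' s * s powr (- \<gamma> - 1))) *
              ennreal (translated_ball \<alpha> x s y) \<partial>lborel)"
    proof (rule dunkl_translation_even_le[OF \<alpha> _ _ _ xy])
      show "ennreal \<bar>bessel_riesz_kernel \<rho> \<gamma> t\<bar>
          \<le> (\<integral>\<^sup>+s\<in>{t<..}. ennreal (C\<^sub>1 * (\<rho>' s * s powr (- \<gamma> - 1))) \<partial>lborel)" if "0 < t" for t
        using C1(2)[OF that] \<rho>(2)[OF that] that by (simp add: bessel_riesz_kernel_def)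
    qed (simp_all add: bessel_riesz_kernel_def)
    also have "\<dots> \<le> (\<integral>\<^sup>+s\<in>{0<..}. ennreal (a x s) * (indicator (ball x s) y + indicator (ball (- x) s) y) \<partial>lborel)"
    proof (rule nn_integral_mono)
      fix s :: real
      show "ennreal (C\<^sub>1 * (\<rho>' s * s powr (- \<gamma> - 1))) * ennreal (translated_ball \<alpha> x s y) * indicator {0<..} s
          \<le> ennreal (a x s) * (indicator (ball x s) y + indicator (ball (- x) s) y) * indicator {0<..} s"
      proof (cases "0 < s")
        case True
        let ?i = "indicator (ball x s \<union> ball (- x) s) y"
        have sp: "s powr (- \<gamma> - 1) * s powr dunkl_dim \<alpha> = 1 / s powr (\<gamma> - dunkl_dim \<alpha> + 1)"
          using True by (simp add: powr_minus_divide[symmetric] flip: powr_add) (simp add: algebra_simps)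
        have "ennreal (C\<^sub>1 * (\<rho>' s * s powr (- \<gamma> - 1))) * ennreal (translated_ball \<alpha> x s y)
            \<le> ennreal (C\<^sub>1 * (\<rho>' s * s powr (- \<gamma> - 1))) * ennreal (C\<^sub>2 * (k * s powr dunkl_dim \<alpha> / dunkl_weight \<alpha> x s) * ?i)"
          using C2(2)[OF True, of x y] ratio_powr_eq_dunkl_weight[OF \<alpha> True, of x]
          by (intro mult_left_mono ennreal_leI) (simp_all add: k_def)
        also have "\<dots> = ennreal (C\<^sub>1 * (\<rho>' s * s powr (- \<gamma> - 1)) * (C\<^sub>2 * (k * s powr dunkl_dim \<alpha> / dunkl_weight \<alpha> x s) * ?i))"
          using C1(1) \<rho>'0[of s] by (intro ennreal_mult'[symmetric]) auto
        also have "C\<^sub>1 * (\<rho>' s * s powr (- \<gamma> - 1)) * (C\<^sub>2 * (k * s powr dunkl_dim \<alpha> / dunkl_weight \<alpha> x s) * ?i)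
            = C * (\<rho>' s * (s powr (- \<gamma> - 1) * s powr dunkl_dim \<alpha>)) / dunkl_weight \<alpha> x s * ?i"
          by (simp add: C_def)
        also have "\<dots> = a x s * ?i"
          unfolding sp by (simp add: a_def)
        also have "ennreal (a x s * ?i) \<le> ennreal (a x s) * (indicator (ball x s) y + indicator (ball (- x) s) y)"
          by (auto simp: indicator_def distrib_left)
        finally show ?thesis using True by simp
      qed simp
    qed
    finally show ?thesis .
  qed
  show thesis
  proof (rule that[OF C])
    fix f f' :: "real \<Rightarrow> complex" and x :: real
    assume [measurable]: "f' \<in> borel_measurable borel" and f: "AE y in lborel. f y = f' y"
    have [measurable]: "ball y s \<in> sets borel" for y s :: real by simp
    let ?h = "\<lambda>y s. ennreal (cmod (f' y)) * (ennreal (a x s) * (indicator (ball x s) y + indicator (ball (- x) s) y) * indicator {0<..} s)"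
    let ?J = "\<lambda>y. (\<integral>\<^sup>+s\<in>{0<..}. ennreal (a x s) * (indicator (ball x s) y + indicator (ball (- x) s) y) \<partial>lborel)"
    have "ennreal (cmod (dunkl_bessel_riesz \<alpha> \<rho> \<gamma> f x))
        \<le> (\<integral>\<^sup>+y. ennreal (norm (f y * complex_of_real (dunkl_translation \<alpha> x (bessel_riesz_kernel \<rho> \<gamma>) y))) \<partial>dunkl_measure \<alpha>)"
      unfolding dunkl_bessel_riesz_def by (rule norm_integral_le_nn_integral)
    also have "\<dots> \<le> (\<integral>\<^sup>+y. ennreal (cmod (f' y)) * ?J y \<partial>dunkl_borel \<alpha>)"
    proof (rule nn_integral_dunkl_measure_le)
      show "(\<lambda>y. ennreal (cmod (f' y)) * ?J y) \<in> borel_measurable borel"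
        unfolding mem_ball indicator_def by measurable
      show "AE y in lborel. ennreal (norm (f y * complex_of_real (dunkl_translation \<alpha> x (bessel_riesz_kernel \<rho> \<gamma>) y)))
          \<le> ennreal (cmod (f' y)) * ?J y"
        using f AE_lborel_singleton[of x] AE_lborel_singleton[of "- x"]
      proof eventually_elim
        case (elim y)
        then have "\<bar>x\<bar> \<noteq> \<bar>y\<bar>" by auto
        from transl[OF this] show ?case
          using elim(1) by (simp add: norm_mult ennreal_mult mult_left_mono)
      qed
    qed
    also have "\<dots> = (\<integral>\<^sup>+y. (\<integral>\<^sup>+s. ?h y s \<partial>lborel) \<partial>dunkl_borel \<alpha>)"
      unfolding mem_ball indicator_def by (intro nn_integral_cong nn_integral_cmult[symmetric]) measurable
    also have "\<dots> = (\<integral>\<^sup>+s. (\<integral>\<^sup>+y. ?h y s \<partial>dunkl_borel \<alpha>) \<partial>lborel)"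
      unfolding mem_ball indicator_def by (rule P.Fubini'[symmetric]) measurable
    also have "\<dots> = (\<integral>\<^sup>+s\<in>{0<..}. ennreal (a x s) *
             dunkl_ball \<alpha> (\<lambda>y. cmod (f' y) + cmod (f' (- y))) x s \<partial>lborel)"
    proof (rule nn_integral_cong)
      fix s :: real
      have "(\<integral>\<^sup>+y. ?h y s \<partial>dunkl_borel \<alpha>)
          = (\<integral>\<^sup>+y. ennreal (a x s) * indicator {0<..} s * (ennreal (cmod (f' y)) * indicator (ball x s) y + ennreal (cmod (f' y)) * indicator (ball (- x) s) y) \<partial>dunkl_borel \<alpha>)"
        by (intro nn_integral_cong) (simp add: algebra_simps)
      also have "\<dots> = ennreal (a x s) * indicator {0<..} s * (dunkl_ball \<alpha> (\<lambda>y. cmod (f' y)) x s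
           + dunkl_ball \<alpha> (\<lambda>y. cmod (f' y)) (- x) s)"
        by (subst nn_integral_cmult, measurable) (subst nn_integral_add, auto)
      also have "dunkl_ball \<alpha> (\<lambda>y. cmod (f' y)) (- x) s
          = dunkl_ball \<alpha> (\<lambda>y. cmod (f' (- y))) x s"
        by (subst nn_integral_dunkl_borel_reflect[symmetric], measurable)
           (auto intro!: nn_integral_cong simp: indicator_def dist_real_def)
      also have "dunkl_ball \<alpha> (\<lambda>y. cmod (f' y)) x s + \<dots>
          = dunkl_ball \<alpha> (\<lambda>y. cmod (f' y) + cmod (f' (- y))) x s"
        by (subst nn_integral_add[symmetric]) (auto intro!: nn_integral_cong simp: distrib_right)
      finally show "(\<integral>\<^sup>+y. ?h y s \<partial>dunkl_borel \<alpha>)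
         = ennreal (a x s) * dunkl_ball \<alpha> (\<lambda>y. cmod (f' y) + cmod (f' (- y))) x s * indicator {0<..} s"
        by (simp add: mult_ac)
    qed
    finally show "ennreal (cmod (dunkl_bessel_riesz \<alpha> \<rho> \<gamma> f x))
         \<le> (\<integral>\<^sup>+s\<in>{0<..}. ennreal (C * (\<rho>' s / s powr (\<gamma> - dunkl_dim \<alpha> + 1)) / dunkl_weight \<alpha> x s) *
             dunkl_ball \<alpha> (\<lambda>y. cmod (f' y) + cmod (f' (- y))) x s \<partial>lborel)"
      unfolding a_def .
  qed
qed

section \<open>Boundedness on Morrey spaces\<close>

lemma complex_borel_representative:
  fixes f :: "real \<Rightarrow> complex"
  assumes [measurable]: "f \<in> borel_measurable lebesgue"
  obtains f' where "f' \<in> borel_measurable borel" "AE y in lborel. f y = f' y"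
proof -
  obtain u where u: "u \<in> borel_measurable lborel" "AE y in lborel. Re (f y) = u y"
    using completion_ex_borel_measurable_real[of "\<lambda>y. Re (f y)" lborel] by auto
  obtain v where v: "v \<in> borel_measurable lborel" "AE y in lborel. Im (f y) = v y"
    using completion_ex_borel_measurable_real[of "\<lambda>y. Im (f y)" lborel] by auto
  show thesis
  proof (rule that)
    have [measurable]: "u \<in> borel_measurable borel" "v \<in> borel_measurable borel" using u v by simp_all
    show "(\<lambda>y. complex_of_real (u y) + \<i> * complex_of_real (v y)) \<in> borel_measurable borel" by measurable
    show "AE y in lborel. f y = complex_of_real (u y) + \<i> * complex_of_real (v y)"
      using u(2) v(2) by eventually_elim (simp add: complex_eq_iff)
  qed
qed

text \<open>
  Replacing both \<open>f\<close> and \<open>\<rho>\<close> by Borel versions does not change the value of the operator at any point,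
  and makes the integrand jointly Borel measurable.
\<close>
lemma dunkl_bessel_riesz_borel:
  assumes \<alpha>: "- 1 / 2 \<le> \<alpha>"
    and [measurable]: "\<rho>' \<in> borel_measurable borel" "f' \<in> borel_measurable borel"
    and \<rho>: "AE s in lborel. 0 < s \<longrightarrow> \<rho> s = \<rho>' s" and f: "AE y in lborel. f y = f' y"
  shows "dunkl_bessel_riesz \<alpha> \<rho> \<gamma> f \<in> borel_measurable borel"
proof -
  interpret doubling_weight "dunkl_borel \<alpha>" "dunkl_weight \<alpha>" "5 powr (2 * \<alpha> + 2)"
    by (rule doubling_weight_dunkl[OF \<alpha>])
  interpret M: sigma_finite_measure "dunkl_borel \<alpha>" by (rule sigma_finite_M)
  have [measurable]: "bessel_riesz_kernel \<rho>' \<gamma> \<in> borel_measurable borel"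
    unfolding bessel_riesz_kernel_def by measurable
  have "AE z in lborel. 0 < - z \<longrightarrow> \<rho> (- z) = \<rho>' (- z)"
    using AE_lborel_affine[OF \<rho>, of "-1" 0] by simp
  with \<rho> AE_lborel_singleton[of 0] have K: "AE z in lborel. bessel_riesz_kernel \<rho> \<gamma> z = bessel_riesz_kernel \<rho>' \<gamma> z"
    by eventually_elim (auto simp: bessel_riesz_kernel_def abs_if)
  have "dunkl_bessel_riesz \<alpha> \<rho> \<gamma> f x
      = (LINT y|dunkl_borel \<alpha>. f' y * complex_of_real (dunkl_translation \<alpha> x (bessel_riesz_kernel \<rho>' \<gamma>) y))" for x
    unfolding dunkl_bessel_riesz_def
  proof (rule integral_dunkl_measure[OF \<alpha>])
    have "AE y in lborel. dunkl_translation \<alpha> x (bessel_riesz_kernel \<rho> \<gamma>) y = dunkl_translation \<alpha> x (bessel_riesz_kernel \<rho>' \<gamma>) y"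
      by (rule AE_dunkl_translation_cong[OF K]) simp
    with f show "AE y in lborel. f y * complex_of_real (dunkl_translation \<alpha> x (bessel_riesz_kernel \<rho> \<gamma>) y)
        = f' y * complex_of_real (dunkl_translation \<alpha> x (bessel_riesz_kernel \<rho>' \<gamma>) y)"
      by eventually_elim simp
  qed measurable
  moreover have "(\<lambda>x. LINT y|dunkl_borel \<alpha>. f' y * complex_of_real (dunkl_translation \<alpha> x (bessel_riesz_kernel \<rho>' \<gamma>) y))
      \<in> borel_measurable borel"
    by (rule M.borel_measurable_lebesgue_integral) measurable
  ultimately show ?thesis by (simp cong: measurable_cong)
qed

text \<open>
  The integral condition is stated with Bochner integrals, which vanish for non-integrable
  functions. The almost monotonicity of \<open>\<phi>\<close> makes the second integrand integrable, so that the condition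
  carries over to nonnegative integrals.
\<close>
lemma kernel_condition_nn_integral:
  fixes u \<phi> :: "real \<Rightarrow> real"
  assumes u0: "\<And>t. 0 < t \<Longrightarrow> 0 \<le> u t" and u: "set_integrable lebesgue {0<..} u"
    and \<phi>0: "\<And>r. 0 < r \<Longrightarrow> 0 < \<phi> r" and \<phi>_meas: "\<phi> \<in> borel_measurable (lebesgue_on {0<..})"
    and B: "\<And>r s. 0 < r \<Longrightarrow> r \<le> s \<Longrightarrow> \<phi> s \<le> B * \<phi> r"
    and r: "0 < r"
    and le: "\<phi> r * (LINT t:{0<..<r}|lebesgue. u t) + (LINT t:{r<..}|lebesgue. u t * \<phi> t) \<le> b"
  shows "ennreal (\<phi> r) * (\<integral>\<^sup>+t\<in>{0<..<r}. ennreal (u t) \<partial>lebesgue)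
      + (\<integral>\<^sup>+t\<in>{r<..}. ennreal (u t * \<phi> t) \<partial>lebesgue) \<le> ennreal b"
proof -
  have [measurable]: "{r<..} \<in> sets lebesgue" "{0<..<r} \<in> sets lebesgue" "{0<..} \<in> sets (lebesgue :: real measure)" by auto
  have int1: "set_integrable lebesgue {0<..<r} u"
    by (rule set_integrable_subset[OF u]) auto
  have int2: "set_integrable lebesgue {r<..} u"
    by (rule set_integrable_subset[OF u]) (use r in auto)
  have int3: "set_integrable lebesgue {r<..} (\<lambda>t. u t * \<phi> t)"
  proof (rule set_integrable_bound)
    show "set_integrable lebesgue {r<..} (\<lambda>t. B * \<phi> r * u t)"
      using int2 by (rule set_integrable_mult_right)
    have "(\<lambda>t. indicator {0<..} t * \<phi> t) \<in> borel_measurable lebesgue"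
      using \<phi>_meas by (subst (asm) borel_measurable_restrict_space_iff) auto
    moreover have "(\<lambda>t. indicator {r<..} t *\<^sub>R u t) \<in> borel_measurable lebesgue"
      using int2 unfolding set_integrable_def by (rule borel_measurable_integrable)
    ultimately have "(\<lambda>t. (indicator {r<..} t *\<^sub>R u t) * (indicator {0<..} t * \<phi> t)) \<in> borel_measurable lebesgue"
      by (rule borel_measurable_times[rotated])
    also have "(\<lambda>t. (indicator {r<..} t *\<^sub>R u t) * (indicator {0<..} t * \<phi> t)) = (\<lambda>t. indicator {r<..} t *\<^sub>R (u t * \<phi> t))"
      using r by (auto simp: indicator_def)
    finally show "set_borel_measurable lebesgue {r<..} (\<lambda>t. u t * \<phi> t)"
      unfolding set_borel_measurable_def .
    show "AE t in lebesgue. t \<in> {r<..} \<longrightarrow> norm (u t * \<phi> t) \<le> norm (B * \<phi> r * u t)"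
    proof (intro AE_I2 impI)
      fix t assume "t \<in> {r<..}"
      then have t: "r < t" "0 < t" using r by auto
      have "\<bar>\<phi> t\<bar> \<le> \<bar>B * \<phi> r\<bar>" using B[OF r, of t] t \<phi>0[OF t(2)] by linarith
      then show "norm (u t * \<phi> t) \<le> norm (B * \<phi> r * u t)"
        using mult_right_mono[of _ _ "\<bar>u t\<bar>"] by (fastforce simp: abs_mult mult_ac)
    qed
  qed
  have 1: "(\<integral>\<^sup>+t\<in>{0<..<r}. ennreal (u t) \<partial>lebesgue) = ennreal (LINT t:{0<..<r}|lebesgue. u t)"
    unfolding set_lebesgue_integral_def
    using int1 u0 unfolding set_integrable_def
    by (subst nn_integral_eq_integral[symmetric]) (auto simp: indicator_def intro!: nn_integral_cong)
  have 2: "(\<integral>\<^sup>+t\<in>{r<..}. ennreal (u t * \<phi> t) \<partial>lebesgue) = ennreal (LINT t:{r<..}|lebesgue. u t * \<phi> t)"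
    unfolding set_lebesgue_integral_def
    using int3 u0 \<phi>0 r unfolding set_integrable_def
    by (subst nn_integral_eq_integral[symmetric])
       (auto simp: indicator_def less_imp_le intro!: nn_integral_cong mult_nonneg_nonneg)
  have "0 \<le> (LINT t:{0<..<r}|lebesgue. u t)" "0 \<le> (LINT t:{r<..}|lebesgue. u t * \<phi> t)"
    unfolding set_lebesgue_integral_def using u0 \<phi>0 r
    by (auto intro!: integral_nonneg_AE simp: indicator_def less_imp_le)
  then show ?thesis
    unfolding 1 2 using le \<phi>0[OF r] by (simp add: ennreal_leI flip: ennreal_mult ennreal_plus)
qed

lemma locally_p_integrable_nn_integral:
  assumes "locally_p_integrable \<alpha> p f" and [measurable]: "f' \<in> borel_measurable borel"
    and ae: "AE y in lborel. f y = f' y"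
  shows "dunkl_ball \<alpha> (\<lambda>y. cmod (f' y) powr p) 0 R < \<infinity>"
proof -
  have [measurable]: "ball 0 R \<in> sets borel" by simp
  have int: "integrable (dunkl_measure \<alpha>) (\<lambda>y. indicator (cball 0 R) y *\<^sub>R (cmod (f y) powr p))"
    using assms(1) compact_cball[of "0::real" R] unfolding locally_p_integrable_def set_integrable_def by blast
  have "dunkl_ball \<alpha> (\<lambda>y. cmod (f' y) powr p) 0 R
      = ball_integral (dunkl_measure \<alpha>) (\<lambda>y. cmod (f y) powr p) 0 R"
    by (rule nn_integral_dunkl_measure[symmetric], measurable) (use ae in eventually_elim, simp)
  also have "\<dots> \<le> (\<integral>\<^sup>+y. ennreal (norm (indicator (cball 0 R) y *\<^sub>R (cmod (f y) powr p))) \<partial>dunkl_measure \<alpha>)"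
    by (intro nn_integral_mono) (auto simp: indicator_def)
  also have "\<dots> < \<infinity>" using int by (simp add: integrable_iff_bounded)
  finally show ?thesis .
qed

lemma locally_p_integrableI:
  assumes \<alpha>: "- 1 / 2 \<le> \<alpha>" and [measurable]: "f \<in> borel_measurable borel"
    and fin: "\<And>R. 0 < R \<Longrightarrow> (dunkl_ball \<alpha> (\<lambda>y. cmod (f y) powr p) 0 R) < \<infinity>"
  shows "locally_p_integrable \<alpha> p f"
  unfolding locally_p_integrable_def
proof (intro conjI allI impI)
  show "f \<in> borel_measurable lebesgue" by (rule measurable_completion) simp
  fix K :: "real set" assume K: "compact K"
  then obtain R where R: "0 < R" "K \<subseteq> ball 0 R"
    using bounded_subset_ballD[OF compact_imp_bounded[OF K], of 0] by auto
  have [measurable]: "K \<in> sets borel" using K by (rule borel_compact)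
  show "set_integrable (dunkl_measure \<alpha>) K (\<lambda>x. cmod (f x) powr p)"
    unfolding set_integrable_def
  proof (rule integrableI_bounded)
    have "(\<lambda>y. indicator K y *\<^sub>R (cmod (f y) powr p)) \<in> borel_measurable lebesgue"
      by (rule measurable_completion) simp
    then show "(\<lambda>y. indicator K y *\<^sub>R (cmod (f y) powr p)) \<in> borel_measurable (dunkl_measure \<alpha>)"
      by (simp add: dunkl_measure_def)
    have "(\<integral>\<^sup>+y. ennreal (norm (indicator K y *\<^sub>R (cmod (f y) powr p))) \<partial>dunkl_measure \<alpha>)
        \<le> dunkl_ball \<alpha> (\<lambda>y. cmod (f y) powr p) 0 R"
      by (rule nn_integral_dunkl_measure_le) (use R in \<open>auto simp: indicator_def intro!: AE_I2\<close>)
    also have "\<dots> < \<infinity>" by (rule fin[OF R(1)])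
    finally show "(\<integral>\<^sup>+y. ennreal (norm (indicator K y *\<^sub>R (cmod (f y) powr p))) \<partial>dunkl_measure \<alpha>) < \<infinity>" .
  qed
qed

lemma powr_add_le:
  fixes a b p :: real
  assumes "0 \<le> a" "0 \<le> b" "0 \<le> p"
  shows "(a + b) powr p \<le> 2 powr p * (a powr p + b powr p)"
proof -
  have "(a + b) powr p \<le> (2 * max a b) powr p"
    using assms by (intro powr_mono2) auto
  also have "\<dots> = 2 powr p * max a b powr p" using assms by (simp add: powr_mult)
  also have "\<dots> \<le> 2 powr p * (a powr p + b powr p)"
    by (intro mult_left_mono) (auto simp: max_def)
  finally show ?thesis .
qed

lemma dunkl_morrey_normD:
  assumes "dunkl_morrey_norm \<alpha> p \<phi> f \<le> ennreal N" and p: "0 < p" and r: "0 < r" and N: "0 \<le> N" and \<phi>: "0 < \<phi> r"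
    and "0 \<le> translated_integral \<alpha> x (\<lambda>z. cmod (f z) powr p) r" (is "0 \<le> ?L")
  shows "?L \<le> r powr dunkl_dim \<alpha> * (N * \<phi> r) powr p"
proof -
  define m where "m = 1 / r powr dunkl_dim \<alpha> * ?L"
  have m: "0 \<le> m" using assms by (simp add: m_def)
  have "ennreal (1 / \<phi> r * m powr (1 / p)) \<le> dunkl_morrey_norm \<alpha> p \<phi> f"
    unfolding dunkl_morrey_norm_def m_def by (rule SUP_upper2[where i = "(r, x)"]) (use r in auto)
  also note assms(1)
  finally have "1 / \<phi> r * m powr (1 / p) \<le> N" using N by simp
  then have "m powr (1 / p) \<le> N * \<phi> r" using \<phi> by (simp add: pos_divide_le_eq)
  then have "(m powr (1 / p)) powr p \<le> (N * \<phi> r) powr p" using p by (intro powr_mono2) auto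
  then have "m \<le> (N * \<phi> r) powr p" using p m by (simp add: powr_powr)
  then show ?thesis using r by (simp add: m_def pos_divide_le_eq mult.commute)
qed

theorem theorem5p1:
  fixes \<alpha> \<gamma> p q C\<^sub>0 :: real
    and \<rho> \<phi> :: "real \<Rightarrow> real"
  assumes "\<alpha> \<ge> - 1 / 2" and "\<gamma> > 0" and "1 < p" and "p < q"
    and "\<And>t. t > 0 \<Longrightarrow> \<rho> t > 0"
    and "doubling \<rho>"
    and "set_integrable lebesgue {0<..} (\<lambda>t. \<rho> t / t powr (\<gamma> - dunkl_dim \<alpha> + 1))"
    and "\<And>r. r > 0 \<Longrightarrow> \<phi> r > 0"
    and "\<phi> \<in> borel_measurable (lebesgue_on {0<..})"
    and "almost_decreasing \<phi>"
    and "almost_increasing (\<lambda>r. r powr (dunkl_dim \<alpha> / p) * \<phi> r)"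
    and "doubling \<phi>"
    and "\<phi> ` {0<..} = {0<..}"
    and "C\<^sub>0 > 0"
    and "\<And>r. r > 0 \<Longrightarrow>
           \<phi> r * (LINT t:{0<..<r}|lebesgue. \<rho> t / t powr (\<gamma> - dunkl_dim \<alpha> + 1))
           + (LINT t:{r<..}|lebesgue. \<rho> t * \<phi> t / t powr (\<gamma> - dunkl_dim \<alpha> + 1))
           \<le> C\<^sub>0 * \<phi> r powr (p / q)"
  shows "\<exists>C>0. \<forall>f \<in> dunkl_morrey_space \<alpha> p \<phi>.
           dunkl_bessel_riesz \<alpha> \<rho> \<gamma> f \<in> dunkl_morrey_space \<alpha> q (\<lambda>r. \<phi> r powr (p / q)) \<and>
           dunkl_morrey_norm \<alpha> q (\<lambda>r. \<phi> r powr (p / q)) (dunkl_bessel_riesz \<alpha> \<rho> \<gamma> f)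
             \<le> ennreal C * dunkl_morrey_norm \<alpha> p \<phi> f"
proof -
  note \<alpha> = assms(1) and p = assms(3) and pq = assms(4) and \<rho>0 = assms(5) and \<phi>0 = assms(8)
  have q: "1 < q" using p pq by simp
  define e where "e = \<gamma> - dunkl_dim \<alpha> + 1"
  define D where "D = 5 powr (2 * \<alpha> + 2)"
  interpret doubling_weight "dunkl_borel \<alpha>" "dunkl_weight \<alpha>" D
    unfolding D_def by (rule doubling_weight_dunkl[OF \<alpha>])
  let ?w = "dunkl_weight \<alpha>" and ?T = "dunkl_bessel_riesz \<alpha> \<rho> \<gamma>"
  let ?rd = "\<lambda>r. r powr dunkl_dim \<alpha>"
  have [measurable]: "ball x r \<in> sets borel" for x r :: real by simp
  obtain B where B0: "0 < B" and B: "\<And>r s. 0 < r \<Longrightarrow> r \<le> s \<Longrightarrow> \<phi> s \<le> B * \<phi> r"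
  proof -
    obtain c where c: "0 < c" "\<And>r s. 0 < r \<Longrightarrow> r \<le> s \<Longrightarrow> c * \<phi> s \<le> \<phi> r"
      using assms(10) unfolding almost_decreasing_def by auto
    show thesis
      by (rule that[of "1 / c"]) (use c in \<open>auto simp: field_simps\<close>)
  qed
  obtain \<rho>' where \<rho>'_meas [measurable]: "\<rho>' \<in> borel_measurable borel" and \<rho>'0: "\<And>s. 0 \<le> \<rho>' s"
    and \<rho>': "AE s in lborel. 0 < s \<longrightarrow> \<rho> s = \<rho>' s"
  proof -
    have "(\<lambda>t. (indicator {0<..} t *\<^sub>R (\<rho> t / t powr e)) * t powr e) \<in> borel_measurable lebesgue"
    proof (rule borel_measurable_times)
      show "(\<lambda>t. indicator {0<..} t *\<^sub>R (\<rho> t / t powr e)) \<in> borel_measurable lebesgue"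
        using assms(7) unfolding set_integrable_def e_def[symmetric] by (rule borel_measurable_integrable)
      show "(\<lambda>t. t powr e) \<in> borel_measurable lebesgue" by (rule measurable_completion) simp
    qed
    then obtain u where u: "u \<in> borel_measurable lborel"
      "AE t in lborel. (indicator {0<..} t *\<^sub>R (\<rho> t / t powr e)) * t powr e = u t"
      using completion_ex_borel_measurable_real by blast
    have [measurable]: "u \<in> borel_measurable borel" using u(1) by simp
    show thesis
    proof (rule that[of "\<lambda>s. max 0 (u s)"])
      show "AE s in lborel. 0 < s \<longrightarrow> \<rho> s = max 0 (u s)"
        using u(2)
      proof eventually_elim
        case (elim s)
        then show ?case using \<rho>0[of s] by (auto simp: max_def)
      qed
    qed auto
  qed
  obtain K where K0: "0 < K" and K: "\<And>g g' x r. \<lbrakk>0 < r; g' \<in> borel_measurable borel; \<And>z. 0 \<le> g' z; AE z in lborel. g z = g' z;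
       \<And>R. dunkl_ball \<alpha> g' 0 R < \<infinity>\<rbrakk> \<Longrightarrow>
     0 \<le> translated_integral \<alpha> x g r \<and>
     ennreal (translated_integral \<alpha> x g r)
       \<le> ennreal (K * (?rd r / ?w x r)) *
         (dunkl_ball \<alpha> g' x r + dunkl_ball \<alpha> g' (- x) r) \<and>
     dunkl_ball \<alpha> g' x (r / 2)
       \<le> ennreal (K * (?w x (r / 2) / ?rd r)) *
         ennreal (translated_integral \<alpha> x g r)"
    using dunkl_ball_mean_bounds[OF \<alpha>] by blast
  obtain J where J0: "0 < J" and J: "\<And>f f' x. \<lbrakk>f' \<in> borel_measurable borel; AE y in lborel. f y = f' y\<rbrakk> \<Longrightarrow>
       ennreal (cmod (?T f x))
         \<le> (\<integral>\<^sup>+s\<in>{0<..}. ennreal (J * (\<rho>' s / s powr e) / ?w x s) *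
             dunkl_ball \<alpha> (\<lambda>y. cmod (f' y) + cmod (f' (- y))) x s \<partial>lborel)"
    using dunkl_bessel_riesz_le[OF \<alpha> assms(2,6) \<rho>0 \<rho>'_meas \<rho>' \<rho>'0] unfolding e_def by blast
  define k where "k = (\<lambda>s. J * (\<rho>' s / s powr e))"
  have [measurable]: "k \<in> borel_measurable borel" unfolding k_def by measurable
  have k0: "0 \<le> k s" for s using J0 \<rho>'0[of s] by (simp add: k_def)
  have k_le: "ennreal (\<phi> r) * (\<integral>\<^sup>+s\<in>{0<..<r}. ennreal (k s) \<partial>lborel)
        + (\<integral>\<^sup>+s\<in>{r<..}. ennreal (k s * \<phi> s) \<partial>lebesgue) \<le> ennreal (J * C\<^sub>0 * \<phi> r powr (p / q))"
    if r: "0 < r" for r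
  proof -
    let ?u = "\<lambda>t. J * (\<rho> t / t powr e)"
    have ae: "AE s in lebesgue. 0 < s \<longrightarrow> k s = ?u s"
      by (rule AE_completion) (use \<rho>' in eventually_elim, simp add: k_def)
    have "ennreal (\<phi> r) * (\<integral>\<^sup>+s\<in>{0<..<r}. ennreal (k s) \<partial>lborel) + (\<integral>\<^sup>+s\<in>{r<..}. ennreal (k s * \<phi> s) \<partial>lebesgue)
      = ennreal (\<phi> r) * (\<integral>\<^sup>+s\<in>{0<..<r}. ennreal (?u s) \<partial>lebesgue) + (\<integral>\<^sup>+s\<in>{r<..}. ennreal (?u s * \<phi> s) \<partial>lebesgue)"
      unfolding nn_integral_completion[of lborel "\<lambda>s. ennreal (k s) * indicator {0<..<r} s", symmetric]
      by (intro arg_cong2[where f = "(+)"] arg_cong2[where f = "(*)"] refl nn_integral_cong_AE)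
         (use ae in \<open>eventually_elim, use r in \<open>auto simp: indicator_def\<close>\<close>)+
    also have "\<dots> \<le> ennreal (J * C\<^sub>0 * \<phi> r powr (p / q))"
    proof (rule kernel_condition_nn_integral[OF _ _ \<phi>0 assms(9) B r])
      show "0 \<le> ?u t" if "0 < t" for t using J0 \<rho>0[OF that] by simp
      show "set_integrable lebesgue {0<..} ?u"
        using assms(7) unfolding e_def[symmetric] by (rule set_integrable_mult_right)
      have "(LINT t:{0<..<r}|lebesgue. ?u t) = J * (LINT t:{0<..<r}|lebesgue. \<rho> t / t powr e)"
        by (rule set_integral_mult_right)
      moreover have "(LINT t:{r<..}|lebesgue. ?u t * \<phi> t) = J * (LINT t:{r<..}|lebesgue. \<rho> t * \<phi> t / t powr e)"
        by (subst set_integral_mult_right[symmetric]) (simp add: mult_ac)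
      ultimately have "\<phi> r * (LINT t:{0<..<r}|lebesgue. ?u t) + (LINT t:{r<..}|lebesgue. ?u t * \<phi> t)
        = J * (\<phi> r * (LINT t:{0<..<r}|lebesgue. \<rho> t / t powr e) + (LINT t:{r<..}|lebesgue. \<rho> t * \<phi> t / t powr e))"
        by (simp add: algebra_simps)
      also have "\<dots> \<le> J * (C\<^sub>0 * \<phi> r powr (p / q))"
        using J0 assms(15)[OF r] unfolding e_def[symmetric] by (intro mult_left_mono) auto
      finally show "\<phi> r * (LINT t:{0<..<r}|lebesgue. ?u t) + (LINT t:{r<..}|lebesgue. ?u t * \<phi> t)
        \<le> J * C\<^sub>0 * \<phi> r powr (p / q)" by (simp add: mult.assoc)
    qed
    finally show ?thesis .
  qed
  define H where "H = (2 * (J * C\<^sub>0)) powr q * ((2 powr p * D\<^sup>2 * p / (p - 1) + 2 powr p) * B powr p)"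
  define c where "c = (2 powr p * 2 * K) powr (1 / p) * B"
  define C where "C = (2 * K * H) powr (1 / q) * c"
  have H0: "0 < H" unfolding H_def using J0 assms(14) p B0 D_pos
    by (intro mult_pos_pos add_nonneg_pos) auto
  have c0: "0 < c" using K0 B0 by (simp add: c_def)
  have C0: "0 < C" using K0 H0 c0 by (simp add: C_def)
  have main: "locally_p_integrable \<alpha> q (?T f) \<and>
      dunkl_morrey_norm \<alpha> q (\<lambda>r. \<phi> r powr (p / q)) (?T f) \<le> ennreal (C * N)"
    if f: "locally_p_integrable \<alpha> p f" and N: "0 < N" "dunkl_morrey_norm \<alpha> p \<phi> f \<le> ennreal N" for f N
  proof -
    obtain f' where f'_meas [measurable]: "f' \<in> borel_measurable borel" and f': "AE y in lborel. f y = f' y"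
      using complex_borel_representative f unfolding locally_p_integrable_def by blast
    let ?g = "\<lambda>z. cmod (f z) powr p" and ?g' = "\<lambda>z. cmod (f' z) powr p" and ?h = "\<lambda>z. cmod (?T f z) powr q"
    have ball_f: "dunkl_ball \<alpha> ?g' x r
        \<le> ennreal (K * (?w x r * (N * (B * \<phi> r)) powr p))" if r: "0 < r" for x r
    proof -
      \<comment> \<open>The lower mean bound at radius \<open>2 * r\<close> controls the ball of radius \<open>r\<close>.\<close>
      let ?L = "translated_integral \<alpha> x ?g (2 * r)"
      have L: "0 \<le> ?L" "dunkl_ball \<alpha> ?g' x (2 * r / 2)
          \<le> ennreal (K * (?w x (2 * r / 2) / ?rd (2 * r))) * ennreal ?L"
      proof -
        have "AE z in lborel. cmod (f z) powr p = cmod (f' z) powr p"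
          using f' by eventually_elim simp
        from K[of "2 * r" ?g', OF _ _ _ this locally_p_integrable_nn_integral[OF f f'_meas f'], of x]
        show "0 \<le> ?L" "dunkl_ball \<alpha> ?g' x (2 * r / 2)
            \<le> ennreal (K * (?w x (2 * r / 2) / ?rd (2 * r))) * ennreal ?L"
          using r by auto
      qed
      have "?L \<le> ?rd (2 * r) * (N * \<phi> (2 * r)) powr p"
        using N r p \<phi>0 L(1) by (intro dunkl_morrey_normD) auto
      also have "\<dots> \<le> ?rd (2 * r) * (N * (B * \<phi> r)) powr p"
        using B[OF r, of "2 * r"] N r p \<phi>0[of "2 * r"] by (intro mult_left_mono powr_mono2) auto
      finally have "K * (?w x r / ?rd (2 * r)) * ?L \<le> K * (?w x r / ?rd (2 * r)) * (?rd (2 * r) * (N * (B * \<phi> r)) powr p)"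
        using K0 w_pos[OF r, of x] r by (intro mult_left_mono) auto
      also have "\<dots> = K * (?w x r * (N * (B * \<phi> r)) powr p)" using r by simp
      finally have "ennreal (K * (?w x r / ?rd (2 * r)) * ?L) \<le> ennreal (K * (?w x r * (N * (B * \<phi> r)) powr p))"
        by (rule ennreal_leI)
      moreover have "ennreal (K * (?w x r / ?rd (2 * r)) * ?L) = ennreal (K * (?w x r / ?rd (2 * r))) * ennreal ?L"
        using K0 w_pos[OF r, of x] r by (intro ennreal_mult') (auto intro!: mult_nonneg_nonneg divide_nonneg_nonneg)
      ultimately show ?thesis using L(2) by simp
    qed
    define F where "F = (\<lambda>y. cmod (f' y) + cmod (f' (- y)))"
    have [measurable]: "F \<in> borel_measurable borel" unfolding F_def by measurable
    have F0: "0 \<le> F y" for y by (simp add: F_def)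
    have ball_F: "dunkl_ball \<alpha> (\<lambda>y. F y powr p) x r \<le> ennreal (?w x r * ((c * N) * \<phi> r) powr p)"
      if r: "0 < r" for x r
    proof -
      let ?b = "K * (?w x r * (N * (B * \<phi> r)) powr p)"
      have "dunkl_ball \<alpha> (\<lambda>y. F y powr p) x r
          \<le> (\<integral>\<^sup>+y. ennreal (2 powr p) * (ennreal (cmod (f' y) powr p) * indicator (ball x r) y
               + ennreal (cmod (f' (- y)) powr p) * indicator (ball x r) y) \<partial>dunkl_borel \<alpha>)"
        using p powr_add_le[of "cmod (f' _)" "cmod (f' (- _))" p]
        by (intro nn_integral_mono) (auto simp: F_def indicator_def simp flip: ennreal_plus ennreal_mult intro!: ennreal_leI)
      also have "\<dots> = ennreal (2 powr p) * (dunkl_ball \<alpha> ?g' x r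
          + dunkl_ball \<alpha> (\<lambda>y. cmod (f' (- y)) powr p) x r)"
        by (subst nn_integral_cmult, measurable) (subst nn_integral_add, auto)
      also have "dunkl_ball \<alpha> (\<lambda>y. cmod (f' (- y)) powr p) x r
          = dunkl_ball \<alpha> ?g' (- x) r"
        by (subst (2) nn_integral_dunkl_borel_reflect[symmetric], measurable)
           (auto intro!: nn_integral_cong simp: indicator_def dist_real_def)
      also have "ennreal (2 powr p) * (dunkl_ball \<alpha> ?g' x r + \<dots>)
          \<le> ennreal (2 powr p) * (ennreal ?b + ennreal ?b)"
        using ball_f[OF r, of x] ball_f[OF r, of "- x"] by (intro mult_left_mono add_mono) auto
      also have "\<dots> = ennreal (2 powr p * (?b + ?b))"
        using K0 w_pos[OF r, of x] by (simp flip: ennreal_plus ennreal_mult)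
      also have "2 powr p * (?b + ?b) = ?w x r * ((c * N) * \<phi> r) powr p"
        using K0 B0 N p \<phi>0[OF r] by (simp add: c_def powr_mult powr_powr)
      finally show ?thesis .
    qed
    have T_meas [measurable]: "?T f \<in> borel_measurable borel"
      by (rule dunkl_bessel_riesz_borel[OF \<alpha> \<rho>'_meas f'_meas \<rho>' f'])
    have ball_T: "dunkl_ball \<alpha> ?h x r
        \<le> ennreal (H * (?w x r * ((c * N) powr q * \<phi> r powr p)))" if r: "0 < r" for x r
      unfolding H_def
    proof (rule Hedberg_Morrey[where F = F and k = k])
      show "ennreal (cmod (?T f x)) \<le> (\<integral>\<^sup>+s\<in>{0<..}. ennreal (k s / ?w x s) *
          dunkl_ball \<alpha> F x s \<partial>lborel)" for x
        using J[OF f'_meas f', of x] by (simp add: k_def F_def)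
    qed (use F0 k0 p pq \<phi>0 assms(9,13,14) B J0 k_le c0 N ball_F r in auto)
    have fin: "dunkl_ball \<alpha> ?h 0 R < \<infinity>" for R
    proof (cases "0 < R")
      case True
      show ?thesis by (rule le_less_trans[OF ball_T[OF True]]) simp
    qed (simp add: ball_empty)
    have "dunkl_morrey_norm \<alpha> q (\<lambda>r. \<phi> r powr (p / q)) (?T f) \<le> ennreal (C * N)"
      unfolding dunkl_morrey_norm_def
    proof (rule SUP_least)
      fix i :: "real \<times> real" assume "i \<in> {0<..} \<times> UNIV"
      then obtain r x where i: "i = (r, x)" and r: "0 < r" by auto
      let ?L = "translated_integral \<alpha> x ?h r"
      let ?S = "dunkl_ball \<alpha> ?h x r + dunkl_ball \<alpha> ?h (- x) r"
      let ?b = "H * (?w x r * ((c * N) powr q * \<phi> r powr p))"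
      have L: "0 \<le> ?L" "ennreal ?L \<le> ennreal (K * (?rd r / ?w x r)) * ?S"
        using K[OF r, of ?h ?h x] fin by auto
      note L(2)
      also have "ennreal (K * (?rd r / ?w x r)) * ?S
         \<le> ennreal (K * (?rd r / ?w x r)) * (ennreal ?b + ennreal ?b)"
        using ball_T[OF r, of x] ball_T[OF r, of "- x"] by (intro mult_left_mono add_mono) auto
      also have "\<dots> = ennreal (K * (?rd r / ?w x r) * (?b + ?b))"
        using K0 w_pos[OF r, of x] H0 by (simp flip: ennreal_plus ennreal_mult)
      also have "K * (?rd r / ?w x r) * (?b + ?b) = ?rd r * (2 * K * H * ((c * N) powr q * \<phi> r powr p))"
        using w_pos[OF r, of x] by simp
      finally have "?L \<le> ?rd r * (2 * K * H * ((c * N) powr q * \<phi> r powr p))"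
        using K0 H0 by (subst (asm) ennreal_le_iff) auto
      then have "1 / ?rd r * ?L \<le> 2 * K * H * ((c * N) powr q * \<phi> r powr p)"
        using r by (simp add: pos_divide_le_eq mult.commute)
      then have "(1 / ?rd r * ?L) powr (1 / q) \<le> (2 * K * H * ((c * N) powr q * \<phi> r powr p)) powr (1 / q)"
        using L(1) q by (intro powr_mono2) auto
      also have "\<dots> = C * N * \<phi> r powr (p / q)"
        using K0 H0 c0 N q \<phi>0[OF r] by (simp add: C_def powr_mult powr_powr)
      finally have "ennreal (1 / \<phi> r powr (p / q) * (1 / ?rd r * ?L) powr (1 / q)) \<le> ennreal (C * N)"
        using \<phi>0[OF r] by (intro ennreal_leI) (simp add: pos_divide_le_eq)
      then show "(case i of (r, x) \<Rightarrow> ennreal (1 / \<phi> r powr (p / q) * (1 / ?rd r *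
          translated_integral \<alpha> x ?h r) powr (1 / q)))
          \<le> ennreal (C * N)"
        unfolding i by simp
    qed
    moreover have "locally_p_integrable \<alpha> q (?T f)"
      by (rule locally_p_integrableI[OF \<alpha> T_meas fin])
    ultimately show ?thesis by blast
  qed
  show ?thesis
  proof (intro exI[of _ C] conjI ballI C0)
    fix f assume "f \<in> dunkl_morrey_space \<alpha> p \<phi>"
    then have f: "locally_p_integrable \<alpha> p f" "dunkl_morrey_norm \<alpha> p \<phi> f < \<infinity>"
      by (auto simp: dunkl_morrey_space_def)
    define n where "n = enn2real (dunkl_morrey_norm \<alpha> p \<phi> f)"
    have n: "0 \<le> n" "dunkl_morrey_norm \<alpha> p \<phi> f = ennreal n" using f(2) by (simp_all add: n_def)
    show le: "dunkl_morrey_norm \<alpha> q (\<lambda>r. \<phi> r powr (p / q)) (?T f) \<le> ennreal C * dunkl_morrey_norm \<alpha> p \<phi> f"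
    \<comment> \<open>\<open>N\<close> must be positive, but the norm of \<open>f\<close> may vanish; so it is approximated from above.\<close>
    proof (rule ennreal_le_epsilon)
      fix \<epsilon> :: real assume \<epsilon>: "0 < \<epsilon>"
      define N where "N = n + \<epsilon> / C"
      have N: "0 < N" "n \<le> N" using n \<epsilon> C0 by (auto simp: N_def add_nonneg_pos)
      have "dunkl_morrey_norm \<alpha> q (\<lambda>r. \<phi> r powr (p / q)) (?T f) \<le> ennreal (C * N)"
        using main[OF f(1) N(1)] N(2) by (simp add: n(2) ennreal_leI)
      also have "\<dots> = ennreal C * ennreal n + ennreal \<epsilon>"
        using C0 n \<epsilon> by (simp add: N_def distrib_left flip: ennreal_mult ennreal_plus)
      finally show "dunkl_morrey_norm \<alpha> q (\<lambda>r. \<phi> r powr (p / q)) (?T f) \<le> ennreal C * dunkl_morrey_norm \<alpha> p \<phi> f + ennreal \<epsilon>"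
        by (simp add: n(2))
    qed
    have "locally_p_integrable \<alpha> q (?T f)"
      using main[OF f(1), of "n + 1"] n by (simp add: ennreal_leI)
    moreover have "dunkl_morrey_norm \<alpha> q (\<lambda>r. \<phi> r powr (p / q)) (?T f) < \<infinity>"
      by (rule le_less_trans[OF le]) (simp add: n(2) ennreal_mult_less_top)
    ultimately show "?T f \<in> dunkl_morrey_space \<alpha> q (\<lambda>r. \<phi> r powr (p / q))"
      by (simp add: dunkl_morrey_space_def)
  qed
qed

end
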